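(* Let $(X,\mu)$ be a standard atomless probability space, let $\alpha$ be either a positive real number or $+\infty$, and let $S\in\mathrm{Aut}(X,\mu)$ be an odometer whose associated supernatural number $\prod_{p\in\Pi}p^{k_p}$ satisfies the following property: there exists a prime number $p_\star$ such that $k_{p_\star}=+\infty$. Then there exists a probability measure-preserving transformation $T\in\mathrm{Aut}(X,\mu)$ such that 1. $\mathrm{h}_\mu(T)=\alpha$; 2. there exists an orbit equivalence between $S$ and $T$ which is $\varphi_m$-integrable for all integers $m\geq 0$, where $\varphi_m$ denotes the map $t\mapsto\frac{\log t}{\log^{(\circ m)}t}$ and $\log^{(\circ m)}$ is the composition $\log\circ\cdots\circ\log$ ($m$ times).
   Context: $\mathrm{Aut}(X,\mu)$ is the group of bimeasurable $\mu$-preserving bijections of $(X,\mu)$, up to null sets. $\mathrm{h}_\mu$ is the measure-theoretic (Kolmogorov–Sinai) entropy. Odometers. For integers $q_n\geq 2$ ($n\ge 0$), the odometer on $\prod_{n\geq 0}\{0,\ldots,q_n-1\}$, equipped with the product of the uniform measures, is the addition of $(1,0,0,\ldots)$ with carry over to the right. An odometer is a system conjugate to such a map for some choice of integers $q_n$. Its supernatural number is the formal product $\prod_{p\in\Pi}p^{k_p}$ over the set $\Pi$ of primes, with $k_p=\sum_{n\geq 0}\nu_p(q_n)\in\mathbb{N}\cup\{+\infty\}$, where $\nu_p$ is the $p$-adic valuation; it depends only on the conjugacy class. Orbit equivalence. An orbit equivalence between aperiodic $S,T\in\mathrm{Aut}(X,\mu)$ is a $\mu$-preserving bimeasurable bijection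 $\Psi\colon X\to X$ such that $S$ and $\Psi^{-1}T\Psi$ have the same orbit at almost every point. Its cocycles are the functions $c_S,c_T\colon X\to\mathbb{Z}$ given almost everywhere by $Sx=\Psi^{-1}T^{c_S(x)}\Psi(x)$ and $Ty=\Psi S^{c_T(y)}\Psi^{-1}(y)$. For $\varphi\colon\mathbb{R}_+\to\mathbb{R}_+$, it is $\varphi$-integrable if $\int_X\varphi(|c_S|)\,d\mu<+\infty$ and $\int_X\varphi(|c_T|)\,d\mu<+\infty$. Convention: $\log^{(\circ 0)}t=t$. The expression for $\varphi_m(t)$ is used for $t$ large enough (where $\log^{(\circ m)}t$ is defined and positive, and $\log t\ge 0$); on the remaining bounded set of values of $t$, $\varphi_m$ is extended by arbitrary bounded non-negative values, which does not affect integrability. *)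

theory Defs
  imports "HOL-Probability.Probability" "HOL-Computational_Algebra.Primes"
begin

section \<open>Standard atomless probability spaces and their automorphisms\<close>

definition standard_borel_space :: "'a measure \<Rightarrow> bool" where
  "standard_borel_space M \<longleftrightarrow>
    (\<exists>X. completely_metrizable_space X \<and> second_countable X \<and> topspace X = space M \<and>
         sets M = sigma_sets (space M) {U. openin X U})"

definition atomless :: "'a measure \<Rightarrow> bool" where
  "atomless M \<longleftrightarrow>
    (\<forall>A\<in>sets M. emeasure M A > 0 \<longrightarrow>
       (\<exists>B\<in>sets M. B \<subseteq> A \<and> 0 < emeasure M B \<and> emeasure M B < emeasure M A))"

definition standard_atomless_prob_space :: "'a measure \<Rightarrow> bool" where
  "standard_atomless_prob_space M \<longleftrightarrow> prob_space M \<and> standard_borel_space M \<and> atomless M"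

text \<open>Elements of \<open>Aut M\<close> are everywhere defined representatives; all notions below are
  insensitive to changing them on null sets. The values of a map outside \<open>space M\<close> are
  irrelevant, so inverses are always taken relative to \<open>space M\<close>.\<close>

abbreviation inv_map :: "'a measure \<Rightarrow> ('a \<Rightarrow> 'a) \<Rightarrow> 'a \<Rightarrow> 'a" where
  "inv_map M T \<equiv> inv_into (space M) T"

definition Aut :: "'a measure \<Rightarrow> ('a \<Rightarrow> 'a) set" where
  "Aut M = {T. bij_betw T (space M) (space M) \<and> T \<in> measurable M M \<and>
               inv_map M T \<in> measurable M M \<and> distr M M T = M}"

definition zpow :: "'a measure \<Rightarrow> ('a \<Rightarrow> 'a) \<Rightarrow> int \<Rightarrow> 'a \<Rightarrow> 'a" where
  "zpow M T k = (if k \<ge> 0 then T ^^ nat k else inv_map M T ^^ nat (- k))"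

definition orbit_of :: "'a measure \<Rightarrow> ('a \<Rightarrow> 'a) \<Rightarrow> 'a \<Rightarrow> 'a set" where
  "orbit_of M T x = range (\<lambda>k. zpow M T k x)"

definition aperiodic :: "'a measure \<Rightarrow> ('a \<Rightarrow> 'a) \<Rightarrow> bool" where
  "aperiodic M T \<longleftrightarrow> (AE x in M. \<forall>n>0. (T ^^ n) x \<noteq> x)"

text \<open>Conjugacy: an isomorphism of measure spaces between conull sets, intertwining the two
  maps almost everywhere.\<close>

definition conjugate_systems ::
  "'a measure \<Rightarrow> ('a \<Rightarrow> 'a) \<Rightarrow> 'b measure \<Rightarrow> ('b \<Rightarrow> 'b) \<Rightarrow> bool" where
  "conjugate_systems M S N T \<longleftrightarrow>
    (\<exists>A\<in>sets M. \<exists>B\<in>sets N. \<exists>\<Phi>.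
       (AE x in M. x \<in> A) \<and> (AE y in N. y \<in> B) \<and> bij_betw \<Phi> A B \<and>
       \<Phi> \<in> measurable (restrict_space M A) (restrict_space N B) \<and>
       inv_into A \<Phi> \<in> measurable (restrict_space N B) (restrict_space M A) \<and>
       distr (restrict_space M A) (restrict_space N B) \<Phi> = restrict_space N B \<and>
       (AE x in M. S x \<in> A \<and> \<Phi> (S x) = T (\<Phi> x)))"

section \<open>Kolmogorov--Sinai entropy\<close>

definition finite_measurable_partition :: "'a measure \<Rightarrow> 'a set set \<Rightarrow> bool" where
  "finite_measurable_partition M P \<longleftrightarrow> finite P \<and> P \<subseteq> sets M \<and> partition_on (space M) P"

text \<open>Null cells contribute \<open>0\<close>, as required.\<close>

definition partition_entropy :: "'a measure \<Rightarrow> 'a set set \<Rightarrow> real" where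
  "partition_entropy M P = (\<Sum>A\<in>P. - measure M A * ln (measure M A))"

text \<open>The join of \<open>T\<^sup>-\<^sup>i P\<close> for \<open>i < n\<close>. The empty set may occur as an
  additional cell, which does not affect the entropy.\<close>

definition iterated_join ::
  "'a measure \<Rightarrow> ('a \<Rightarrow> 'a) \<Rightarrow> 'a set set \<Rightarrow> nat \<Rightarrow> 'a set set" where
  "iterated_join M T P n =
    {space M \<inter> (\<Inter>i<n. (T ^^ i) -` A i) | A. \<forall>i<n. A i \<in> P}"

definition entropy_wrt_partition :: "'a measure \<Rightarrow> ('a \<Rightarrow> 'a) \<Rightarrow> 'a set set \<Rightarrow> real" where
  "entropy_wrt_partition M T P =
    lim (\<lambda>n. partition_entropy M (iterated_join M T P n) / real n)"

definition KS_entropy :: "'a measure \<Rightarrow> ('a \<Rightarrow> 'a) \<Rightarrow> ereal" where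
  "KS_entropy M T =
    (SUP P \<in> {P. finite_measurable_partition M P}. ereal (entropy_wrt_partition M T P))"

section \<open>Odometers\<close>

definition odometer_space :: "(nat \<Rightarrow> nat) \<Rightarrow> (nat \<Rightarrow> nat) measure" where
  "odometer_space q = PiM UNIV (\<lambda>n. uniform_count_measure {0..<q n})"

text \<open>\<open>carry q x y n\<close> is the carry entering digit \<open>n\<close> when adding \<open>x\<close> and \<open>y\<close>.\<close>

primrec carry :: "(nat \<Rightarrow> nat) \<Rightarrow> (nat \<Rightarrow> nat) \<Rightarrow> (nat \<Rightarrow> nat) \<Rightarrow> nat \<Rightarrow> nat" where
  "carry q x y 0 = 0"
| "carry q x y (Suc n) = (x n + y n + carry q x y n) div q n"

definition add_with_carry ::
  "(nat \<Rightarrow> nat) \<Rightarrow> (nat \<Rightarrow> nat) \<Rightarrow> (nat \<Rightarrow> nat) \<Rightarrow> nat \<Rightarrow> nat" where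
  "add_with_carry q x y n = (x n + y n + carry q x y n) mod q n"

definition odometer_map :: "(nat \<Rightarrow> nat) \<Rightarrow> (nat \<Rightarrow> nat) \<Rightarrow> nat \<Rightarrow> nat" where
  "odometer_map q x = add_with_carry q x (\<lambda>n. if n = 0 then 1 else 0)"

definition odometer_with_digits :: "'a measure \<Rightarrow> ('a \<Rightarrow> 'a) \<Rightarrow> (nat \<Rightarrow> nat) \<Rightarrow> bool" where
  "odometer_with_digits M S q \<longleftrightarrow>
    (\<forall>n. q n \<ge> 2) \<and> conjugate_systems M S (odometer_space q) (odometer_map q)"

text \<open>The exponent of the prime \<open>p\<close> in the supernatural number of the odometer given by
  \<open>q\<close>.\<close>

definition supernatural_exponent :: "(nat \<Rightarrow> nat) \<Rightarrow> nat \<Rightarrow> enat" where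
  "supernatural_exponent q p = (\<Sum>n. enat (multiplicity p (q n)))"

section \<open>Quantitative orbit equivalence\<close>

definition orbit_equivalence ::
  "'a measure \<Rightarrow> ('a \<Rightarrow> 'a) \<Rightarrow> ('a \<Rightarrow> 'a) \<Rightarrow> ('a \<Rightarrow> 'a) \<Rightarrow> bool" where
  "orbit_equivalence M S T \<Psi> \<longleftrightarrow>
    aperiodic M S \<and> aperiodic M T \<and> \<Psi> \<in> Aut M \<and>
    (AE x in M. orbit_of M S x = orbit_of M (inv_map M \<Psi> \<circ> T \<circ> \<Psi>) x)"

text \<open>The cocycles are determined almost everywhere by aperiodicity; measurable versions
  are required since the integral of a non-measurable function would only be a lower
  integral.\<close>

definition orbit_equivalence_cocycles ::
  "'a measure \<Rightarrow> ('a \<Rightarrow> 'a) \<Rightarrow> ('a \<Rightarrow> 'a) \<Rightarrow> ('a \<Rightarrow> 'a) \<Rightarrow> ('a \<Rightarrow> int) \<Rightarrow> ('a \<Rightarrow> int) \<Rightarrow> bool" where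
  "orbit_equivalence_cocycles M S T \<Psi> cS cT \<longleftrightarrow>
    cS \<in> measurable M (count_space UNIV) \<and> cT \<in> measurable M (count_space UNIV) \<and>
    (AE x in M. S x = inv_map M \<Psi> (zpow M T (cS x) (\<Psi> x))) \<and>
    (AE y in M. T y = \<Psi> (zpow M S (cT y) (inv_map M \<Psi> y)))"

definition integrable_orbit_equivalence ::
  "(real \<Rightarrow> real) \<Rightarrow> 'a measure \<Rightarrow> ('a \<Rightarrow> 'a) \<Rightarrow> ('a \<Rightarrow> 'a) \<Rightarrow> ('a \<Rightarrow> 'a) \<Rightarrow> bool" where
  "integrable_orbit_equivalence \<phi> M S T \<Psi> \<longleftrightarrow>
    orbit_equivalence M S T \<Psi> \<and>
    (\<exists>cS cT. orbit_equivalence_cocycles M S T \<Psi> cS cT \<and>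
       (\<integral>\<^sup>+x. ennreal (\<phi> (real_of_int \<bar>cS x\<bar>)) \<partial>M) < \<infinity> \<and>
       (\<integral>\<^sup>+x. ennreal (\<phi> (real_of_int \<bar>cT x\<bar>)) \<partial>M) < \<infinity>)"

text \<open>The \<open>m\<close>-fold iterated logarithm of \<open>t\<close> is defined (as a real) and positive iff all
  \<open>(ln ^^ k) t\<close> with \<open>k \<le> m\<close> are positive. On the remaining bounded set of \<open>t \<ge> 0\<close>, where
  any bounded non-negative values would do, the value \<open>0\<close> is chosen.\<close>

definition phi :: "nat \<Rightarrow> real \<Rightarrow> real" where
  "phi m t =
    (if (\<forall>k\<le>m. (ln ^^ k) t > 0) \<and> ln t \<ge> 0 then ln t / (ln ^^ m) t else 0)"

end

theory Submission
  imports Defs "HOL-Combinatorics.Permutations"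
begin

text \<open>The transformation \<open>T\<close> is an odomutant in the sense of Correia, that is, a measurable version
  of a construction of Boyle and Handelman. Cut the odometer \<open>S\<close> along
  towers of heights \<open>h\<^sub>0 | h\<^sub>1 | \<dots>\<close>, where \<open>h\<^sub>n\<^sub>+\<^sub>1 = h\<^sub>n q\<^sub>n\<close>. The map \<open>T\<close> has the same towers, but
  in the tower of height \<open>h\<^sub>n\<^sub>+\<^sub>1\<close> with index \<open>b < q\<^sub>n\<^sub>+\<^sub>1\<close> it runs through the \<open>q\<^sub>n\<close> subtowers of
  height \<open>h\<^sub>n\<close> in an order depending on \<open>b\<close>, and as \<open>b\<close> varies every order is used about equally often.

  The itinerary of a point along a tower of height \<open>h\<^sub>n\<close> is one of \<open>q\<^sub>n\<close> words, so the entropy of \<open>T\<close>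
  is at most \<open>ln q\<^sub>n / h\<^sub>n\<close>. Conversely, few towers carry the same word and the words read along
  consecutive towers are almost independent, so the entropy is the limit of these quantities.
  Since the prime \<open>p\<close> occurs infinitely often in the supernatural number, \<open>q\<^sub>n\<close> can be
  chosen within a factor \<open>p\<close> of any prescribed number, and taking it close to \<open>exp (\<alpha> h\<^sub>n)\<close>
  (or to \<open>exp ((n + 1) h\<^sub>n)\<close> if \<open>\<alpha> = \<infinity>\<close>) gives entropy \<open>\<alpha>\<close>.

  The cocycles exceed \<open>h\<^sub>n\<close> only on sets of measure \<open>1 / h\<^sub>n\<close>, where they are at most \<open>h\<^sub>n\<^sub>+\<^sub>1\<close>
  outside a set of measure \<open>1 / h\<^sub>n\<^sub>+\<^sub>1\<close>. As \<open>ln h\<^sub>n\<^sub>+\<^sub>1\<close> is about \<open>\<alpha> h\<^sub>n\<close> (or \<open>(n + 1) h\<^sub>n\<close>), the integral of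
  \<open>\<phi>\<^sub>m\<close> of a cocycle is bounded by a sum of reciprocals of iterated logarithms of the heights,
  which converges because the heights grow like iterated exponentials.\<close>

section \<open>Entropy of finite-valued random variables\<close>

text \<open>Two demands compete. All orders of the \<open>q n\<close> subtowers must occur about
  equally often among the \<open>q (Suc n)\<close> towers of the next height, which forces
  \<open>fact (q n) \<le> q (Suc n)\<close>, while \<open>ln (q n) / h n\<close> must stay near the
  prescribed entropy. They are compatible because ln (q!) is q ln q up to an error of order q: if
  \<open>q n\<close> is about exp (a h), then exp (a h q) is about q ^ q. Divided by
  \<open>h (Suc n) = h n * q n\<close>, the error costs only order 1 / \<open>h n\<close> of
  entropy, and all losses from level n on add up to at most 4 / \<open>h n\<close>. The orbit
  equivalence is the identity. A tower of T with index a consists of the \<open>h n\<close>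
  consecutive odometer levels with quotient a, merely rearranged, so T and S move points within such
  a block until its top is reached; this bounds both cocycles. For finite entropy the residues
  modulo the heights must also generate all measurable sets, so every finite quotient of the
  odometer has to divide some height. The factors other than the distinguished prime are inserted
  without control of their size, and powers of that prime restore the size afterwards.\<close>

lemma fekete:
  fixes a :: "nat \<Rightarrow> real"
  assumes sub: "\<And>m n. a (m + n) \<le> a m + a n" and nn: "\<And>n. 0 \<le> a n"
  shows "(\<lambda>n. a n / n) \<longlonglongrightarrow> (INF n\<in>{0<..}. a n / n)"
proof (rule LIMSEQ_I)
  define l where "l = (INF n\<in>{0<..}. a n / n)"
  have bdd: "bdd_below ((\<lambda>n. a n / real n) ` {0<..})"
    by (rule bdd_belowI[of _ 0]) (auto simp: nn)
  fix e :: real assume e: "0 < e"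
  have "\<exists>x\<in>(\<lambda>n. a n / real n) ` {0<..}. x < l + e / 2"
    by (rule cInf_lessD) (use e in \<open>auto simp: l_def\<close>)
  then obtain k where k: "0 < k" "a k / k < l + e / 2" by auto
  \<comment> \<open>The remainder \<open>n mod k\<close> costs at most \<open>C\<close>, which
    vanishes after division by n; the multiple of k costs the nearly optimal average
    \<open>a k / k\<close>.\<close>
  define C where "C = Max (a ` {..<k})"
  have C: "a r \<le> C" if "r < k" for r unfolding C_def using that by (intro Max_ge) auto
  have mult: "a (j * k + r) \<le> j * a k + a r" for j r
  proof (induction j)
    case (Suc j)
    have "a (Suc j * k + r) = a (k + (j * k + r))" by (simp add: algebra_simps)
    also have "\<dots> \<le> a k + a (j * k + r)" by (rule sub)
    finally show ?case using Suc by (simp add: algebra_simps)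
  qed auto
  obtain n0 :: nat where n0: "2 * C / e < n0" using reals_Archimedean2 by blast
  show "\<exists>no. \<forall>n\<ge>no. norm (a n / n - (INF n\<in>{0<..}. a n / n)) < e"
  proof (intro exI allI impI)
    fix n assume n: "max 1 n0 \<le> n"
    then have npos: "0 < real n" by auto
    have "a n \<le> (n div k) * a k + a (n mod k)" using mult[of "n div k" "n mod k"] by simp
    also have "\<dots> \<le> (n / k) * a k + C"
    proof (intro add_mono mult_right_mono C nn)
      show "n mod k < k" using k by simp
      show "real (n div k) \<le> real n / real k" by (rule of_nat_div_le_of_nat)
    qed
    finally have "a n / n \<le> a k / k + C / n" using npos by (simp add: field_simps)
    moreover have "C / n < e / 2"
    proof -
      have "2 * C / e < n" using n0 n by linarith
      then show ?thesis using e npos by (simp add: field_simps)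
    qed
    ultimately have "a n / n < l + e" using k by linarith
    moreover have "l \<le> a n / n" unfolding l_def by (rule cINF_lower[OF bdd]) (use n in auto)
    ultimately show "norm (a n / n - (INF n\<in>{0<..}. a n / n)) < e" unfolding l_def by simp
  qed
qed

text \<open>Partitions are treated as level sets of random variables, so that the chain rule and
  data processing of the library's information theory apply. Base \<open>exp 1\<close> there
  corresponds to the natural logarithm here.\<close>

definition rv_entropy :: "'a measure \<Rightarrow> ('a \<Rightarrow> 'b) \<Rightarrow> real" where
  "rv_entropy M X =
    (\<Sum>v\<in>X ` space M. - measure M (X -` {v} \<inter> space M) * ln (measure M (X -` {v} \<inter> space M)))"

definition itinerary :: "('a \<Rightarrow> 'a) \<Rightarrow> ('a \<Rightarrow> 'b) \<Rightarrow> nat \<Rightarrow> 'a \<Rightarrow> 'b list" where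
  "itinerary T X n x = map (\<lambda>i. X ((T ^^ i) x)) [0..<n]"

lemma simple_function_level: "simple_function M X \<Longrightarrow> X -` V \<inter> space M \<in> sets M"
  by (metis simple_functionD(2))

context prob_space
begin

lemma rv_entropy_eq_entropy:
  assumes "simple_function M X"
  shows "rv_entropy M X = entropy (exp 1) (count_space (X ` space M)) X"
proof -
  interpret information_space M "exp 1" by unfold_locales simp
  show ?thesis
    using entropy_simple_distributed[OF simple_distributedI[OF assms measure_nonneg refl]]
    unfolding rv_entropy_def log_def by (simp add: sum_negf)
qed

lemma rv_entropy_superset:
  assumes "finite V" "X ` space M \<subseteq> V"
  shows "rv_entropy M X = (\<Sum>v\<in>V. - prob (X -` {v} \<inter> space M) * ln (prob (X -` {v} \<inter> space M)))"
  unfolding rv_entropy_def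
proof (intro sum.mono_neutral_left assms ballI)
  fix v assume "v \<in> V - X ` space M"
  then have "X -` {v} \<inter> space M = {}" by auto
  then show "- prob (X -` {v} \<inter> space M) * ln (prob (X -` {v} \<inter> space M)) = 0" by simp
qed

lemma rv_entropy_cong_AE:
  assumes X: "simple_function M X" and Y: "simple_function M Y" and "AE x in M. X x = Y x"
  shows "rv_entropy M X = rv_entropy M Y"
proof -
  let ?V = "X ` space M \<union> Y ` space M"
  have fin: "finite ?V" using X Y by (simp add: simple_functionD)
  have "prob (X -` {v} \<inter> space M) = prob (Y -` {v} \<inter> space M)" for v
  proof (rule finite_measure_eq_AE)
    show "AE x in M. (x \<in> X -` {v} \<inter> space M) = (x \<in> Y -` {v} \<inter> space M)"
      using assms(3) by eventually_elim auto
  qed (use X Y in \<open>auto intro: simple_function_level\<close>)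
  then show ?thesis using rv_entropy_superset[OF fin, of X] rv_entropy_superset[OF fin, of Y] by simp
qed

lemma rv_entropy_le_AE:
  assumes X: "simple_function M X" and Y: "simple_function M Y" and "AE x in M. X x = f (Y x)"
  shows "rv_entropy M X \<le> rv_entropy M Y"
proof -
  interpret information_space M "exp 1" by unfold_locales simp
  have fY: "simple_function M (f \<circ> Y)" using Y by (rule simple_function_compose)
  have "rv_entropy M X = rv_entropy M (f \<circ> Y)"
    by (rule rv_entropy_cong_AE[OF X fY]) (use assms(3) in simp)
  also have "\<dots> \<le> rv_entropy M Y"
    unfolding rv_entropy_eq_entropy[OF Y] rv_entropy_eq_entropy[OF fY] by (rule entropy_data_processing[OF Y])
  finally show ?thesis .
qed

lemma rv_entropy_pair_le:
  assumes X: "simple_function M X" and Y: "simple_function M Y"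
  shows "rv_entropy M (\<lambda>x. (X x, Y x)) \<le> rv_entropy M X + rv_entropy M Y"
proof -
  interpret information_space M "exp 1" by unfold_locales simp
  show ?thesis
    unfolding rv_entropy_eq_entropy[OF Y] rv_entropy_eq_entropy[OF X] rv_entropy_eq_entropy[OF simple_function_Pair[OF X Y]]
    using entropy_chain_rule[OF X Y] conditional_entropy_less_eq_entropy[OF Y X] by simp
qed

lemma prob_mult_ln_nonpos: "prob A * ln (prob A) \<le> 0"
proof (cases "prob A = 0")
  case False
  then have "0 < prob A" using measure_nonneg by (simp add: less_le)
  then show ?thesis by (simp add: mult_nonneg_nonpos)
qed simp

lemma rv_entropy_nonneg: "0 \<le> rv_entropy M X"
  unfolding rv_entropy_def by (auto intro!: sum_nonneg simp: prob_mult_ln_nonpos)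

lemma rv_entropy_le_ln_card:
  assumes X: "simple_function M X" and C: "finite C" and AE: "AE x in M. X x \<in> C"
  shows "rv_entropy M X \<le> ln (card C)"
proof -
  interpret information_space M "exp 1" by unfold_locales simp
  have "C \<noteq> {}"
  proof
    assume "C = {}"
    then have "AE x in M. False" using AE by simp
    then show False by simp
  qed
  then obtain c0 where c0: "c0 \<in> C" by blast
  \<comment> \<open>Redirecting the values outside \<open>C\<close> to \<open>c0\<close> changes
    \<open>X\<close> only on a null set and puts the whole range inside \<open>C\<close>.\<close>
  define f where "f = (\<lambda>v. if v \<in> C then v else c0)"
  have fX: "simple_function M (f \<circ> X)" using X by (rule simple_function_compose)
  have "rv_entropy M X = rv_entropy M (f \<circ> X)"
    by (rule rv_entropy_cong_AE[OF X fX]) (use AE in \<open>eventually_elim, simp add: f_def\<close>)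
  also have "\<dots> \<le> ln (card ((f \<circ> X) ` space M))"
    unfolding rv_entropy_eq_entropy[OF fX]
    using entropy_le_card[OF simple_distributedI[OF fX measure_nonneg refl]] by (simp add: log_def)
  also have "\<dots> \<le> ln (card C)"
  proof -
    have "(f \<circ> X) ` space M \<subseteq> C" using c0 by (auto simp: f_def)
    then have "card ((f \<circ> X) ` space M) \<le> card C" by (rule card_mono[OF C])
    moreover have "card ((f \<circ> X) ` space M) > 0" using simple_functionD(1)[OF fX] not_empty by (simp add: card_gt_0_iff del: image_comp)
    ultimately show ?thesis by simp
  qed
  finally show ?thesis .
qed

lemma rv_entropy_compose:
  assumes X: "simple_function M X" and T: "T \<in> measurable M M" "distr M M T = M"
  shows "rv_entropy M (\<lambda>x. X (T x)) = rv_entropy M X"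
proof -
  have "(\<lambda>x. X (T x)) ` space M \<subseteq> X ` space M" using measurable_space[OF T(1)] by auto
  moreover have "prob ((\<lambda>x. X (T x)) -` {v} \<inter> space M) = prob (X -` {v} \<inter> space M)" for v
  proof -
    have "(\<lambda>x. X (T x)) -` {v} \<inter> space M = T -` (X -` {v} \<inter> space M) \<inter> space M"
      using measurable_space[OF T(1)] by auto
    then show ?thesis
      using measure_distr[OF T(1) simple_function_level[OF X]] T(2) by metis
  qed
  ultimately show ?thesis
    using rv_entropy_superset[of "X ` space M" "\<lambda>x. X (T x)"] X unfolding rv_entropy_def[of M X]
    by (simp add: simple_functionD)
qed

text \<open>\<open>Y\<close> forgets \<open>X\<close> outside \<open>G\<close>. Each cell inside
  \<open>G\<close> has mass at most \<open>P\<close> and so contributes at least its mass times - ln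
  P. The term \<open>ln 2\<close> pays for the indicator of \<open>G\<close>, which together with
  \<open>X\<close> determines \<open>Y\<close>.\<close>

lemma rv_entropy_ge:
  assumes X: "simple_function M X" and G: "G \<in> events" and "0 < P"
    and P: "\<And>w. prob (X -` {w} \<inter> G) \<le> P"
  shows "prob G * (- ln P) - ln 2 \<le> rv_entropy M X"
proof -
  let ?I = "\<lambda>x. x \<in> G"
  define Y where "Y = (\<lambda>x. if x \<in> G then Some (X x) else None)"
  have I: "simple_function M ?I"
    unfolding simple_function_def
  proof (intro conjI ballI)
    fix b
    have "?I -` {b} \<inter> space M = (if b then G else space M - G)"
      using G sets.sets_into_space by auto
    then show "?I -` {b} \<inter> space M \<in> sets M" using G by auto
  qed simp
  have XI: "simple_function M (\<lambda>x. (X x, ?I x))" using X I by (rule simple_function_Pair)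
  have Y: "simple_function M Y"
    using simple_function_compose[OF XI, of "\<lambda>(v, b). if b then Some v else None"]
    by (simp add: Y_def comp_def)
  have GM: "G \<subseteq> space M" using G sets.sets_into_space by blast
  let ?V = "insert None (Some ` X ` space M)"
  let ?\<eta> = "\<lambda>v. - prob (Y -` {v} \<inter> space M) * ln (prob (Y -` {v} \<inter> space M))"
  have finX: "finite (X ` space M)" using X by (simp add: simple_functionD)
  have lev: "Y -` {Some w} \<inter> space M = X -` {w} \<inter> G" for w using GM by (auto simp: Y_def split: if_splits)
  have "prob G = (\<Sum>w\<in>X ` space M. prob (X -` {w} \<inter> G))"
  proof -
    have "G = (\<Union>w\<in>X ` space M. X -` {w} \<inter> G)" using GM by auto
    then have "prob G = prob (\<Union>w\<in>X ` space M. X -` {w} \<inter> G)" by simp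
    also have "\<dots> = (\<Sum>w\<in>X ` space M. prob (X -` {w} \<inter> G))"
    proof (intro finite_measure_finite_Union finX)
      have "X -` {w} \<inter> G = (X -` {w} \<inter> space M) \<inter> G" for w using GM by auto
      then show "(\<lambda>w. X -` {w} \<inter> G) ` X ` space M \<subseteq> events"
        using simple_function_level[OF X] G by auto
    qed (auto simp: disjoint_family_on_def)
    finally show ?thesis .
  qed
  then have "prob G * (- ln P) = (\<Sum>w\<in>X ` space M. prob (X -` {w} \<inter> G) * (- ln P))"
    by (simp add: sum_distrib_right sum_negf)
  also have "\<dots> \<le> (\<Sum>w\<in>X ` space M. ?\<eta> (Some w))"
  proof (intro sum_mono)
    fix w
    show "prob (X -` {w} \<inter> G) * (- ln P) \<le> ?\<eta> (Some w)"
    proof (cases "prob (X -` {w} \<inter> G) = 0")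
      case False
      then have pos: "0 < prob (X -` {w} \<inter> G)" using measure_nonneg by (simp add: less_le)
      then have "ln (prob (X -` {w} \<inter> G)) \<le> ln P" using P[of w] \<open>0 < P\<close> by simp
      then show ?thesis unfolding lev using pos by simp
    qed (simp add: lev)
  qed
  also have "\<dots> = (\<Sum>v\<in>Some ` X ` space M. ?\<eta> v)" by (subst sum.reindex) auto
  also have "\<dots> \<le> (\<Sum>v\<in>?V. ?\<eta> v)"
    by (intro sum_mono2) (use finX in \<open>auto simp: prob_mult_ln_nonpos\<close>)
  also have "\<dots> = rv_entropy M Y"
    by (rule rv_entropy_superset[symmetric]) (use finX in \<open>auto simp: Y_def\<close>)
  also have "\<dots> \<le> rv_entropy M (\<lambda>x. (X x, ?I x))"
    by (rule rv_entropy_le_AE[OF Y XI, of "\<lambda>(v, b). if b then Some v else None"]) (simp add: Y_def)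
  also have "\<dots> \<le> rv_entropy M X + rv_entropy M ?I" by (rule rv_entropy_pair_le[OF X I])
  also have "rv_entropy M ?I \<le> ln (card (UNIV :: bool set))" by (rule rv_entropy_le_ln_card[OF I]) auto
  finally show ?thesis by (simp add: card_UNIV_bool)
qed

end

section \<open>Powers of automorphisms and full groups\<close>

lemma zpow_0 [simp]: "zpow M f 0 x = x"
  by (simp add: zpow_def)

context
  fixes M :: "'a measure" and f :: "'a \<Rightarrow> 'a"
  assumes bij: "bij_betw f (space M) (space M)"
begin

lemma inv_map_in_space: "x \<in> space M \<Longrightarrow> inv_map M f x \<in> space M"
  using bij by (metis bij_betw_imp_surj_on inv_into_into)

lemma zpow_in_space: "x \<in> space M \<Longrightarrow> zpow M f k x \<in> space M"
proof -
  have "(g ^^ n) x \<in> space M" if "x \<in> space M" "\<And>y. y \<in> space M \<Longrightarrow> g y \<in> space M" for n and g :: "'a \<Rightarrow> 'a"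
    by (induction n) (use that in auto)
  then show "x \<in> space M \<Longrightarrow> zpow M f k x \<in> space M"
    using inv_map_in_space bij_betwE[OF bij] by (auto simp: zpow_def)
qed

lemma zpow_plus_one:
  assumes x: "x \<in> space M"
  shows "zpow M f (k + 1) x = f (zpow M f k x)"
proof (cases "0 \<le> k")
  case True
  then show ?thesis by (simp add: zpow_def nat_add_distrib)
next
  case False
  define n where "n = nat (- (k + 1))"
  have k: "nat (- k) = Suc n" "nat (- 1 - k) = n" using False by (auto simp: n_def)
  have "zpow M f (k + 1) x = (inv_map M f ^^ n) x"
    using False k by (cases "k = -1") (auto simp: zpow_def n_def)
  moreover have "(inv_map M f ^^ n) x \<in> space M" by (induction n) (use x inv_map_in_space in auto)
  moreover have "zpow M f k x = inv_map M f ((inv_map M f ^^ n) x)" using False k by (simp add: zpow_def)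
  ultimately show ?thesis using bij by (simp add: bij_betw_inv_into_right)
qed

lemma zpow_one: "x \<in> space M \<Longrightarrow> zpow M f 1 x = f x"
  using zpow_plus_one[of x 0] by simp

lemma zpow_minus_one:
  assumes "x \<in> space M"
  shows "f (zpow M f (k - 1) x) = zpow M f k x"
  using zpow_plus_one[OF assms, of "k - 1"] by simp

lemma zpow_add:
  assumes x: "x \<in> space M"
  shows "zpow M f (i + j) x = zpow M f i (zpow M f j x)"
proof (induction i rule: int_induct[where k = 0])
  case (step1 i)
  have "zpow M f (i + 1 + j) x = zpow M f ((i + j) + 1) x" by (simp add: algebra_simps)
  then show ?case using step1 zpow_plus_one[OF x] zpow_plus_one[OF zpow_in_space[OF x]] by simp
next
  case (step2 i)
  have "f (zpow M f (i - 1 + j) x) = f (zpow M f (i - 1) (zpow M f j x))"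
    using zpow_minus_one[OF x, of "i + j"] zpow_minus_one[OF zpow_in_space[OF x], of i] step2
    by (simp add: algebra_simps)
  then show ?case using bij zpow_in_space x by (meson bij_betw_imp_inj_on inj_onD)
qed simp

lemma zpow_uminus_cancel:
  assumes "x \<in> space M"
  shows "zpow M f (- k) (zpow M f k x) = x" "zpow M f k (zpow M f (- k) x) = x"
  using zpow_add[OF assms, of "-k" k] zpow_add[OF assms, of k "-k"] by simp_all

lemma zpow_of_nat: "zpow M f (int n) = f ^^ n"
  by (simp add: zpow_def)

lemma zpow_image:
  assumes "A \<subseteq> space M"
  shows "zpow M f k ` A = zpow M f (- k) -` A \<inter> space M"
proof (intro equalityI subsetI)
  fix y assume "y \<in> zpow M f k ` A"
  then obtain x where "y = zpow M f k x" "x \<in> A" "x \<in> space M" using assms by auto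
  then show "y \<in> zpow M f (- k) -` A \<inter> space M"
    using zpow_in_space zpow_uminus_cancel by auto
next
  fix x assume "x \<in> zpow M f (- k) -` A \<inter> space M"
  then show "x \<in> zpow M f k ` A" using zpow_uminus_cancel(2)[of x k] by force
qed

lemma orbit_of_trans:
  assumes x: "x \<in> space M" and y: "y \<in> orbit_of M f x"
  shows "orbit_of M f y = orbit_of M f x"
proof -
  obtain j where j: "y = zpow M f j x" using y by (auto simp: orbit_of_def)
  have 1: "zpow M f k y = zpow M f (k + j) x" for k unfolding j using zpow_add[OF x] by simp
  then have "zpow M f k x = zpow M f (k - j) y" for k by simp
  with 1 show ?thesis unfolding orbit_of_def by (metis (no_types) equalityI image_subsetI rangeI)
qed

end

text \<open>Serves for the conjugate of T by the identity in the definition of orbit equivalence: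
  there \<open>inv_into\<close> is the identity on \<open>space M\<close> only.\<close>

lemma zpow_cong:
  assumes f: "bij_betw f (space M) (space M)" and fg: "\<And>y. y \<in> space M \<Longrightarrow> g y = f y"
    and x: "x \<in> space M"
  shows "zpow M g k x = zpow M f k x"
proof -
  have g: "bij_betw g (space M) (space M)" using bij_betw_cong[of "space M" g f] f fg by blast
  show ?thesis
  proof (induction k rule: int_induct[where k = 0])
    case (step1 i)
    then show ?case using zpow_plus_one[OF f x] zpow_plus_one[OF g x] fg[OF zpow_in_space[OF f x]] by simp
  next
    case (step2 i)
    have "f (zpow M g (i - 1) x) = f (zpow M f (i - 1) x)"
      using zpow_minus_one[OF f x, of i] zpow_minus_one[OF g x, of i] fg[OF zpow_in_space[OF g x]] step2 by simp
    then show ?case using f zpow_in_space[OF f x] zpow_in_space[OF g x] by (meson bij_betw_imp_inj_on inj_onD)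
  qed simp
qed

text \<open>One step suffices: as \<open>f\<close> moves each point of \<open>G\<close> within its
  \<open>g\<close>-orbit, the \<open>g\<close>-orbit stays the same along the
  \<open>f\<close>-orbit, forwards and backwards.\<close>

lemma orbit_of_subset:
  assumes f: "bij_betw f (space M) (space M)" and g: "bij_betw g (space M) (space M)"
    and G: "G \<subseteq> space M" and inv: "\<And>x k. x \<in> G \<Longrightarrow> zpow M f k x \<in> G"
    and fg: "\<And>x. x \<in> G \<Longrightarrow> f x \<in> orbit_of M g x" and x: "x \<in> G"
  shows "orbit_of M f x \<subseteq> orbit_of M g x"
proof -
  have xM: "x \<in> space M" using x G by auto
  have sub: "zpow M f k x \<in> space M" for k using zpow_in_space[OF f xM] .
  have self: "y \<in> orbit_of M g y" for y unfolding orbit_of_def by (metis rangeI zpow_0)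
  have eq: "orbit_of M g (f y) = orbit_of M g y" if "y \<in> G" for y
    using orbit_of_trans[OF g _ fg[OF that]] that G by auto
  have "orbit_of M g (zpow M f k x) = orbit_of M g x" for k
  proof (induction k rule: int_induct[where k = 0])
    case (step1 i)
    then show ?case using eq[OF inv[OF x, of i]] zpow_plus_one[OF f xM, of i] by simp
  next
    case (step2 i)
    then show ?case using eq[OF inv[OF x, of "i - 1"]] zpow_minus_one[OF f xM, of i] by simp
  qed simp
  then show ?thesis using self unfolding orbit_of_def[of M f] by blast
qed

lemma Aut_bij: "S \<in> Aut M \<Longrightarrow> bij_betw S (space M) (space M)"
  by (simp add: Aut_def)

lemma Aut_inv_distr:
  assumes "S \<in> Aut M"
  shows "distr M M (inv_map M S) = M"
proof -
  have S: "bij_betw S (space M) (space M)" "S \<in> measurable M M" "inv_map M S \<in> measurable M M" "distr M M S = M"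
    using assms by (auto simp: Aut_def)
  have "distr M M (inv_map M S) = distr (distr M M S) M (inv_map M S)" by (simp add: S(4))
  also have "\<dots> = distr M M (inv_map M S \<circ> S)" by (rule distr_distr[OF S(3) S(2)])
  also have "\<dots> = distr M M (\<lambda>x. x)"
    by (rule distr_cong) (use S(1) in \<open>auto simp: bij_betw_inv_into_left\<close>)
  finally show ?thesis by (simp add: distr_id)
qed

lemma funpow_measurable_distr:
  assumes "g \<in> measurable M M" "distr M M g = M"
  shows "g ^^ n \<in> measurable M M" "distr M M (g ^^ n) = M"
proof -
  show m: "g ^^ n \<in> measurable M M" for n
  proof (induction n)
    case (Suc n)
    show ?case unfolding funpow.simps by (rule measurable_comp[OF Suc assms(1)])
  qed (simp add: id_def)
  show "distr M M (g ^^ n) = M"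
  proof (induction n)
    case (Suc n)
    have "distr M M (g ^^ Suc n) = distr (distr M M (g ^^ n)) M g"
      unfolding funpow.simps by (rule distr_distr[OF assms(1) m, symmetric])
    also have "\<dots> = M" unfolding Suc assms(2) ..
    finally show ?case .
  qed (simp add: id_def distr_id)
qed

lemma zpow_measurable:
  assumes "S \<in> Aut M"
  shows "zpow M S k \<in> measurable M M"
proof -
  have S: "S \<in> measurable M M" "inv_map M S \<in> measurable M M" "distr M M S = M"
    using assms by (auto simp: Aut_def)
  show ?thesis unfolding zpow_def
    using funpow_measurable_distr(1)[OF S(1,3)] funpow_measurable_distr(1)[OF S(2) Aut_inv_distr[OF assms]] by simp
qed

lemma zpow_distr:
  assumes "S \<in> Aut M"
  shows "distr M M (zpow M S k) = M"
proof -
  have S: "S \<in> measurable M M" "inv_map M S \<in> measurable M M" "distr M M S = M"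
    using assms by (auto simp: Aut_def)
  show ?thesis unfolding zpow_def
    using funpow_measurable_distr(2)[OF S(1,3)] funpow_measurable_distr(2)[OF S(2) Aut_inv_distr[OF assms]] by simp
qed

lemma emeasure_zpow_vimage:
  assumes "S \<in> Aut M" "A \<in> sets M"
  shows "emeasure M (zpow M S k -` A \<inter> space M) = emeasure M A"
  using emeasure_distr[OF zpow_measurable[OF assms(1)] assms(2), of k] by (simp add: zpow_distr[OF assms(1)])

lemma AE_zpow:
  assumes S: "S \<in> Aut M" and P: "AE x in M. P x"
  shows "AE x in M. P (zpow M S k x)"
proof (rule AE_distrD[OF zpow_measurable[OF S]])
  show "AE x in distr M M (zpow M S k). P x" unfolding zpow_distr[OF S] by (rule P)
qed

text \<open>On each of the countably many sets where \<open>c\<close> is constant, \<open>T\<close>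
  is a power of \<open>S\<close> and preserves measure. Injectivity of \<open>T\<close> keeps the
  images of these pieces disjoint, so their measures add up.\<close>

lemma full_group_in_Aut:
  fixes c :: "'a \<Rightarrow> int"
  assumes S: "S \<in> Aut M" and c: "c \<in> measurable M (count_space UNIV)"
    and T_def: "\<And>x. T x = zpow M S (c x) x" and T: "bij_betw T (space M) (space M)"
  shows "T \<in> Aut M"
proof -
  note bS = Aut_bij[OF S]
  have mT: "T \<in> measurable M M"
    unfolding T_def[abs_def] by (rule measurable_compose_countable[OF zpow_measurable[OF S] c])
  let ?C = "\<lambda>k. c -` {k} \<inter> space M"
  have C: "?C k \<in> sets M" for k using measurable_sets[OF c, of "{k}"] by simp
  have piece_eq: "zpow M S k ` (A \<inter> ?C k) = zpow M S (- k) -` (A \<inter> ?C k) \<inter> space M" for A k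
    by (rule zpow_image[OF bS]) auto
  have piece: "zpow M S k ` (A \<inter> ?C k) \<in> sets M" if "A \<in> sets M" for A k
    unfolding piece_eq by (intro measurable_sets[OF zpow_measurable[OF S]] sets.Int that C)
  have img: "T ` A = (\<Union>k. zpow M S k ` (A \<inter> ?C k))" if "A \<in> sets M" for A
  proof -
    have AM: "A \<subseteq> space M" using that sets.sets_into_space by auto
    show ?thesis
    proof safe
      fix x assume "x \<in> A"
      then have "x \<in> A \<inter> ?C (c x)" using AM by auto
      then show "T x \<in> (\<Union>k. zpow M S k ` (A \<inter> ?C k))" unfolding T_def by blast
    qed (auto simp: T_def)
  qed
  have img_sets: "T ` A \<in> sets M" if "A \<in> sets M" for A
    unfolding img[OF that] using piece[OF that] by (intro sets.countable_UN) auto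
  have em: "emeasure M (T ` A) = emeasure M A" if A: "A \<in> sets M" for A
  proof -
    have AM: "A \<subseteq> space M" using A sets.sets_into_space by auto
    have "emeasure M (T ` A) = (\<integral>\<^sup>+k. emeasure M (zpow M S k ` (A \<inter> ?C k)) \<partial>count_space UNIV)"
      unfolding img[OF A]
    proof (rule emeasure_UN_countable)
      show "disjoint_family (\<lambda>k. zpow M S k ` (A \<inter> ?C k))"
      proof -
        have eq: "zpow M S k ` (A \<inter> ?C k) = T ` (A \<inter> ?C k)" for k by (auto simp: T_def)
        have inj: "inj_on T (space M)" using T by (rule bij_betw_imp_inj_on)
        have "T ` (A \<inter> ?C k) \<inter> T ` (A \<inter> ?C l) = {}" if "k \<noteq> l" for k l
        proof -
          have "T ` (A \<inter> ?C k) \<inter> T ` (A \<inter> ?C l) = T ` ((A \<inter> ?C k) \<inter> (A \<inter> ?C l))"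
            by (rule inj_on_image_Int[OF inj, symmetric]) (use AM in auto)
          also have "(A \<inter> ?C k) \<inter> (A \<inter> ?C l) = {}" using that by auto
          finally show ?thesis by simp
        qed
        then show ?thesis unfolding disjoint_family_on_def eq by blast
      qed
    qed (use piece[OF A] in auto)
    also have "\<dots> = (\<integral>\<^sup>+k. emeasure M (A \<inter> ?C k) \<partial>count_space UNIV)"
      unfolding piece_eq by (subst emeasure_zpow_vimage[OF S]) (use A C in auto)
    also have "\<dots> = emeasure M (\<Union>k. A \<inter> ?C k)"
      by (rule emeasure_UN_countable[symmetric]) (use A C in \<open>auto simp: disjoint_family_on_def\<close>)
    also have "(\<Union>k. A \<inter> ?C k) = A" using AM by auto
    finally show ?thesis .
  qed
  have inv_meas: "inv_map M T \<in> measurable M M"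
  proof (rule measurableI)
    fix A assume A: "A \<in> sets M"
    then have AM: "A \<subseteq> space M" using sets.sets_into_space by auto
    have "inv_map M T -` A \<inter> space M = T ` A"
    proof (intro equalityI subsetI)
      fix x assume "x \<in> inv_map M T -` A \<inter> space M"
      then show "x \<in> T ` A" using bij_betw_inv_into_right[OF T, of x] by force
    next
      fix y assume "y \<in> T ` A"
      then obtain x where "y = T x" "x \<in> A" "x \<in> space M" using AM by auto
      then show "y \<in> inv_map M T -` A \<inter> space M"
        using bij_betw_inv_into_left[OF T, of x] bij_betwE[OF T] by auto
    qed
    then show "inv_map M T -` A \<inter> space M \<in> sets M" using img_sets[OF A] by simp
  qed (rule inv_map_in_space[OF T])
  have "distr M M T = M"
  proof (rule measure_eqI)
    fix A assume "A \<in> sets (distr M M T)"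
    then have A: "A \<in> sets M" by simp
    then have AM: "A \<subseteq> space M" using sets.sets_into_space by auto
    have "T ` (T -` A \<inter> space M) = A"
    proof (intro equalityI subsetI)
      fix y assume y: "y \<in> A"
      then have "y \<in> T ` space M" using AM bij_betw_imp_surj_on[OF T] by auto
      then show "y \<in> T ` (T -` A \<inter> space M)" using y by auto
    qed auto
    then have "emeasure M (T -` A \<inter> space M) = emeasure M A"
      using em[OF measurable_sets[OF mT A]] by simp
    then show "emeasure (distr M M T) A = emeasure M A" by (simp add: emeasure_distr[OF mT A])
  qed simp
  then show ?thesis using T mT inv_meas by (simp add: Aut_def)
qed

section \<open>Entropy of processes\<close>

text \<open>As an infimum the quantity exists without a convergence proof; Fekete's lemma identifies
  it with the limit in \<open>entropy_wrt_partition\<close>.\<close>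

definition process_entropy :: "'a measure \<Rightarrow> ('a \<Rightarrow> 'a) \<Rightarrow> ('a \<Rightarrow> 'b) \<Rightarrow> real" where
  "process_entropy M T X = (INF n\<in>{0<..}. rv_entropy M (itinerary T X n) / n)"

definition cell_of :: "'a set set \<Rightarrow> 'a \<Rightarrow> 'a set" where
  "cell_of P x = (THE A. A \<in> P \<and> x \<in> A)"

lemma partition_on_ex1:
  assumes "partition_on \<Omega> P" "x \<in> \<Omega>"
  shows "\<exists>!A. A \<in> P \<and> x \<in> A"
proof -
  obtain A where A: "A \<in> P" "x \<in> A" using assms by (auto simp: partition_on_def)
  moreover have "B = A" if "B \<in> P" "x \<in> B" for B
    using partition_onD2[OF assms(1)] A that by (auto dest: disjointD)
  ultimately show ?thesis by blast
qed

lemma cell_of_eq_iff: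
  assumes "partition_on \<Omega> P" "A \<in> P" "x \<in> \<Omega>"
  shows "cell_of P x = A \<longleftrightarrow> x \<in> A"
proof -
  have ex: "\<exists>!A. A \<in> P \<and> x \<in> A" using assms(1,3) by (rule partition_on_ex1)
  show ?thesis unfolding cell_of_def using theI'[OF ex] the1_equality[OF ex] assms(2) by blast
qed

lemma cell_of_in:
  assumes "partition_on \<Omega> P" "x \<in> \<Omega>"
  shows "cell_of P x \<in> P"
proof -
  have ex: "\<exists>!A. A \<in> P \<and> x \<in> A" using assms by (rule partition_on_ex1)
  show ?thesis unfolding cell_of_def using theI'[OF ex] by blast
qed

lemma itinerary_add: "itinerary T X (m + n) x = itinerary T X m x @ itinerary T X n ((T ^^ m) x)"
proof -
  have "[0..<m + n] = [0..<m] @ map (\<lambda>i. i + m) [0..<n]"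
    using map_add_upt[of m n] upt_add_eq_append[of 0 m n] by (simp add: add.commute)
  then show ?thesis by (simp add: itinerary_def funpow_add)
qed

locale measure_preserving_map = prob_space +
  fixes T :: "'a \<Rightarrow> 'a"
  assumes T_measurable: "T \<in> measurable M M" and T_distr: "distr M M T = M"
begin

lemma funpow_measurable: "T ^^ n \<in> measurable M M" and funpow_distr: "distr M M (T ^^ n) = M"
  by (rule funpow_measurable_distr[OF T_measurable T_distr])+

lemma funpow_in_space: "x \<in> space M \<Longrightarrow> (T ^^ n) x \<in> space M"
  by (rule measurable_space[OF funpow_measurable])

lemma simple_function_itinerary:
  assumes X: "simple_function M X"
  shows "simple_function M (itinerary T X n)"
proof (induction n)
  case 0
  then show ?case unfolding itinerary_def by simp
next
  case (Suc n)
  have "simple_function M (\<lambda>x. X ((T ^^ n) x))"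
    unfolding simple_function_def
  proof (intro conjI ballI)
    have "(\<lambda>x. X ((T ^^ n) x)) ` space M \<subseteq> X ` space M" using funpow_in_space by auto
    then show "finite ((\<lambda>x. X ((T ^^ n) x)) ` space M)"
      using X by (meson finite_subset simple_functionD(1))
    fix v
    have "(\<lambda>x. X ((T ^^ n) x)) -` {v} \<inter> space M = (T ^^ n) -` (X -` {v} \<inter> space M) \<inter> space M"
      using funpow_in_space by auto
    then show "(\<lambda>x. X ((T ^^ n) x)) -` {v} \<inter> space M \<in> sets M"
      using measurable_sets[OF funpow_measurable simple_function_level[OF X]] by simp
  qed
  then have "simple_function M (\<lambda>x. (itinerary T X n x, X ((T ^^ n) x)))" by (rule simple_function_Pair[OF Suc])
  from simple_function_compose[OF this, of "\<lambda>(w, v). w @ [v]"]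
  show ?case by (simp add: itinerary_def comp_def)
qed

lemma rv_entropy_itinerary_add_le:
  assumes X: "simple_function M X"
  shows "rv_entropy M (itinerary T X (m + n)) \<le> rv_entropy M (itinerary T X m) + rv_entropy M (itinerary T X n)"
proof -
  have Y: "simple_function M (\<lambda>x. itinerary T X n ((T ^^ m) x))"
    using simple_function_compose[OF simple_function_itinerary[OF X, of "m + n"], of "drop m"]
    by (simp add: itinerary_add comp_def itinerary_def[of T X m])
  have "rv_entropy M (itinerary T X (m + n))
    \<le> rv_entropy M (\<lambda>x. (itinerary T X m x, itinerary T X n ((T ^^ m) x)))"
    by (rule rv_entropy_le_AE[where f = "\<lambda>(v, w). v @ w"])
      (simp_all add: X Y simple_function_itinerary itinerary_add simple_function_Pair)
  also have "\<dots> \<le> rv_entropy M (itinerary T X m) + rv_entropy M (\<lambda>x. itinerary T X n ((T ^^ m) x))"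
    by (rule rv_entropy_pair_le[OF simple_function_itinerary[OF X] Y])
  also have "rv_entropy M (\<lambda>x. itinerary T X n ((T ^^ m) x)) = rv_entropy M (itinerary T X n)"
    by (rule rv_entropy_compose[OF simple_function_itinerary[OF X] funpow_measurable funpow_distr])
  finally show ?thesis .
qed

lemma rv_entropy_itinerary_le:
  assumes X: "simple_function M X"
  shows "rv_entropy M (itinerary T X n) \<le> n * rv_entropy M X"
proof (induction n)
  case 0
  have "rv_entropy M (itinerary T X 0) \<le> ln (card {[] :: 'b list})"
    by (rule rv_entropy_le_ln_card[OF simple_function_itinerary[OF X]]) (auto simp: itinerary_def)
  then show ?case by simp
next
  case (Suc n)
  have "rv_entropy M (itinerary T X 1) \<le> rv_entropy M X"
    by (rule rv_entropy_le_AE[OF simple_function_itinerary[OF X] X, where f = "\<lambda>v. [v]"]) (simp add: itinerary_def)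
  then show ?case using Suc rv_entropy_itinerary_add_le[OF X, of n 1] by (simp add: algebra_simps)
qed

lemma process_entropy_tendsto:
  assumes X: "simple_function M X"
  shows "(\<lambda>n. rv_entropy M (itinerary T X n) / n) \<longlonglongrightarrow> process_entropy M T X"
  unfolding process_entropy_def
  by (rule fekete) (rule rv_entropy_itinerary_add_le[OF X] rv_entropy_nonneg)+

lemma process_entropy_mono:
  assumes X: "simple_function M X" and Y: "simple_function M Y"
    and f: "AE x in M. \<forall>n. X ((T ^^ n) x) = f (Y ((T ^^ n) x))"
  shows "process_entropy M T X \<le> process_entropy M T Y"
proof (rule LIMSEQ_le[OF process_entropy_tendsto[OF X] process_entropy_tendsto[OF Y]], intro exI allI impI)
  fix n :: nat
  have "rv_entropy M (itinerary T X n) \<le> rv_entropy M (itinerary T Y n)"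
    by (rule rv_entropy_le_AE[where f = "map f"])
      (use f in \<open>auto simp: X Y simple_function_itinerary itinerary_def\<close>)
  then show "rv_entropy M (itinerary T X n) / n \<le> rv_entropy M (itinerary T Y n) / n"
    by (simp add: divide_right_mono)
qed

lemma simple_function_cell_of:
  assumes P: "finite_measurable_partition M P"
  shows "simple_function M (cell_of P)"
  unfolding simple_function_def
proof (intro conjI ballI)
  have part: "partition_on (space M) P" "finite P" "P \<subseteq> sets M"
    using P by (auto simp: finite_measurable_partition_def)
  show "finite (cell_of P ` space M)"
    using part(2) cell_of_in[OF part(1)] by (meson finite_subset image_subsetI)
  fix A assume "A \<in> cell_of P ` space M"
  then have A: "A \<in> P" using cell_of_in[OF part(1)] by auto
  have "cell_of P -` {A} \<inter> space M = A"
    using cell_of_eq_iff[OF part(1) A] A part(3) sets.sets_into_space by blast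
  then show "cell_of P -` {A} \<inter> space M \<in> sets M" using A part(3) by auto
qed

text \<open>The nonempty members of the join correspond bijectively to the words that occur as
  itineraries, and the empty set contributes 0.\<close>

lemma partition_entropy_iterated_join:
  assumes P: "finite_measurable_partition M P"
  shows "partition_entropy M (iterated_join M T P n) = rv_entropy M (itinerary T (cell_of P) n)"
proof -
  have part: "partition_on (space M) P" "finite P" using P by (auto simp: finite_measurable_partition_def)
  let ?I = "itinerary T (cell_of P) n"
  define J where "J = iterated_join M T P n"
  define C where "C = (\<lambda>v. ?I -` {v} \<inter> space M)"
  have fin: "finite (?I ` space M)"
    using simple_function_itinerary[OF simple_function_cell_of[OF P]] by (rule simple_functionD)
  have lev: "space M \<inter> (\<Inter>i<n. (T ^^ i) -` A i) = C (map A [0..<n])" if "\<forall>i<n. A i \<in> P" for A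
    using that cell_of_eq_iff[OF part(1)] funpow_in_space unfolding C_def
    by (auto simp: itinerary_def)
  have sub1: "J - {{}} \<subseteq> C ` (?I ` space M)"
  proof
    fix D assume D: "D \<in> J - {{}}"
    then obtain A where A: "\<forall>i<n. A i \<in> P" "D = C (map A [0..<n])"
      unfolding J_def iterated_join_def using lev by blast
    then obtain x where "x \<in> D" using D by blast
    then have "x \<in> space M" "?I x = map A [0..<n]" using A(2) by (auto simp: C_def)
    then show "D \<in> C ` (?I ` space M)" using A(2) by (metis imageI)
  qed
  have sub2: "C ` (?I ` space M) \<subseteq> J - {{}}"
  proof safe
    fix x assume x: "x \<in> space M"
    have "\<forall>i<n. cell_of P ((T ^^ i) x) \<in> P" using cell_of_in[OF part(1)] funpow_in_space[OF x] by blast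
    from lev[OF this] this
    have "\<exists>A. C (?I x) = space M \<inter> (\<Inter>i<n. (T ^^ i) -` A i) \<and> (\<forall>i<n. A i \<in> P)"
      unfolding itinerary_def by metis
    then show "C (?I x) \<in> J"
      unfolding J_def iterated_join_def by blast
  next
    fix x assume "x \<in> space M" "C (?I x) = {}"
    then show False unfolding C_def by auto
  qed
  have inj: "inj_on C (?I ` space M)"
    unfolding inj_on_def C_def by blast
  have eq: "J - {{}} = C ` (?I ` space M)" using sub1 sub2 by blast
  have finJ: "finite J" using eq fin by (metis finite_Diff2 finite_imageI finite.emptyI finite_insert)
  have "partition_entropy M J = (\<Sum>A\<in>J - {{}}. - prob A * ln (prob A))"
    unfolding partition_entropy_def by (rule sum.mono_neutral_right) (use finJ in auto)
  also have "\<dots> = (\<Sum>v\<in>?I ` space M. - prob (C v) * ln (prob (C v)))"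
    unfolding eq by (subst sum.reindex[OF inj]) simp
  finally show ?thesis unfolding J_def rv_entropy_def C_def .
qed

lemma entropy_wrt_partition_eq:
  assumes P: "finite_measurable_partition M P"
  shows "entropy_wrt_partition M T P = process_entropy M T (cell_of P)"
  unfolding entropy_wrt_partition_def partition_entropy_iterated_join[OF P]
  by (rule limI[OF process_entropy_tendsto[OF simple_function_cell_of[OF P]]])

lemma process_entropy_le_KS_entropy:
  assumes X: "simple_function M X"
  shows "ereal (process_entropy M T X) \<le> KS_entropy M T"
proof -
  define P where "P = (\<lambda>v. X -` {v} \<inter> space M) ` (X ` space M)"
  have P: "finite_measurable_partition M P"
    unfolding finite_measurable_partition_def
  proof (intro conjI)
    show "finite P" unfolding P_def using X by (simp add: simple_functionD)
    show "P \<subseteq> sets M" unfolding P_def using simple_function_level[OF X] by auto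
    show "partition_on (space M) P"
      unfolding P_def by (rule partition_onI) (auto simp: disjnt_def)
  qed
  have part: "partition_on (space M) P" using P by (auto simp: finite_measurable_partition_def)
  \<comment> \<open>The cells are the level sets of \<open>X\<close>, so any chosen point of a cell
    returns the value of \<open>X\<close> there, and \<open>X\<close> is a function of the
    cell.\<close>
  have "X x = X (SOME y. y \<in> cell_of P x)" if "x \<in> space M" for x
  proof -
    have "X -` {X x} \<inter> space M \<in> P" unfolding P_def using that by blast
    then have eq: "cell_of P x = X -` {X x} \<inter> space M" using cell_of_eq_iff[OF part] that by auto
    have "x \<in> cell_of P x" unfolding eq using that by auto
    then have "(SOME y. y \<in> cell_of P x) \<in> cell_of P x" by (rule someI)
    then show ?thesis unfolding eq by auto
  qed
  then have "process_entropy M T X \<le> process_entropy M T (cell_of P)"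
    by (intro process_entropy_mono[OF X simple_function_cell_of[OF P], where f = "\<lambda>A. X (SOME y. y \<in> A)"])
      (auto intro!: AE_I2 funpow_in_space)
  then have "ereal (process_entropy M T X) \<le> ereal (entropy_wrt_partition M T P)"
    by (simp add: entropy_wrt_partition_eq[OF P])
  also have "\<dots> \<le> KS_entropy M T" unfolding KS_entropy_def by (rule SUP_upper) (use P in simp)
  finally show ?thesis .
qed

end

section \<open>Entropy bound from a generating sequence\<close>

lemma neg_mult_ln_le_sqrt:
  fixes p :: real assumes "0 \<le> p" shows "- p * ln p \<le> 2 * sqrt p"
proof (cases "p = 0")
  case False
  then have p: "0 < p" using assms by simp
  have "- ln p = 2 * ln (1 / sqrt p)" using p by (simp add: ln_div ln_sqrt)
  also have "\<dots> \<le> 2 * (1 / sqrt p)" using ln_bound[of "1 / sqrt p"] p by simp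
  finally have "p * (- ln p) \<le> p * (2 * (1 / sqrt p))" using p by (intro mult_left_mono) auto
  also have "\<dots> = 2 * sqrt p" using p real_div_sqrt[of p] by (simp add: field_simps)
  finally show ?thesis by simp
qed simp

lemma neg_mult_ln_le_one_minus:
  fixes p :: real assumes "0 \<le> p" shows "- p * ln p \<le> 1 - p"
proof (cases "p = 0")
  case False
  then have p: "0 < p" using assms by simp
  have "ln (1 / p) \<le> 1 / p - 1" by (rule ln_le_minus_one) (use p in simp)
  then have "p * (- ln p) \<le> p * (1 / p - 1)" using p by (intro mult_left_mono) (auto simp: ln_div)
  then show ?thesis using p by (simp add: algebra_simps)
qed simp

context prob_space
begin

text \<open>A crude Fano inequality: \<open>E\<close> is a correction that is rarely made. The
  nearly certain value \<open>None\<close> is estimated by - p ln p \<le> 1 - p, the rare ones by -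
  p ln p \<le> 2 sqrt p.\<close>

lemma rv_entropy_option_le:
  assumes E: "simple_function M E" and V: "finite V" "E ` space M \<subseteq> insert None (Some ` V)"
    and d: "prob {x \<in> space M. E x \<noteq> None} \<le> d" "d \<le> 1"
  shows "rv_entropy M E \<le> (1 + 2 * card V) * sqrt d"
proof -
  let ?\<eta> = "\<lambda>v. - prob (E -` {v} \<inter> space M) * ln (prob (E -` {v} \<inter> space M))"
  have d0: "0 \<le> d" using d(1) measure_nonneg order_trans by blast
  have "rv_entropy M E = (\<Sum>v\<in>insert None (Some ` V). ?\<eta> v)"
    by (rule rv_entropy_superset) (use V in auto)
  also have "\<dots> = ?\<eta> None + (\<Sum>v\<in>Some ` V. ?\<eta> v)" by (rule sum.insert) (use V in auto)
  also have "?\<eta> None \<le> d"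
  proof -
    have "E -` {None} \<inter> space M = space M - {x \<in> space M. E x \<noteq> None}" by auto
    moreover have "{x \<in> space M. E x \<noteq> None} = E -` (- {None}) \<inter> space M" by auto
    ultimately have "prob (E -` {None} \<inter> space M) = 1 - prob {x \<in> space M. E x \<noteq> None}"
      using prob_compl[OF simple_function_level[OF E, of "- {None}"]] by simp
    then show ?thesis using neg_mult_ln_le_one_minus[of "prob (E -` {None} \<inter> space M)"] d by simp
  qed
  also have "(\<Sum>v\<in>Some ` V. ?\<eta> v) \<le> (\<Sum>v\<in>Some ` V. 2 * sqrt d)"
  proof (intro sum_mono)
    fix v assume "v \<in> Some ` V"
    then have "E -` {v} \<inter> space M \<subseteq> {x \<in> space M. E x \<noteq> None}" by auto
    moreover have "{x \<in> space M. E x \<noteq> None} = E -` (- {None}) \<inter> space M" by auto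
    ultimately have "prob (E -` {v} \<inter> space M) \<le> prob {x \<in> space M. E x \<noteq> None}"
      using finite_measure_mono simple_function_level[OF E, of "- {None}"] by metis
    then have "prob (E -` {v} \<inter> space M) \<le> d" using d(1) by linarith
    then have "sqrt (prob (E -` {v} \<inter> space M)) \<le> sqrt d" by simp
    moreover have "?\<eta> v \<le> 2 * sqrt (prob (E -` {v} \<inter> space M))" by (rule neg_mult_ln_le_sqrt) simp
    ultimately show "?\<eta> v \<le> 2 * sqrt d" by linarith
  qed
  also have "\<dots> = 2 * card V * sqrt d" by (simp add: card_image)
  finally have "rv_entropy M E \<le> d + 2 * card V * sqrt d" by simp
  moreover have "d \<le> sqrt d" using d0 d(2) by (simp add: real_le_rsqrt power2_eq_square mult_left_le)
  ultimately show ?thesis by (simp add: algebra_simps)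
qed

end

context measure_preserving_map
begin

text \<open>The itinerary of \<open>X\<close> is recovered from those of \<open>Y\<close> and of the
  correction \<open>E\<close>, and n corrections cost at most n times the entropy of one.\<close>

lemma process_entropy_le_add:
  assumes X: "simple_function M X" and Y: "simple_function M Y" and E: "simple_function M E"
    and f: "\<And>x. x \<in> space M \<Longrightarrow> X x = f (Y x, E x)"
  shows "process_entropy M T X \<le> process_entropy M T Y + rv_entropy M E"
proof (rule LIMSEQ_le[OF process_entropy_tendsto[OF X]])
  show "(\<lambda>n. rv_entropy M (itinerary T Y n) / n + rv_entropy M E) \<longlonglongrightarrow> process_entropy M T Y + rv_entropy M E"
    by (intro tendsto_add process_entropy_tendsto[OF Y] tendsto_const)
  show "\<exists>N. \<forall>n\<ge>N. rv_entropy M (itinerary T X n) / n \<le> rv_entropy M (itinerary T Y n) / n + rv_entropy M E"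
  proof (intro exI allI impI)
    fix n :: nat assume n: "1 \<le> n"
    note YE = simple_function_Pair[OF simple_function_itinerary[OF Y, of n] simple_function_itinerary[OF E, of n]]
    have "rv_entropy M (itinerary T X n) \<le> rv_entropy M (\<lambda>x. (itinerary T Y n x, itinerary T E n x))"
    proof (rule rv_entropy_le_AE[OF simple_function_itinerary[OF X] YE, where f = "\<lambda>(v, w). map f (zip v w)"])
      show "AE x in M. itinerary T X n x = (case (itinerary T Y n x, itinerary T E n x) of (v, w) \<Rightarrow> map f (zip v w))"
        by (intro AE_I2) (auto simp: itinerary_def zip_map_map f[OF funpow_in_space] intro!: nth_equalityI)
    qed
    also have "\<dots> \<le> rv_entropy M (itinerary T Y n) + rv_entropy M (itinerary T E n)"
      by (rule rv_entropy_pair_le) (rule simple_function_itinerary Y E)+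
    also have "rv_entropy M (itinerary T E n) \<le> n * rv_entropy M E" by (rule rv_entropy_itinerary_le[OF E])
    finally show "rv_entropy M (itinerary T X n) / n \<le> rv_entropy M (itinerary T Y n) / n + rv_entropy M E"
      using n by (simp add: field_simps)
  qed
qed

text \<open>Generator theorem in approximate form; the set in \<open>approx\<close> is the symmetric
  difference of \<open>A\<close> and the preimage of \<open>D\<close> under \<open>r n\<close>. A
  partition is guessed from a fine \<open>r n\<close>, and wrong guesses are corrected by a variable
  of entropy at most e.\<close>

lemma KS_entropy_le_generating:
  fixes r :: "nat \<Rightarrow> 'a \<Rightarrow> 'b"
  assumes r: "\<And>n. simple_function M (r n)"
    and mono: "\<And>m n. m \<le> n \<Longrightarrow> \<exists>f. \<forall>x\<in>space M. r m x = f (r n x)"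
    and approx: "\<And>A e. A \<in> events \<Longrightarrow> 0 < e \<Longrightarrow> \<exists>n D. prob {x \<in> space M. x \<in> A \<longleftrightarrow> r n x \<notin> D} < e"
    and le: "\<And>n. process_entropy M T (r n) \<le> a"
  shows "KS_entropy M T \<le> ereal a"
  unfolding KS_entropy_def
proof (rule SUP_least)
  fix P assume "P \<in> {P. finite_measurable_partition M P}"
  then have P: "finite_measurable_partition M P" by simp
  then have part: "partition_on (space M) P" "finite P" "P \<subseteq> sets M"
    by (auto simp: finite_measurable_partition_def)
  define c where "c = (1 + 2 * real (card P))"
  have c: "1 \<le> c" unfolding c_def by simp
  have "process_entropy M T (cell_of P) \<le> a + e" if e: "0 < e" for e
  proof -
    \<comment> \<open>If a wrong guess has probability at most d, the correction has entropy at most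
      \<open>c * sqrt d \<le> e\<close>. Since \<open>card P \<le> c\<close>, an error of
      \<open>d / c\<close> per cell is affordable.\<close>
    define d where "d = min 1 ((e / c)\<^sup>2)"
    have d: "0 < d" "d \<le> 1" "c * sqrt d \<le> e"
    proof -
      show "0 < d" "d \<le> 1" using e c by (auto simp: d_def)
      have "sqrt d \<le> sqrt ((e / c)\<^sup>2)" unfolding d_def by (rule real_sqrt_le_mono) simp
      also have "\<dots> = e / c" using e c by simp
      finally show "c * sqrt d \<le> e" using c by (simp add: field_simps)
    qed
    have "\<exists>n D. prob {x \<in> space M. x \<in> A \<longleftrightarrow> r n x \<notin> D} < d / c" if "A \<in> P" for A
      using approx[of A "d / c"] that part(3) d c by auto
    then obtain n0 D0 where n0: "\<And>A. A \<in> P \<Longrightarrow> prob {x \<in> space M. x \<in> A \<longleftrightarrow> r (n0 A) x \<notin> D0 A} < d / c"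
      by metis
    define n where "n = Max (n0 ` P)"
    have "\<exists>f. \<forall>x\<in>space M. r (n0 A) x = f (r n x)" if "A \<in> P" for A
      by (rule mono) (use that part(2) in \<open>simp add: n_def\<close>)
    then obtain f where f: "\<And>A x. A \<in> P \<Longrightarrow> x \<in> space M \<Longrightarrow> r (n0 A) x = f A (r n x)" by metis
    \<comment> \<open>Off the bad sets \<open>?B A\<close> exactly the cell of x passes the test, so
      the choice operator returns the right cell.\<close>
    define g where "g = (\<lambda>v. SOME A. A \<in> P \<and> f A v \<in> D0 A)"
    define E where "E = (\<lambda>x. if cell_of P x = g (r n x) then None else Some (cell_of P x))"
    have sE: "simple_function M E"
      using simple_function_compose[OF simple_function_Pair[OF simple_function_cell_of[OF P] r[of n]],
          of "\<lambda>(A, v). if A = g v then None else Some A"]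
      by (simp add: E_def comp_def)
    let ?B = "\<lambda>A. {x \<in> space M. x \<in> A \<longleftrightarrow> r n x \<notin> f A -` D0 A}"
    have Beq: "?B A = {x \<in> space M. x \<in> A \<longleftrightarrow> r (n0 A) x \<notin> D0 A}" if "A \<in> P" for A
      using f[OF that] by auto
    have Bev: "?B A \<in> events" if "A \<in> P" for A
    proof -
      have "?B A = (A - (r n -` (f A -` D0 A) \<inter> space M)) \<union> ((r n -` (f A -` D0 A) \<inter> space M) - A)"
        using that part(3) sets.sets_into_space by auto
      then show ?thesis using that part(3) simple_function_level[OF r[of n], of "f A -` D0 A"] by auto
    qed
    have "prob {x \<in> space M. E x \<noteq> None} \<le> prob (\<Union>A\<in>P. ?B A)"
    proof (rule finite_measure_mono)
      show "{x \<in> space M. E x \<noteq> None} \<subseteq> (\<Union>A\<in>P. ?B A)"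
      proof (rule subsetI, rule ccontr)
        fix x assume "x \<in> {x \<in> space M. E x \<noteq> None}" and nB: "x \<notin> (\<Union>A\<in>P. ?B A)"
        then have x: "x \<in> space M" "cell_of P x \<noteq> g (r n x)" by (auto simp: E_def split: if_splits)
        have iff: "x \<in> A \<longleftrightarrow> f A (r n x) \<in> D0 A" if "A \<in> P" for A using nB that x(1) by auto
        have "g (r n x) \<in> P \<and> f (g (r n x)) (r n x) \<in> D0 (g (r n x))"
          unfolding g_def
        proof (rule someI)
          show "cell_of P x \<in> P \<and> f (cell_of P x) (r n x) \<in> D0 (cell_of P x)"
            using iff cell_of_in[OF part(1) x(1)] cell_of_eq_iff[OF part(1) _ x(1)] by blast
        qed
        then have "g (r n x) \<in> P" "x \<in> g (r n x)" using iff by auto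
        then show False using cell_of_eq_iff[OF part(1) _ x(1)] x(2) by blast
      qed
      show "(\<Union>A\<in>P. ?B A) \<in> events" using Bev part(2) by (intro sets.finite_UN) auto
    qed
    also have "\<dots> \<le> (\<Sum>A\<in>P. prob (?B A))"
      by (rule finite_measure_subadditive_finite) (use part(2) Bev in auto)
    also have "\<dots> \<le> (\<Sum>A\<in>P. d / c)" by (intro sum_mono less_imp_le) (use n0 Beq in simp)
    also have "\<dots> \<le> d"
    proof -
      have "real (card P) \<le> c" by (simp add: c_def)
      then have "card P * d \<le> c * d" using d by (intro mult_right_mono) auto
      then show ?thesis using c by (simp add: field_simps)
    qed
    finally have Ed: "prob {x \<in> space M. E x \<noteq> None} \<le> d" .
    have "E ` space M \<subseteq> insert None (Some ` P)" using cell_of_in[OF part(1)] by (auto simp: E_def)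
    from rv_entropy_option_le[OF sE part(2) this Ed d(2)]
    have "rv_entropy M E \<le> e" using d(3) by (simp add: c_def)
    moreover have "process_entropy M T (cell_of P) \<le> process_entropy M T (r n) + rv_entropy M E"
      by (rule process_entropy_le_add[OF simple_function_cell_of[OF P] r sE,
            where f = "\<lambda>(v, w). case w of None \<Rightarrow> g v | Some A \<Rightarrow> A"]) (simp add: E_def)
    ultimately show ?thesis using le[of n] by linarith
  qed
  then have "process_entropy M T (cell_of P) \<le> a" by (rule field_le_epsilon)
  then show "ereal (entropy_wrt_partition M T P) \<le> ereal a" by (simp add: entropy_wrt_partition_eq[OF P])
qed

end

section \<open>Towers\<close>

text \<open>\<open>perm n b i\<close> is the index of the subtower of height \<open>h n\<close> that
  the tower \<open>b\<close> of height \<open>h (Suc n)\<close> visits as number i; its inverse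
  turns a subtower into the time of its visit.\<close>

locale digit_system =
  fixes h q :: "nat \<Rightarrow> nat" and perm :: "nat \<Rightarrow> nat \<Rightarrow> nat \<Rightarrow> nat"
  assumes h_0: "0 < h 0" and q_ge2: "2 \<le> q n" and h_Suc: "h (Suc n) = h n * q n"
    and perm: "perm n b permutes {..<q n}"
begin

text \<open>A level \<open>\<rho> < h (n + 1)\<close> of the odometer lies in exactly one of the \<open>q n\<close> towers of
  height \<open>h n\<close> of the new map, namely the one with index \<open>\<rho> div h n\<close>. The function \<open>point n s a\<close>
  is the odometer level of the point at height \<open>s\<close> of the tower with index \<open>a\<close>, and \<open>height n\<close>
  recovers \<open>s\<close> from that level.\<close>

primrec point :: "nat \<Rightarrow> nat \<Rightarrow> nat \<Rightarrow> nat" where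
  "point 0 s a = s + h 0 * a"
| "point (Suc n) s b = point n (s mod h n) (perm n b (s div h n)) + h (Suc n) * b"

primrec height :: "nat \<Rightarrow> nat \<Rightarrow> nat" where
  "height 0 \<rho> = \<rho> mod h 0"
| "height (Suc n) \<rho> = height n (\<rho> mod h (Suc n)) +
     h n * inv (perm n (\<rho> div h (Suc n))) ((\<rho> mod h (Suc n)) div h n)"

lemma q_pos: "0 < q n"
  using q_ge2[of n] by simp

lemma h_pos: "0 < h n"
  by (induction n) (use h_0 q_pos in \<open>auto simp: h_Suc\<close>)

lemma h_mono: "m \<le> n \<Longrightarrow> h m \<le> h n"
  by (rule lift_Suc_mono_le[of h]) (use q_pos in \<open>simp_all add: h_Suc Suc_le_eq\<close>)

lemma h_dvd: "m \<le> n \<Longrightarrow> h m dvd h n"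
  by (induction n rule: dec_induct) (simp_all add: h_Suc dvd_mult2)

lemma h_ge_pow2: "2 ^ n \<le> h n"
proof (induction n)
  case (Suc n)
  have "2 ^ n * 2 \<le> h n * q n" using Suc q_ge2[of n] by (rule mult_le_mono)
  then show ?case by (simp add: h_Suc mult.commute)
qed (use h_0 in simp)

lemma perm_less: "i < q n \<Longrightarrow> perm n b i < q n"
  using permutes_in_image[OF perm, of n b i] by simp

lemma inv_perm_less: "i < q n \<Longrightarrow> inv (perm n b) i < q n"
  using permutes_in_image[OF permutes_inv[OF perm], of n b i] by simp

lemma div_h_less: "s < h (Suc n) \<Longrightarrow> s div h n < q n"
  using h_pos[of n] by (simp add: h_Suc less_mult_imp_div_less mult.commute)

lemma add_h_mult_less:
  assumes "s < h n" "a < q n" shows "s + h n * a < h (Suc n)"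
proof -
  have "s + h n * a < h n * (a + 1)" using assms by simp
  also have "\<dots> \<le> h n * q n" using assms by (intro mult_le_mono2) simp
  finally show ?thesis by (simp add: h_Suc)
qed

lemma point_less: "s < h n \<Longrightarrow> a < q n \<Longrightarrow> point n s a < h (Suc n)"
proof (induction n arbitrary: s a)
  case 0
  then show ?case using add_h_mult_less[of s 0 a] by simp
next
  case (Suc n)
  have "point n (s mod h n) (perm n a (s div h n)) < h (Suc n)"
    using Suc h_pos perm_less div_h_less by simp
  then show ?case using add_h_mult_less[of _ "Suc n" a] Suc.prems by simp
qed

lemma point_Suc_decomp:
  assumes "s < h (Suc n)"
  shows "point (Suc n) s b div h (Suc n) = b"
    "point (Suc n) s b mod h (Suc n) = point n (s mod h n) (perm n b (s div h n))"
proof -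
  have "point n (s mod h n) (perm n b (s div h n)) < h (Suc n)"
    using assms h_pos perm_less div_h_less by (intro point_less) auto
  then show "point (Suc n) s b div h (Suc n) = b"
    "point (Suc n) s b mod h (Suc n) = point n (s mod h n) (perm n b (s div h n))" by auto
qed

lemma point_div: "s < h n \<Longrightarrow> point n s a div h n = a"
  by (cases n) (simp, metis point_Suc_decomp(1))

lemma height_less: "height n \<rho> < h n"
proof (induction n arbitrary: \<rho>)
  case 0
  then show ?case using h_0 by simp
next
  case (Suc n)
  then show ?case using h_pos by (simp add: add_h_mult_less inv_perm_less div_h_less)
qed

lemma height_point: "s < h n \<Longrightarrow> a < q n \<Longrightarrow> height n (point n s a) = s"
proof (induction n arbitrary: s a)
  case (Suc n)
  have "height n (point n (s mod h n) (perm n a (s div h n))) = s mod h n"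
    using Suc h_pos perm_less div_h_less by simp
  moreover have "point n (s mod h n) (perm n a (s div h n)) div h n = perm n a (s div h n)"
    using h_pos by (intro point_div) simp
  ultimately show ?case
    using point_Suc_decomp[OF Suc.prems(1), of a] permutes_inverses(2)[OF perm] by (simp del: point.simps)
qed simp

lemma point_height: "\<rho> < h (Suc n) \<Longrightarrow> point n (height n \<rho>) (\<rho> div h n) = \<rho>"
proof (induction n arbitrary: \<rho>)
  case (Suc n)
  define \<rho>' where "\<rho>' = \<rho> mod h (Suc n)"
  have \<rho>': "\<rho>' < h (Suc n)" using h_pos unfolding \<rho>'_def by simp
  let ?y = "inv (perm n (\<rho> div h (Suc n))) (\<rho>' div h n)"
  have H: "height (Suc n) \<rho> = height n \<rho>' + h n * ?y" by (simp add: \<rho>'_def)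
  have "height (Suc n) \<rho> mod h n = height n \<rho>'" "height (Suc n) \<rho> div h n = ?y"
    unfolding H using height_less[of n \<rho>'] by auto
  then have "point (Suc n) (height (Suc n) \<rho>) (\<rho> div h (Suc n)) = \<rho>' + h (Suc n) * (\<rho> div h (Suc n))"
    using Suc.IH[OF \<rho>'] permutes_inverses(1)[OF perm] by (simp del: height.simps)
  then show ?case by (simp add: \<rho>'_def)
qed simp

end

text \<open>The odometer enters only through compatible residues: \<open>r n\<close> is the position
  modulo \<open>h n\<close>. The relations hold everywhere on the invariant conull set
  \<open>G\<^sub>0\<close>, so that orbits can be followed point by point.\<close>

locale tower_system = digit_system h q perm + prob_space M
  for h q perm and M :: "'a measure" +
  fixes S :: "'a \<Rightarrow> 'a" and G\<^sub>0 :: "'a set" and r :: "nat \<Rightarrow> 'a \<Rightarrow> nat"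
  assumes S: "S \<in> Aut M" and G0_sets: "G\<^sub>0 \<in> sets M" and G0_AE: "AE x in M. x \<in> G\<^sub>0"
    and G0_invariant: "x \<in> G\<^sub>0 \<Longrightarrow> zpow M S k x \<in> G\<^sub>0"
    and r_measurable [measurable]: "r n \<in> measurable M (count_space UNIV)"
    and r_less: "r n x < h n"
    and r_mod: "x \<in> G\<^sub>0 \<Longrightarrow> r (Suc n) x mod h n = r n x"
    and r_S: "x \<in> G\<^sub>0 \<Longrightarrow> r n (S x) = (r n x + 1) mod h n"
begin

lemmas bij_S = Aut_bij[OF S]

lemma G0_space: "x \<in> G\<^sub>0 \<Longrightarrow> x \<in> space M"
  using G0_sets sets.sets_into_space by auto

lemma S_in_G0: "x \<in> G\<^sub>0 \<Longrightarrow> S x \<in> G\<^sub>0"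
  using G0_invariant[of x 1] zpow_one[OF bij_S] G0_space by simp

lemma r_zpow:
  assumes x: "x \<in> G\<^sub>0"
  shows "int (r n (zpow M S k x)) = (int (r n x) + k) mod int (h n)"
proof (induction k rule: int_induct[where k = 0])
  case base
  then show ?case using r_less[of n x] by simp
next
  case (step1 i)
  have "int (r n (zpow M S (i + 1) x)) = (int (r n (zpow M S i x)) + 1) mod int (h n)"
    unfolding zpow_plus_one[OF bij_S G0_space[OF x]] r_S[OF G0_invariant[OF x]] by (simp add: zmod_int add.commute)
  also have "\<dots> = (int (r n x) + (i + 1)) mod int (h n)" unfolding step1 by (simp add: mod_simps add.assoc)
  finally show ?case .
next
  case (step2 i)
  let ?y = "zpow M S (i - 1) x"
  have y: "?y \<in> G\<^sub>0" by (rule G0_invariant[OF x])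
  have "(int (r n ?y) + 1) mod int (h n) = (int (r n x) + i) mod int (h n)"
    using arg_cong[OF r_S[OF y, of n], of int] zpow_minus_one[OF bij_S G0_space[OF x], of i] step2
    by (simp add: zmod_int add.commute)
  then have "((int (r n ?y) + 1) - 1) mod int (h n) = ((int (r n x) + i) - 1) mod int (h n)"
    by (rule mod_diff_cong) simp
  then show ?case using r_less[of n ?y] by (simp add: algebra_simps)
qed

definition level :: "nat \<Rightarrow> nat \<Rightarrow> 'a set" where
  "level n i = {x \<in> G\<^sub>0. r n x = i}"

lemma level_sets [measurable]: "level n i \<in> sets M"
proof -
  have "level n i = G\<^sub>0 \<inter> (r n -` {i} \<inter> space M)" using G0_space by (auto simp: level_def)
  then show ?thesis using G0_sets measurable_sets[OF r_measurable, of "{i}" n] by auto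
qed

text \<open>\<open>S\<close> moves each level except the top one onto the next, so all
  \<open>h n\<close> levels have the same mass.\<close>

lemma prob_level:
  assumes "i < h n"
  shows "prob (level n i) = 1 / h n"
proof -
  have const: "i < h n \<Longrightarrow> prob (level n i) = prob (level n 0)" for i
  proof (induction i)
    case (Suc i)
    have "S -` level n (Suc i) \<inter> G\<^sub>0 = level n i"
      using Suc.prems S_in_G0 r_S r_less[of n] unfolding level_def by (auto simp: mod_Suc split: if_splits)
    moreover have "prob (S -` level n (Suc i) \<inter> G\<^sub>0) = prob (S -` level n (Suc i) \<inter> space M)"
    proof (rule finite_measure_eq_AE)
      show "S -` level n (Suc i) \<inter> space M \<in> events"
        using S measurable_sets[OF _ level_sets, of S M n "Suc i"] by (simp add: Aut_def)
      moreover have "S -` level n (Suc i) \<inter> G\<^sub>0 = (S -` level n (Suc i) \<inter> space M) \<inter> G\<^sub>0"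
        using G0_space by auto
      ultimately show "S -` level n (Suc i) \<inter> G\<^sub>0 \<in> events" using G0_sets by auto
      show "AE x in M. (x \<in> S -` level n (Suc i) \<inter> G\<^sub>0) = (x \<in> S -` level n (Suc i) \<inter> space M)"
        using G0_AE by eventually_elim (use G0_space in auto)
    qed
    moreover have "prob (S -` level n (Suc i) \<inter> space M) = prob (level n (Suc i))"
      using S measure_distr[of S M M "level n (Suc i)"] by (simp add: Aut_def)
    ultimately show ?case using Suc by simp
  qed simp
  have "G\<^sub>0 = (\<Union>i<h n. level n i)" using r_less by (auto simp: level_def)
  then have "prob G\<^sub>0 = prob (\<Union>i<h n. level n i)" by (rule arg_cong)
  also have "\<dots> = (\<Sum>i<h n. prob (level n i))"
    proof (rule finite_measure_finite_Union)
    show "disjoint_family_on (level n) {..<h n}" by (auto simp: disjoint_family_on_def level_def)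
  qed auto
  also have "\<dots> = (\<Sum>i<h n. prob (level n 0))" by (intro sum.cong refl const) simp
  also have "prob G\<^sub>0 = 1" using G0_AE G0_sets by (simp add: prob_eq_1)
  finally have "1 = h n * prob (level n 0)" by simp
  then show ?thesis using const[OF assms] h_pos[of n] by (simp add: field_simps)
qed

text \<open>The position in a tower of height \<open>h n\<close> is read from stage n + 1 of the
  odometer, because the order inside the tower depends on the index of the tower.\<close>

definition s :: "nat \<Rightarrow> 'a \<Rightarrow> nat" where "s n x = height n (r (Suc n) x)"

definition digit :: "nat \<Rightarrow> 'a \<Rightarrow> nat" where "digit n x = r (Suc n) x div h n"

lemma s_less: "s n x < h n"
  by (simp add: s_def height_less)

lemma digit_less: "x \<in> G\<^sub>0 \<Longrightarrow> digit n x < q n"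
  unfolding digit_def by (rule div_h_less[OF r_less])

lemma point_s_digit: "x \<in> G\<^sub>0 \<Longrightarrow> point n (s n x) (digit n x) = r (Suc n) x"
  unfolding s_def digit_def by (rule point_height[OF r_less])

lemma s_digit_eqI:
  assumes "r (Suc n) x = point n j a" "j < h n" "a < q n"
  shows "s n x = j" "digit n x = a"
  using assms by (simp_all add: s_def digit_def height_point point_div)

lemma s_Suc:
  assumes "x \<in> G\<^sub>0"
  shows "s (Suc n) x = s n x + h n * inv (perm n (digit (Suc n) x)) (digit n x)"
  using r_mod[OF assms, of "Suc n"] by (simp add: s_def digit_def)

lemma s_Suc_mod: "x \<in> G\<^sub>0 \<Longrightarrow> s (Suc n) x mod h n = s n x"
  using s_less[of n x] by (simp add: s_Suc)

lemma s_mod: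
  assumes "x \<in> G\<^sub>0" "m \<le> n"
  shows "s n x mod h m = s m x"
  using assms(2)
proof (induction n rule: dec_induct)
  case (step n)
  then show ?case using s_Suc_mod[OF assms(1), of n] mod_mod_cancel[OF h_dvd[OF step(1)], of "s (Suc n) x"] by simp
qed (use s_less in simp)

text \<open>Height and index together encode, through \<open>point\<close>, a single level of the
  odometer at stage n + 1.\<close>

lemma prob_s_digit:
  assumes "j < h n" "a < q n"
  shows "prob {x \<in> G\<^sub>0. s n x = j \<and> digit n x = a} = 1 / h (Suc n)"
proof -
  have "{x \<in> G\<^sub>0. s n x = j \<and> digit n x = a} = level (Suc n) (point n j a)"
    unfolding level_def
  proof (intro Collect_cong conj_cong refl iffI)
    fix x assume x: "x \<in> G\<^sub>0"
    show "r (Suc n) x = point n j a" if "s n x = j \<and> digit n x = a" using point_s_digit[OF x, of n] that by simp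
    show "s n x = j \<and> digit n x = a" if "r (Suc n) x = point n j a" using s_digit_eqI[OF that assms] by simp
  qed
  then show ?thesis using prob_level[OF point_less[OF assms]] by simp
qed

lemma s_measurable [measurable]: "s n \<in> measurable M (count_space UNIV)"
  unfolding s_def[abs_def] by measurable

lemma digit_measurable [measurable]: "digit n \<in> measurable M (count_space UNIV)"
  unfolding digit_def[abs_def] by measurable

lemma G0_Collect_sets [measurable]: "Measurable.pred M P \<Longrightarrow> {x \<in> G\<^sub>0. P x} \<in> sets M"
proof -
  assume P: "Measurable.pred M P"
  have "{x \<in> G\<^sub>0. P x} = G\<^sub>0 \<inter> {x \<in> space M. P x}" using G0_space by auto
  then show ?thesis using G0_sets P by (auto simp: pred_def)
qed

lemma prob_s:
  assumes "j < h n"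
  shows "prob {x \<in> G\<^sub>0. s n x = j} = 1 / h n"
proof -
  have "{x \<in> G\<^sub>0. s n x = j} = (\<Union>a<q n. {x \<in> G\<^sub>0. s n x = j \<and> digit n x = a})"
    using digit_less by auto
  then have "prob {x \<in> G\<^sub>0. s n x = j} = (\<Sum>a<q n. prob {x \<in> G\<^sub>0. s n x = j \<and> digit n x = a})"
    using finite_measure_finite_Union[of "{..<q n}" "\<lambda>a. {x \<in> G\<^sub>0. s n x = j \<and> digit n x = a}"]
    by (force simp: disjoint_family_on_def)
  also have "\<dots> = q n * (1 / h (Suc n))" using prob_s_digit[OF assms] by simp
  finally show ?thesis using q_pos[of n] by (simp add: h_Suc)
qed

text \<open>Along the whole orbit three degenerate positions are excluded: being at the top of the
  T-tower at all stages (T could not be defined), at its bottom at all stages (no preimage), and at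
  the top of the odometer tower at all stages (\<open>cS\<close> could not be read off).\<close>

definition G :: "'a set" where
  "G = {x \<in> G\<^sub>0. \<forall>k. (\<exists>n. s n (zpow M S k x) + 1 < h n) \<and> (\<exists>n. 0 < s n (zpow M S k x)) \<and>
                     (\<exists>n. r n (zpow M S k x) + 1 < h n)}"

lemma G_G0: "x \<in> G \<Longrightarrow> x \<in> G\<^sub>0"
  by (simp add: G_def)

lemma G_space: "x \<in> G \<Longrightarrow> x \<in> space M"
  using G_G0 G0_space by blast

lemma G_invariant: "x \<in> G \<Longrightarrow> zpow M S k x \<in> G"
  unfolding G_def using G0_invariant zpow_add[OF bij_S G0_space, symmetric] by auto

lemma G_exE:
  assumes "x \<in> G"
  obtains m n l where "s m x + 1 < h m" "0 < s n x" "r l x + 1 < h l"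
proof -
  have "(\<exists>n. s n (zpow M S 0 x) + 1 < h n) \<and> (\<exists>n. 0 < s n (zpow M S 0 x)) \<and>
                     (\<exists>n. r n (zpow M S 0 x) + 1 < h n)" using assms unfolding G_def by blast
  then show ?thesis using that by auto
qed

lemma inverse_h_tendsto_0: "(\<lambda>n. 1 / real (h n)) \<longlonglongrightarrow> 0"
proof (rule tendsto_sandwich[OF _ _ tendsto_const])
  show "(\<lambda>n. (1 / 2 :: real) ^ n) \<longlonglongrightarrow> 0" by (intro LIMSEQ_power_zero) simp
  show "\<forall>\<^sub>F n in sequentially. 1 / real (h n) \<le> (1 / 2) ^ n"
  proof (rule always_eventually, rule allI)
    fix n
    have "2 ^ n \<le> real (h n)" using h_ge_pow2[of n] by (metis of_nat_le_iff of_nat_numeral of_nat_power)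
    then show "1 / real (h n) \<le> (1 / 2) ^ n" by (simp add: power_divide frac_le)
  qed
qed simp

lemma AE_exists_not:
  assumes "\<And>n. {x \<in> G\<^sub>0. P n x} \<in> sets M" "\<And>n. prob {x \<in> G\<^sub>0. P n x} \<le> 1 / h n"
  shows "AE x in M. \<exists>n. \<not> P n x"
proof -
  let ?B = "\<Inter>n. {x \<in> G\<^sub>0. P n x}"
  have B: "?B \<in> sets M" using assms(1) by (intro sets.countable_INT) auto
  have "prob ?B \<le> 1 / h n" for n
    using finite_measure_mono[OF _ assms(1)[of n], of ?B] assms(2)[of n] by force
  then have "prob ?B \<le> 0" by (intro LIMSEQ_le_const[OF inverse_h_tendsto_0]) auto
  then have "prob ?B = 0" by (simp add: measure_le_0_iff)
  then have "AE x in M. x \<notin> ?B" using B by (simp add: prob_eq_0)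
  then show ?thesis using G0_AE by eventually_elim auto
qed

lemma G_AE: "AE x in M. x \<in> G"
proof -
  have 1: "AE x in M. \<exists>n. s n x + 1 < h n"
  proof -
    have "AE x in M. \<exists>n. \<not> (s n x = h n - 1)"
      by (rule AE_exists_not) (use prob_s h_pos in \<open>auto simp: less_Suc_eq_le\<close>)
    then show ?thesis
    proof eventually_elim
      case (elim x)
      then obtain n where "s n x \<noteq> h n - 1" by blast
      then have "s n x + 1 < h n" using s_less[of n x] by linarith
      then show ?case ..
    qed
  qed
  have 2: "AE x in M. \<exists>n. 0 < s n x"
  proof -
    have "AE x in M. \<exists>n. \<not> (s n x = 0)"
      by (rule AE_exists_not) (use prob_s h_pos in auto)
    then show ?thesis by eventually_elim auto
  qed
  have 3: "AE x in M. \<exists>n. r n x + 1 < h n"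
  proof -
    have "AE x in M. \<exists>n. \<not> (r n x = h n - 1)"
      by (rule AE_exists_not) (use prob_level[unfolded level_def] h_pos in \<open>auto simp: less_Suc_eq_le\<close>)
    then show ?thesis
    proof eventually_elim
      case (elim x)
      then obtain n where "r n x \<noteq> h n - 1" by blast
      then have "r n x + 1 < h n" using r_less[of n x] by linarith
      then show ?case ..
    qed
  qed
  have "AE x in M. \<forall>k. (\<exists>n. s n (zpow M S k x) + 1 < h n) \<and> (\<exists>n. 0 < s n (zpow M S k x)) \<and>
                     (\<exists>n. r n (zpow M S k x) + 1 < h n)"
    unfolding AE_all_countable using AE_zpow[OF S 1] AE_zpow[OF S 2] AE_zpow[OF S 3] by auto
  then show ?thesis using G0_AE unfolding G_def by eventually_elim auto
qed

lemma G_sets [measurable]: "G \<in> sets M"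
proof -
  let ?P = "{x \<in> space M. (\<exists>n. s n x + 1 < h n) \<and> (\<exists>n. 0 < s n x) \<and> (\<exists>n. r n x + 1 < h n)}"
  have P: "?P \<in> sets M" by measurable
  have eq: "G = G\<^sub>0 \<inter> (\<Inter>k. zpow M S k -` ?P \<inter> space M)"
    using zpow_in_space[OF bij_S] G0_space unfolding G_def by auto
  have "zpow M S k -` ?P \<inter> space M \<in> sets M" for k by (rule measurable_sets[OF zpow_measurable[OF S] P])
  then show ?thesis unfolding eq using G0_sets by (intro sets.Int sets.countable_INT) auto
qed

end

section \<open>The reordered map\<close>

context tower_system
begin

text \<open>Displacement along the S-orbit that leads one step up in the tower of height
  \<open>h n\<close>; meaningful below its top.\<close>

definition shift :: "nat \<Rightarrow> 'a \<Rightarrow> int" where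
  "shift n x = int (point n (s n x + 1) (digit n x)) - int (r (Suc n) x)"

text \<open>Any stage at which x is not on top gives the same value, by \<open>shift_mono\<close>.
  Off \<open>G\<close> the value 0 makes T the identity there, hence a bijection of the whole
  space.\<close>

definition cT :: "'a \<Rightarrow> int" where
  "cT x = (if x \<in> G then shift (LEAST n. s n x + 1 < h n) x else 0)"

definition T :: "'a \<Rightarrow> 'a" where "T x = zpow M S (cT x) x"

text \<open>Below the top of a subtower the next point of the larger tower lies in the same
  subtower, so the larger tower prescribes the same step.\<close>

lemma shift_Suc:
  assumes x: "x \<in> G\<^sub>0" and n: "s n x + 1 < h n"
  shows "s (Suc n) x + 1 < h (Suc n)" "shift (Suc n) x = shift n x"
proof -
  let ?y = "inv (perm n (digit (Suc n) x)) (digit n x)"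
  have y: "?y < q n" by (rule inv_perm_less[OF digit_less[OF x]])
  have e: "s (Suc n) x + 1 = (s n x + 1) + h n * ?y" using s_Suc[OF x] by simp
  show "s (Suc n) x + 1 < h (Suc n)" unfolding e by (rule add_h_mult_less[OF n y])
  have "(t + h n * ?y) mod h n = t \<and> (t + h n * ?y) div h n = ?y" if "t < h n" for t using that by auto
  from this[OF n] have "(s (Suc n) x + 1) mod h n = s n x + 1" "(s (Suc n) x + 1) div h n = ?y"
    unfolding e by auto
  then have "point (Suc n) (s (Suc n) x + 1) (digit (Suc n) x)
      = point n (s n x + 1) (digit n x) + h (Suc n) * digit (Suc n) x"
    using permutes_inverses(1)[OF perm] by simp
  moreover have "r (Suc (Suc n)) x = r (Suc n) x + h (Suc n) * digit (Suc n) x"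
    using r_mod[OF x, of "Suc n"] mult_div_mod_eq[of "h (Suc n)" "r (Suc (Suc n)) x"] unfolding digit_def by simp
  ultimately show "shift (Suc n) x = shift n x" unfolding shift_def by simp
qed

lemma shift_mono:
  assumes x: "x \<in> G\<^sub>0" and n: "s n x + 1 < h n" and "n \<le> m"
  shows "s m x + 1 < h m \<and> shift m x = shift n x"
  using assms(3) by (induction m rule: dec_induct) (use shift_Suc[OF x] n in auto)

lemma cT_eq:
  assumes x: "x \<in> G" and n: "s n x + 1 < h n"
  shows "cT x = shift n x"
proof -
  let ?n = "LEAST n. s n x + 1 < h n"
  have least: "s ?n x + 1 < h ?n" using n by (rule LeastI)
  have le: "?n \<le> n" using n by (rule Least_le)
  have "shift n x = shift ?n x" using shift_mono[OF G_G0[OF x] least le] by (rule conjunct2)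
  then show ?thesis using x by (simp only: cT_def if_True)
qed

lemma T_outside: "x \<notin> G \<Longrightarrow> T x = x"
  by (simp add: T_def cT_def)

lemma T_in_G: "x \<in> G \<Longrightarrow> T x \<in> G"
  unfolding T_def by (rule G_invariant)

lemma T_step:
  assumes x: "x \<in> G" and n: "s n x + 1 < h n"
  shows "r (Suc n) (T x) = point n (s n x + 1) (digit n x)"
    "s n (T x) = s n x + 1" "digit n (T x) = digit n x"
proof -
  have d: "digit n x < q n" by (rule digit_less[OF G_G0[OF x]])
  have "int (r (Suc n) (T x)) = (int (r (Suc n) x) + shift n x) mod int (h (Suc n))"
    unfolding T_def cT_eq[OF x n] by (rule r_zpow[OF G_G0[OF x]])
  also have "\<dots> = int (point n (s n x + 1) (digit n x))"
    unfolding shift_def using point_less[OF n d] by simp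
  finally show r: "r (Suc n) (T x) = point n (s n x + 1) (digit n x)" by simp
  show "s n (T x) = s n x + 1" "digit n (T x) = digit n x" using s_digit_eqI[OF r n d] by auto
qed

text \<open>At some stage at least n the point is not on top and T just adds 1 to the height;
  reduction modulo \<open>h n\<close> gives the claim even at the top of the tower of height
  \<open>h n\<close>.\<close>

lemma s_T:
  assumes x: "x \<in> G"
  shows "s n (T x) = (s n x + 1) mod h n"
proof -
  obtain m where m: "s m x + 1 < h m" using G_exE[OF x] by metis
  have k: "s (max m n) x + 1 < h (max m n)"
    by (rule shift_mono[OF G_G0[OF x] m, THEN conjunct1]) simp
  have "s n (T x) = s (max m n) (T x) mod h n"
    using s_mod[OF G_G0[OF T_in_G[OF x]], of n "max m n"] by simp
  also have "\<dots> = (s (max m n) x mod h n + 1) mod h n" using T_step(2)[OF x k] by (simp add: mod_simps)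
  also have "s (max m n) x mod h n = s n x" by (rule s_mod[OF G_G0[OF x]]) simp
  finally show ?thesis .
qed

lemma funpow_T_in_G: "x \<in> G \<Longrightarrow> (T ^^ i) x \<in> G"
  by (induction i) (auto intro: T_in_G)

lemma s_funpow_T:
  assumes x: "x \<in> G"
  shows "s n ((T ^^ i) x) = (s n x + i) mod h n"
proof (induction i)
  case 0
  then show ?case using s_less by simp
next
  case (Suc i)
  then show ?case using s_T[OF funpow_T_in_G[OF x]] by (simp add: mod_simps)
qed

lemma funpow_T_step:
  assumes x: "x \<in> G" and i: "s n x + i < h n"
  shows "r (Suc n) ((T ^^ i) x) = point n (s n x + i) (digit n x) \<and> digit n ((T ^^ i) x) = digit n x \<and>
    (T ^^ i) x = zpow M S (int (point n (s n x + i) (digit n x)) - int (r (Suc n) x)) x"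
  using i
proof (induction i)
  case 0
  show ?case using point_s_digit[OF G_G0[OF x]] by simp
next
  case (Suc i)
  let ?y = "(T ^^ i) x"
  have lt: "s n x + i < h n" using Suc.prems by simp
  have IH: "r (Suc n) ?y = point n (s n x + i) (digit n x)" "digit n ?y = digit n x"
    "?y = zpow M S (int (point n (s n x + i) (digit n x)) - int (r (Suc n) x)) x"
    using Suc.IH[OF lt] by blast+
  have y: "?y \<in> G" by (rule funpow_T_in_G[OF x])
  have sy: "s n ?y = s n x + i" using s_funpow_T[OF x, of n i] lt by simp
  have step: "s n ?y + 1 < h n" using Suc.prems sy by simp
  have 1: "r (Suc n) ((T ^^ Suc i) x) = point n (s n x + Suc i) (digit n x)"
    using T_step(1)[OF y step] sy IH(2) by simp
  have 2: "digit n ((T ^^ Suc i) x) = digit n x" using T_step(3)[OF y step] IH(2) by simp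
  have "(T ^^ Suc i) x = zpow M S (shift n ?y) ?y" using cT_eq[OF y step] by (simp add: T_def)
  also have "shift n ?y = int (point n (s n x + Suc i) (digit n x)) - int (point n (s n x + i) (digit n x))"
    unfolding shift_def sy IH(1,2) by simp
  also have "zpow M S \<dots> ?y = zpow M S \<dots> (zpow M S (int (point n (s n x + i) (digit n x)) - int (r (Suc n) x)) x)"
    by (subst IH(3)) simp
  also have "\<dots> = zpow M S (int (point n (s n x + Suc i) (digit n x)) - int (r (Suc n) x)) x"
    using zpow_add[OF bij_S G_space[OF x], symmetric] by simp
  finally show ?case using 1 2 by blast
qed

text \<open>At a common stage where neither point is on top, the image determines height and index
  of both, hence their cocycle values, and a power of \<open>S\<close> is injective.\<close>

lemma inj_on_T: "inj_on T G"
proof (rule inj_onI)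
  fix x y assume x: "x \<in> G" and y: "y \<in> G" and eq: "T x = T y"
  obtain m m' where m: "s m x + 1 < h m" and m': "s m' y + 1 < h m'" using G_exE[OF x] G_exE[OF y] by metis
  have kx: "s (max m m') x + 1 < h (max m m')"
    by (rule shift_mono[OF G_G0[OF x] m, THEN conjunct1]) simp
  have ky: "s (max m m') y + 1 < h (max m m')"
    by (rule shift_mono[OF G_G0[OF y] m', THEN conjunct1]) simp
  let ?n = "max m m'"
  have "s ?n x = s ?n y" "digit ?n x = digit ?n y"
    using T_step(2,3)[OF x kx] T_step(2,3)[OF y ky] eq by auto
  then have "cT x = cT y"
    unfolding cT_eq[OF x kx] cT_eq[OF y ky] shift_def
    using point_s_digit[OF G_G0[OF x], of ?n] point_s_digit[OF G_G0[OF y], of ?n] by simp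
  then have "zpow M S (cT x) x = zpow M S (cT x) y" using eq by (simp add: T_def)
  then show "x = y" using zpow_uminus_cancel(1)[OF bij_S G_space] x y by metis
qed

lemma T_image_G: "T ` G = G"
proof
  show "T ` G \<subseteq> G" using T_in_G by auto
  show "G \<subseteq> T ` G"
  proof
    fix y assume y: "y \<in> G"
    obtain n where n: "0 < s n y" using G_exE[OF y] by metis
    \<comment> \<open>The preimage is the point one step lower in a tower where y is not at the
      bottom, reached by a power of \<open>S\<close>.\<close>
    let ?\<rho> = "point n (s n y - 1) (digit n y)"
    let ?x = "zpow M S (int ?\<rho> - int (r (Suc n) y)) y"
    have d: "digit n y < q n" by (rule digit_less[OF G_G0[OF y]])
    have l: "s n y - 1 < h n" using s_less[of n y] by simp
    have x: "?x \<in> G" by (rule G_invariant[OF y])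
    have "int (r (Suc n) ?x) = (int (r (Suc n) y) + (int ?\<rho> - int (r (Suc n) y))) mod int (h (Suc n))"
      by (rule r_zpow[OF G_G0[OF y]])
    also have "\<dots> = int ?\<rho>" using point_less[OF l d] by simp
    finally have r: "r (Suc n) ?x = ?\<rho>" by simp
    note sx = s_digit_eqI[OF r l d]
    have step: "s n ?x + 1 < h n" using sx(1) n s_less[of n y] by simp
    have "cT ?x = int (point n (s n y) (digit n y)) - int ?\<rho>"
      unfolding cT_eq[OF x step] shift_def r sx using n by simp
    also have "\<dots> = int (r (Suc n) y) - int ?\<rho>" using point_s_digit[OF G_G0[OF y]] by simp
    finally have "T ?x = y"
      unfolding T_def using zpow_add[OF bij_S G_space[OF y], symmetric] by simp
    then show "y \<in> T ` G" using x by (metis imageI)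
  qed
qed

lemma bij_T: "bij_betw T (space M) (space M)"
proof -
  have "bij_betw T G G" by (rule bij_betw_imageI[OF inj_on_T T_image_G])
  moreover have "bij_betw T (space M - G) (space M - G)"
    by (subst bij_betw_cong[where g = id]) (simp_all add: T_outside)
  ultimately have "bij_betw T (G \<union> (space M - G)) (G \<union> (space M - G))"
    by (rule bij_betw_combine) auto
  moreover have "G \<union> (space M - G) = space M" using G_space by auto
  ultimately show ?thesis by simp
qed

lemma cT_measurable [measurable]: "cT \<in> measurable M (count_space UNIV)"
proof -
  have F: "(\<lambda>x. f (r n x)) \<in> measurable M (count_space UNIV)" for n and f :: "nat \<Rightarrow> int"
    using measurable_compose[OF r_measurable, of f "count_space UNIV" n] by simp
  have shift: "(\<lambda>x. shift n x) \<in> measurable M (count_space UNIV)" for n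
    using F[of "\<lambda>\<rho>. int (point n (height n \<rho> + 1) (\<rho> div h n)) - int \<rho>" "Suc n"]
    unfolding shift_def s_def digit_def .
  have L: "(\<lambda>x. LEAST n. s n x + 1 < h n) \<in> measurable M (count_space UNIV)" by measurable
  have "(\<lambda>x. shift (LEAST n. s n x + 1 < h n) x) \<in> measurable M (count_space UNIV)"
    by (rule measurable_compose_countable[OF shift L])
  then show ?thesis unfolding cT_def[abs_def] by (intro measurable_If) auto
qed

lemma T_in_Aut: "T \<in> Aut M"
  by (rule full_group_in_Aut[OF S cT_measurable T_def bij_T])

lemma abs_diff_less_if_div_eq:
  fixes a b k :: nat
  assumes "a div k = b div k" "0 < k"
  shows "\<bar>int a - int b\<bar> < int k"
proof -
  have a: "int a = int k * int (a div k) + int (a mod k)"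
    by (metis mult_div_mod_eq of_nat_add of_nat_mult)
  have b: "int b = int k * int (a div k) + int (b mod k)"
    unfolding assms(1) by (metis mult_div_mod_eq of_nat_add of_nat_mult)
  moreover have "a mod k < k" "b mod k < k" using assms(2) by simp_all
  ultimately show ?thesis using a b by linarith
qed

text \<open>The tower with index a occupies the odometer levels with quotient a modulo
  \<open>h n\<close>, an interval of length \<open>h n\<close>; below the top, T stays in
  it.\<close>

lemma abs_cT_less:
  assumes x: "x \<in> G" and n: "s n x + 1 < h n"
  shows "\<bar>cT x\<bar> < int (h n)"
  unfolding cT_eq[OF x n] shift_def
  by (rule abs_diff_less_if_div_eq[OF _ h_pos]) (simp only: point_div[OF n] digit_def)

text \<open>The mirror image of \<open>cT\<close>: if x is not on top of its odometer block, x and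
  \<open>S x\<close> lie in the same T-tower, and the power of T that joins them is the difference
  of their heights.\<close>

definition cS :: "'a \<Rightarrow> int" where
  "cS x = (let n = LEAST n. r n x + 1 < h n in int (s n (S x)) - int (s n x))"

lemma S_measurable [measurable]: "S \<in> measurable M M"
  using S by (simp add: Aut_def)

lemma cS_measurable [measurable]: "cS \<in> measurable M (count_space UNIV)"
proof -
  have d: "(\<lambda>x. int (s n (S x)) - int (s n x)) \<in> measurable M (count_space UNIV)" for n
  proof (rule measurable_compose_countable[where g = "\<lambda>x. s n (S x)"])
    show "(\<lambda>x. s n (S x)) \<in> measurable M (count_space UNIV)"
      by (rule measurable_compose[OF S_measurable s_measurable])
    show "(\<lambda>x. int i - int (s n x)) \<in> measurable M (count_space UNIV)" for i
      using measurable_compose[OF s_measurable, of "\<lambda>j. int i - int j" "count_space UNIV" n] by simp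
  qed
  have L: "(\<lambda>x. LEAST n. r n x + 1 < h n) \<in> measurable M (count_space UNIV)" by measurable
  show ?thesis unfolding cS_def[abs_def] Let_def by (rule measurable_compose_countable[OF d L])
qed

lemma T_transitive_on_tower:
  assumes x: "x \<in> G" and y: "y = zpow M S k x" and d: "digit n y = digit n x"
    and k: "k = int (r (Suc n) y) - int (r (Suc n) x)"
  shows "y = zpow M T (int (s n y) - int (s n x)) x"
proof -
  \<comment> \<open>The case of climbing from the lower to the higher point; otherwise it is applied
    with x and y exchanged.\<close>
  have *: "w = (T ^^ (s n w - s n z)) z"
    if z: "z \<in> G" and w: "w = zpow M S l z" and d: "digit n w = digit n z"
      and l: "l = int (r (Suc n) w) - int (r (Suc n) z)" and le: "s n z \<le> s n w" for z w l
  proof -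
    have wG: "w \<in> G" unfolding w by (rule G_invariant[OF z])
    have "s n z + (s n w - s n z) < h n" using le s_less[of n w] by simp
    note funpow_T_step[OF z this, THEN conjunct2, THEN conjunct2]
    also have "point n (s n z + (s n w - s n z)) (digit n z) = r (Suc n) w"
      using le d point_s_digit[OF G_G0[OF wG], of n] by simp
    finally show ?thesis by (metis w l)
  qed
  have yG: "y \<in> G" unfolding y by (rule G_invariant[OF x])
  show ?thesis
  proof (cases "s n x \<le> s n y")
    case True
    have "zpow M T (int (s n y) - int (s n x)) x = (T ^^ (s n y - s n x)) x"
      unfolding of_nat_diff[OF True, symmetric] zpow_of_nat[OF bij_T] ..
    then show ?thesis using *[OF x y d k True] by (rule trans[OF _ sym, rotated])
  next
    case False
    have x': "x = zpow M S (- k) y" unfolding y using zpow_uminus_cancel(1)[OF bij_S G_space[OF x]] by simp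
    have k': "- k = int (r (Suc n) x) - int (r (Suc n) y)" unfolding k by simp
    have le: "s n y \<le> s n x" using False by simp
    have "x = zpow M T (int (s n x - s n y)) y"
      unfolding zpow_of_nat[OF bij_T] by (rule *[OF yG x' d[symmetric] k' le])
    then have "y = zpow M T (- int (s n x - s n y)) x"
      using zpow_uminus_cancel(1)[OF bij_T G_space[OF yG]] by metis
    moreover have "- int (s n x - s n y) = int (s n y) - int (s n x)" using le by (simp add: of_nat_diff)
    ultimately show ?thesis by metis
  qed
qed

lemma cS_props:
  assumes x: "x \<in> G"
  shows "S x = zpow M T (cS x) x" and "r n x + 1 < h n \<Longrightarrow> \<bar>cS x\<bar> < int (h n)"
proof -
  define m where "m = (LEAST n. r n x + 1 < h n)"
  have cS: "cS x = int (s m (S x)) - int (s m x)" by (simp add: cS_def m_def Let_def)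
  have "\<exists>n. r n x + 1 < h n" using G_exE[OF x] by metis
  then have m: "r m x + 1 < h m" unfolding m_def by (rule LeastI_ex)
  have x0: "x \<in> G\<^sub>0" by (rule G_G0[OF x])
  have rS: "r (Suc m) x + 1 < h (Suc m)" "(r (Suc m) x + 1) div h m = r (Suc m) x div h m"
  proof -
    have e: "r (Suc m) x + 1 = (r m x + 1) + h m * digit m x"
      using r_mod[OF x0, of m] mult_div_mod_eq[of "h m" "r (Suc m) x"] unfolding digit_def by simp
    show "r (Suc m) x + 1 < h (Suc m)" unfolding e by (rule add_h_mult_less[OF m digit_less[OF x0]])
    show "(r (Suc m) x + 1) div h m = r (Suc m) x div h m"
      unfolding e using m div_mult_self2[of "h m" "r m x + 1" "digit m x"] by (simp add: digit_def)
  qed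
  have S1: "S x = zpow M S 1 x" using zpow_one[OF bij_S G_space[OF x]] by simp
  have rSx: "r (Suc m) (S x) = r (Suc m) x + 1" using r_S[OF x0, of "Suc m"] rS(1) by simp
  have "S x = zpow M T (int (s m (S x)) - int (s m x)) x"
    by (rule T_transitive_on_tower[OF x S1]) (use rSx rS(2) in \<open>simp_all add: digit_def\<close>)
  then show "S x = zpow M T (cS x) x" unfolding cS .
  \<comment> \<open>\<open>cS\<close> is a difference of heights in a tower of the least admissible
    stage m, hence below \<open>h m \<le> h n\<close>.\<close>
  show "\<bar>cS x\<bar> < int (h n)" if n: "r n x + 1 < h n"
  proof -
    have "m \<le> n" unfolding m_def by (rule Least_le) (rule n)
    then have "h m \<le> h n" by (rule h_mono)
    then show ?thesis unfolding cS using s_less[of m x] s_less[of m "S x"] by linarith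
  qed
qed

text \<open>A period n would be a multiple of \<open>h n\<close>, but
  \<open>n < 2 ^ n \<le> h n\<close>.\<close>

lemma aperiodic_S: "aperiodic M S"
  unfolding aperiodic_def
proof (rule AE_mp[OF G0_AE], intro AE_I2 impI allI)
  fix x :: 'a and n :: nat assume x: "x \<in> G\<^sub>0" and n: "0 < n"
  show "(S ^^ n) x \<noteq> x"
  proof
    assume "(S ^^ n) x = x"
    then have "int (r n x) = (int (r n x) + int n) mod int (h n)"
      using r_zpow[OF x, of n "int n"] by (simp add: zpow_of_nat[OF bij_S])
    then have "int n mod int (h n) = 0"
      by (metis add_diff_cancel_left' diff_self mod_0 mod_diff_left_eq)
    moreover have "n < h n" using h_ge_pow2[of n] less_exp[of n] by linarith
    ultimately show False using n by simp
  qed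
qed

lemma aperiodic_T: "aperiodic M T"
  unfolding aperiodic_def
proof (rule AE_mp[OF G_AE], intro AE_I2 impI allI)
  fix x :: 'a and n :: nat assume x: "x \<in> G" and n: "0 < n"
  show "(T ^^ n) x \<noteq> x"
  proof
    assume "(T ^^ n) x = x"
    then have "s n x = (s n x + n) mod h n" using s_funpow_T[OF x, of n n] by simp
    moreover have "n < h n" using h_ge_pow2[of n] less_exp[of n] by linarith
    ultimately show False using n s_less[of n x]
      by (cases "s n x + n < h n") (auto simp: le_mod_geq)
  qed
qed

lemma orbits_eq:
  assumes x: "x \<in> G"
  shows "orbit_of M S x = orbit_of M T x"
proof
  show "orbit_of M S x \<subseteq> orbit_of M T x"
    by (rule orbit_of_subset[OF bij_S bij_T _ G_invariant _ x])
      (use G_space cS_props(1) in \<open>auto simp: orbit_of_def\<close>)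
  have inv: "zpow M T k y \<in> G" if "y \<in> G" for k y
  proof (induction k rule: int_induct[where k = 0])
    case (step1 i)
    then show ?case using T_in_G zpow_plus_one[OF bij_T G_space[OF that]] by simp
  next
    case (step2 i)
    have "T (zpow M T (i - 1) y) \<in> G" using step2 zpow_minus_one[OF bij_T G_space[OF that]] by simp
    \<comment> \<open>T fixes the points outside \<open>G\<close>, so a point sent into
      \<open>G\<close> lies in \<open>G\<close> already.\<close>
    then show ?case using T_outside by metis
  qed (use that in simp)
  show "orbit_of M T x \<subseteq> orbit_of M S x"
    by (rule orbit_of_subset[OF bij_T bij_S _ inv _ x])
      (use G_space in \<open>auto simp: orbit_of_def T_def\<close>)
qed

lemma orbit_equivalence_id: "orbit_equivalence M S T (\<lambda>x. x)"
  unfolding orbit_equivalence_def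
proof (intro conjI aperiodic_S aperiodic_T)
  have inv_id: "inv_map M (\<lambda>x. x) x = x" if "x \<in> space M" for x
    using inv_into_f_f[of "\<lambda>x. x" "space M" x] that by simp
  show "(\<lambda>x. x) \<in> Aut M"
    unfolding Aut_def using inv_id measurable_cong[of M "inv_map M (\<lambda>x. x)" "\<lambda>x. x" M]
    by (simp add: bij_betw_def distr_id)
  show "AE x in M. orbit_of M S x = orbit_of M (inv_map M (\<lambda>x. x) \<circ> T \<circ> (\<lambda>x. x)) x"
  proof (rule AE_mp[OF G_AE], intro AE_I2 impI)
    fix x assume x: "x \<in> G"
    have "zpow M (inv_map M (\<lambda>x. x) \<circ> T \<circ> (\<lambda>x. x)) k x = zpow M T k x" for k
      by (rule zpow_cong[OF bij_T _ G_space[OF x]]) (use inv_id bij_betwE[OF bij_T] in auto)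
    then show "orbit_of M S x = orbit_of M (inv_map M (\<lambda>x. x) \<circ> T \<circ> (\<lambda>x. x)) x"
      using orbits_eq[OF x] by (simp add: orbit_of_def)
  qed
qed

lemma cocycles: "orbit_equivalence_cocycles M S T (\<lambda>x. x) cS cT"
  unfolding orbit_equivalence_cocycles_def
proof (intro conjI cS_measurable cT_measurable)
  have inv_id: "inv_map M (\<lambda>x. x) x = x" if "x \<in> space M" for x
    using inv_into_f_f[of "\<lambda>x. x" "space M" x] that by simp
  show "AE x in M. S x = inv_map M (\<lambda>x. x) (zpow M T (cS x) x)"
    by (rule AE_mp[OF G_AE], intro AE_I2 impI)
      (use cS_props(1) inv_id zpow_in_space[OF bij_T] in auto)
  show "AE y in M. T y = zpow M S (cT y) (inv_map M (\<lambda>x. x) y)"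
    by (intro AE_I2) (simp add: inv_id T_def)
qed

end

section \<open>Integrability of the cocycles\<close>

definition iter_ln_pos :: "nat \<Rightarrow> real \<Rightarrow> bool" where
  "iter_ln_pos m t \<longleftrightarrow> (\<forall>k\<le>m. 0 < (ln ^^ k) t)"

lemma iter_ln_pos_Suc: "iter_ln_pos (Suc m) t \<longleftrightarrow> iter_ln_pos m t \<and> 0 < (ln ^^ Suc m) t"
  unfolding iter_ln_pos_def by (auto simp: le_Suc_eq)

lemma iter_ln_mono:
  assumes "iter_ln_pos m t" "t \<le> t'"
  shows "iter_ln_pos m t' \<and> (ln ^^ m) t \<le> (ln ^^ m) t'"
  using assms(1)
proof (induction m)
  case (Suc m)
  then have IH: "iter_ln_pos m t'" "(ln ^^ m) t \<le> (ln ^^ m) t'" and pos: "0 < (ln ^^ m) t" "0 < (ln ^^ Suc m) t"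
    by (auto simp: iter_ln_pos_Suc) (auto simp: iter_ln_pos_def)
  have le: "(ln ^^ Suc m) t \<le> (ln ^^ Suc m) t'" using IH(2) pos(1) by simp
  then have "0 < (ln ^^ Suc m) t'" using pos(2) by linarith
  then show ?case using IH le by (simp add: iter_ln_pos_Suc del: funpow.simps)
qed (use assms(2) in \<open>auto simp: iter_ln_pos_def\<close>)

lemma phi_alt: "phi m t = (if iter_ln_pos m t \<and> 0 \<le> ln t then ln t / (ln ^^ m) t else 0)"
  by (simp add: phi_def iter_ln_pos_def)

lemma phi_nonneg: "0 \<le> phi m t"
  unfolding phi_alt by (auto simp: iter_ln_pos_def less_imp_le)

lemma phi_le:
  assumes "iter_ln_pos m w" "w \<le> t" "0 \<le> ln t"
  shows "phi m t \<le> ln t / (ln ^^ m) w"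
proof -
  have "0 < (ln ^^ m) w" using assms(1) by (auto simp: iter_ln_pos_def)
  moreover have "(ln ^^ m) w \<le> (ln ^^ m) t" using iter_ln_mono[OF assms(1,2)] by blast
  ultimately show ?thesis unfolding phi_alt using assms(3) by (auto intro!: divide_left_mono mult_pos_pos)
qed

text \<open>On a real interval the analogous bound fails, since \<open>phi m\<close> has a pole
  where the iterated logarithm vanishes.\<close>

lemma phi_nat_le_ln: "\<exists>K\<ge>0. \<forall>t::nat. phi m t \<le> K * ln t"
proof (cases "\<exists>t::nat. iter_ln_pos m t")
  case True
  define t0 where "t0 = (LEAST t::nat. iter_ln_pos m t)"
  have t0: "iter_ln_pos m t0" unfolding t0_def using True by (rule LeastI_ex)
  then have pos: "0 < (ln ^^ m) (real t0)" by (auto simp: iter_ln_pos_def)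
  have "phi m t \<le> 1 / (ln ^^ m) (real t0) * ln t" for t :: nat
  proof (cases "iter_ln_pos m t")
    case True
    then have "real t0 \<le> real t" unfolding t0_def by (simp add: Least_le)
    moreover have "0 \<le> ln (real t)" by (cases "t = 0") auto
    ultimately show ?thesis using phi_le[OF t0, of t] by simp
  next
    case False
    then show ?thesis using pos by (cases "t = 0") (auto simp: phi_alt)
  qed
  then show ?thesis using pos by (intro exI[of _ "1 / (ln ^^ m) (real t0)"]) auto
next
  case False
  then show ?thesis by (intro exI[of _ 0]) (auto simp: phi_alt)
qed

context digit_system
begin

lemma h_real_Suc: "real (h (Suc n)) = real (h n) * real (q n)"
  by (simp add: h_Suc)

lemma filterlim_h: "filterlim (\<lambda>n. real (h n)) at_top sequentially"
proof (rule filterlim_at_top_mono)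
  show "filterlim (\<lambda>n. real n) at_top sequentially" by (rule filterlim_real_sequentially)
  have "n \<le> h n" for n using h_ge_pow2[of n] less_exp[of n] by linarith
  then show "\<forall>\<^sub>F n in sequentially. real n \<le> real (h n)" by simp
qed

text \<open>Each logarithm costs one stage: ln (sqrt (h (n + 1))) is at least (c / 2) h n. Weakening
  this to sqrt (h n), valid once sqrt (h n) \<ge> 2 / c, absorbs the constant and lets the bound be
  iterated.\<close>

lemma iter_ln_exp_sqrt_h:
  fixes c :: real
  assumes c: "0 < c" "\<And>n. c * h n \<le> ln (q n)"
  shows "\<forall>\<^sub>F n in sequentially. iter_ln_pos j (exp (sqrt (h (n + j)))) \<and>
    sqrt (h n) \<le> (ln ^^ j) (exp (sqrt (h (n + j))))"
proof (induction j)
  case 0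
  have "sqrt (h n) \<le> exp (sqrt (h n))" for n using exp_ge_add_one_self[of "sqrt (h n)"] by linarith
  then show ?case by (simp add: iter_ln_pos_def)
next
  case (Suc j)
  have 1: "\<forall>\<^sub>F n in sequentially. iter_ln_pos j (exp (sqrt (h (Suc n + j)))) \<and>
    sqrt (h (Suc n)) \<le> (ln ^^ j) (exp (sqrt (h (Suc n + j))))"
    using Suc by (subst eventually_sequentially_Suc)
  have 2: "\<forall>\<^sub>F n in sequentially. (2 / c)\<^sup>2 \<le> real (h n)"
    using filterlim_h unfolding filterlim_at_top by blast
  show ?case using 1 2
  proof eventually_elim
    case (elim n)
    let ?L = "(ln ^^ j) (exp (sqrt (h (Suc n + j))))"
    have hp: "1 \<le> real (h n)" using h_pos[of n] by (simp add: Suc_le_eq)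
    have qp: "2 \<le> real (q n)" using q_ge2[of n] by simp
    have "2 / c \<le> sqrt (h n)" by (rule real_le_rsqrt) (rule elim(2))
    then have "2 * sqrt (h n) \<le> c * sqrt (h n) * sqrt (h n)"
      using c(1) by (intro mult_right_mono) (auto simp: field_simps)
    also have "\<dots> = c * h n" by simp
    also have "\<dots> \<le> ln (q n)" by (rule c(2))
    also have "\<dots> \<le> ln (h (Suc n))"
      unfolding h_real_Suc using hp qp by (subst ln_le_cancel_iff) (auto intro!: mult_le_cancel_right1[THEN iffD2])
    also have "\<dots> = 2 * ln (sqrt (h (Suc n)))" using h_pos[of "Suc n"] by (simp add: ln_sqrt)
    finally have a: "sqrt (h n) \<le> ln (sqrt (h (Suc n)))" by simp
    have "ln (sqrt (h (Suc n))) \<le> ln ?L" using elim(1) h_pos[of "Suc n"] by (subst ln_le_cancel_iff) (auto simp: iter_ln_pos_def)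
    then have b: "sqrt (h n) \<le> (ln ^^ Suc j) (exp (sqrt (h (n + Suc j))))" using a by simp
    have "0 < sqrt (h n)" using hp by simp
    then have "0 < (ln ^^ Suc j) (exp (sqrt (h (n + Suc j))))" using b by (rule less_le_trans)
    then show ?case using elim(1) b by (simp add: iter_ln_pos_Suc del: funpow.simps)
  qed
qed

text \<open>With H = h (n + m), integers t below \<open>h (Suc (n + m))\<close> are split at exp
  (sqrt H). Below, \<open>phi m t\<close> is at most \<open>K * sqrt H\<close>. Above, ln t is at
  most a linear factor in n times H, while the iterated logarithm is at least sqrt (h n). After
  division by H both parts are at most (a + n) / sqrt (h n), and
  \<open>h n \<ge> 2 ^ n\<close>.\<close>

lemma summable_phi:
  fixes c C :: real
  assumes c: "0 < c" "\<And>n. c * h n \<le> ln (q n)" and C: "0 \<le> C" "\<And>n. ln (q n) \<le> (C + n) * h n"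
  shows "summable (\<lambda>n. Max ((\<lambda>t. phi m (real t)) ` {..<h (Suc n)}) / h n)"
proof -
  define B where "B n = Max ((\<lambda>t. phi m (real t)) ` {..<h (Suc n)})" for n
  have Bnn: "0 \<le> B n" for n
  proof -
    have "phi m (real 0) \<le> B n" unfolding B_def
      by (rule Max_ge, simp, rule image_eqI[of _ _ 0]) (use h_pos[of "Suc n"] in auto)
    then show ?thesis using phi_nonneg[of m "real 0"] by linarith
  qed
  obtain K where K: "0 \<le> K" "\<And>t::nat. phi m t \<le> K * ln t" using phi_nat_le_ln[of m] by blast
  \<comment> \<open>Large enough for both cases: \<open>K\<close> for small t, and 1 + C + n + m
    from ln (h (n + m + 1)) for large t.\<close>
  define a where "a = K + 1 + C + m"
  define g where "g n = (a + 1) * (real (Suc n) * (1 / sqrt 2) ^ n)" for n :: nat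
  have a: "0 \<le> a" using K(1) C(1) by (simp add: a_def)
  obtain N where N: "\<And>n. N \<le> n \<Longrightarrow> iter_ln_pos m (exp (sqrt (h (n + m)))) \<and>
    sqrt (h n) \<le> (ln ^^ m) (exp (sqrt (h (n + m))))"
    using iter_ln_exp_sqrt_h[OF c, of m] unfolding eventually_sequentially by blast
  have "summable (\<lambda>n. B (n + m) / h (n + m))"
  proof (rule summable_comparison_test')
    have "summable (\<lambda>n. real (Suc n) * (1 / sqrt 2 :: real) ^ n)"
      using geometric_deriv_sums[of "1 / sqrt 2 :: real"] by (simp add: sums_iff)
    then show "summable g" unfolding g_def by (rule summable_mult)
    fix n assume n: "N \<le> n"
    define H where "H = real (h (n + m))"
    have H1: "1 \<le> H" using h_pos[of "n + m"] by (simp add: H_def Suc_le_eq)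
    have hH: "1 \<le> real (h n)" "real (h n) \<le> H" using h_pos[of n] h_mono[of n "n + m"] by (simp_all add: H_def Suc_le_eq)
    have s1: "1 \<le> sqrt (h n)" using hH by simp
    have lnh: "ln (h (Suc (n + m))) \<le> (1 + C + (n + m)) * H"
    proof -
      have "ln (h (Suc (n + m))) = ln H + ln (q (n + m))"
        unfolding h_real_Suc H_def using h_pos q_pos by (subst ln_mult) auto
      also have "ln H \<le> H" using ln_bound[of H] H1 by simp
      also have "ln (q (n + m)) \<le> (C + (n + m)) * H" using C(2)[of "n + m"] by (simp add: H_def)
      finally show ?thesis by (simp add: algebra_simps)
    qed
    have "B (n + m) \<le> (a + n) * H / sqrt (h n)"
      unfolding B_def
    proof (rule Max.boundedI)
      fix y assume "y \<in> (\<lambda>t. phi m (real t)) ` {..<h (Suc (n + m))}"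
      then obtain t where t: "t < h (Suc (n + m))" "y = phi m (real t)" by auto
      show "y \<le> (a + n) * H / sqrt (h n)"
      proof (cases "ln t \<le> sqrt H")
        case True
        have "y \<le> K * sqrt H" using K(2)[of t] mult_left_mono[OF True K(1)] t(2) by linarith
        also have "\<dots> = K * H / sqrt H" using H1 real_div_sqrt[of H] by (simp flip: times_divide_eq_right)
        also have "\<dots> \<le> (a + n) * H / sqrt (h n)"
          using H1 hH K(1) C(1) by (intro frac_le mult_right_mono mult_nonneg_nonneg) (auto simp: a_def)
        finally show ?thesis .
      next
        case False
        have tpos: "0 < t" using False H1 by (cases "t = 0") auto
        then have "exp (sqrt H) \<le> t" using False by (subst ln_ge_iff[symmetric]) auto
        then have "y \<le> ln t / (ln ^^ m) (exp (sqrt H))"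
          unfolding t(2) using N[OF n] tpos by (intro phi_le) (auto simp: H_def)
        also have "\<dots> \<le> (1 + C + (n + m)) * H / sqrt (h n)"
        proof (rule frac_le)
          have "ln t \<le> ln (h (Suc (n + m)))" using t(1) tpos by simp
          then show "ln t \<le> (1 + C + (n + m)) * H" using lnh by linarith
          show "0 \<le> (1 + C + (n + m)) * H" using C(1) H1 by simp
          show "0 < sqrt (h n)" using s1 by linarith
          show "sqrt (h n) \<le> (ln ^^ m) (exp (sqrt H))" using N[OF n] by (simp add: H_def)
        qed
        also have "\<dots> \<le> (a + n) * H / sqrt (h n)"
          using H1 K(1) by (intro divide_right_mono mult_right_mono) (auto simp: a_def)
        finally show ?thesis .
      qed
    qed (use h_pos[of "Suc (n + m)"] in auto)
    then have "B (n + m) / H \<le> (a + n) / sqrt (h n)" using H1 by (simp add: field_simps)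
    also have "\<dots> \<le> ((a + 1) * Suc n) / sqrt (2 ^ n)"
    proof (rule frac_le)
      show "a + n \<le> (a + 1) * Suc n" using a by (simp add: algebra_simps)
      have "2 ^ n \<le> real (h n)" using h_ge_pow2[of n] by (metis of_nat_le_iff of_nat_numeral of_nat_power)
      then show "sqrt (2 ^ n) \<le> sqrt (h n)" by simp
    qed (use a in auto)
    also have "\<dots> = g n" by (simp add: g_def real_sqrt_power power_divide)
    finally show "norm (B (n + m) / h (n + m)) \<le> g n" using Bnn[of "n + m"] by (simp add: H_def)
  qed
  then show ?thesis unfolding B_def by (rule summable_iff_shift[THEN iffD1])
qed

end

context tower_system
begin

text \<open>The values of \<open>c\<close> are cut into layers between consecutive heights. Each
  layer is bounded by a maximum over integers because \<open>phi m\<close> need not be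
  monotone.\<close>

lemma nn_integral_phi_finite:
  fixes c :: "'a \<Rightarrow> int"
  assumes [measurable]: "c \<in> measurable M (count_space UNIV)"
    and prob: "\<And>n. prob {x \<in> space M. int (h n) \<le> \<bar>c x\<bar>} \<le> 1 / h n"
    and sum: "summable (\<lambda>n. Max ((\<lambda>t. phi m (real t)) ` {..<h (Suc n)}) / h n)"
  shows "(\<integral>\<^sup>+x. ennreal (phi m (real_of_int \<bar>c x\<bar>)) \<partial>M) < \<infinity>"
proof -
  define B where "B n = Max ((\<lambda>t. phi m (real t)) ` {..<h (Suc n)})" for n
  define A where "A n = {x \<in> space M. int (h n) \<le> \<bar>c x\<bar>}" for n
  have A [measurable]: "A n \<in> sets M" for n
  proof -
    have eq: "A n = c -` {i. int (h n) \<le> \<bar>i\<bar>} \<inter> space M" by (auto simp: A_def)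
    show ?thesis unfolding eq by (rule measurable_sets[OF assms(1)]) simp
  qed
  have le_B: "phi m (real_of_int \<bar>c x\<bar>) \<le> B n" if "\<bar>c x\<bar> < int (h (Suc n))" for n x
  proof -
    have "phi m (real (nat \<bar>c x\<bar>)) \<le> B n" unfolding B_def
      by (rule Max_ge, simp, rule image_eqI[of _ _ "nat \<bar>c x\<bar>"]) (use that in auto)
    then show ?thesis by simp
  qed
  have Bnn: "0 \<le> B n" for n
  proof -
    have "phi m (real 0) \<le> B n" unfolding B_def
      by (rule Max_ge, simp, rule image_eqI[of _ _ 0]) (use h_pos[of "Suc n"] in auto)
    then show ?thesis using phi_nonneg[of m "real 0"] by linarith
  qed
  have bound: "ennreal (phi m (real_of_int \<bar>c x\<bar>)) \<le> ennreal (B 0) + (\<Sum>n. ennreal (B n) * indicator (A n) x)"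
    if x: "x \<in> space M" for x
  proof (cases "\<bar>c x\<bar> < int (h 0)")
    case True
    then have "\<bar>c x\<bar> < int (h (Suc 0))" using h_mono[of 0 "Suc 0"] by simp
    then have "ennreal (phi m (real_of_int \<bar>c x\<bar>)) \<le> ennreal (B 0)" using le_B by (intro ennreal_leI)
    then show ?thesis by (rule add_increasing2[rotated]) simp
  next
    case False
    have "\<exists>n. \<bar>c x\<bar> < int (h n)"
    proof
      show "\<bar>c x\<bar> < int (h (nat \<bar>c x\<bar>))"
        using h_ge_pow2[of "nat \<bar>c x\<bar>"] less_exp[of "nat \<bar>c x\<bar>"] by linarith
    qed
    then have "\<exists>n. \<bar>c x\<bar> < int (h (Suc n)) \<and> \<not> \<bar>c x\<bar> < int (h n)"
      using False ex_least_nat_less[of "\<lambda>n. \<bar>c x\<bar> < int (h n)"] by blast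
    then obtain n where n: "\<bar>c x\<bar> < int (h (Suc n))" "int (h n) \<le> \<bar>c x\<bar>" by force
    have "ennreal (phi m (real_of_int \<bar>c x\<bar>)) \<le> ennreal (B n) * indicator (A n) x"
      using le_B[OF n(1)] n(2) x by (simp add: A_def ennreal_leI)
    also have "\<dots> \<le> (\<Sum>n. ennreal (B n) * indicator (A n) x)"
    proof -
      define F where "F = (\<lambda>n. ennreal (B n) * indicator (A n) x)"
      have "F n \<le> suminf F" using sum_le_suminf[OF summableI, of "{n}" F] by simp
      then show ?thesis by (simp add: F_def)
    qed
    finally show ?thesis by (rule add_increasing[rotated]) simp
  qed
  have "(\<integral>\<^sup>+x. ennreal (phi m (real_of_int \<bar>c x\<bar>)) \<partial>M)
      \<le> (\<integral>\<^sup>+x. ennreal (B 0) + (\<Sum>n. ennreal (B n) * indicator (A n) x) \<partial>M)"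
    by (rule nn_integral_mono) (rule bound)
  also have "\<dots> = ennreal (B 0) + (\<Sum>n. ennreal (B n) * emeasure M (A n))"
    by (simp add: nn_integral_add nn_integral_suminf nn_integral_cmult_indicator emeasure_space_1)
  finally have le: "(\<integral>\<^sup>+x. ennreal (phi m (real_of_int \<bar>c x\<bar>)) \<partial>M)
      \<le> ennreal (B 0) + (\<Sum>n. ennreal (B n) * emeasure M (A n))" .
  have "(\<Sum>n. ennreal (B n) * emeasure M (A n)) \<le> (\<Sum>n. ennreal (B n / h n))"
  proof (intro suminf_le allI summableI)
    fix n
    have "ennreal (B n) * emeasure M (A n) \<le> ennreal (B n) * ennreal (1 / h n)"
      using prob[of n] by (intro mult_left_mono) (auto simp: emeasure_eq_measure A_def ennreal_leI)
    also have "\<dots> = ennreal (B n / h n)" using Bnn[of n] by (simp add: ennreal_mult[symmetric])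
    finally show "ennreal (B n) * emeasure M (A n) \<le> ennreal (B n / h n)" .
  qed
  also have "(\<Sum>n. ennreal (B n / h n)) < \<infinity>"
  proof -
    have sumB: "summable (\<lambda>n. B n / h n)" using sum unfolding B_def .
    have "(\<Sum>n. ennreal (B n / h n)) \<noteq> top"
      by (rule ennreal_suminf_neq_top[OF sumB]) (simp add: Bnn)
    then show ?thesis by (simp add: less_top)
  qed
  finally have "ennreal (B 0) + (\<Sum>n. ennreal (B n) * emeasure M (A n)) < \<infinity>" by (simp add: ennreal_add_less_top)
  with le show ?thesis by (rule le_less_trans)
qed

lemma integrable_orbit_equivalence_id:
  fixes c C :: real
  assumes c: "0 < c" "\<And>n. c * h n \<le> ln (q n)" and C: "0 \<le> C" "\<And>n. ln (q n) \<le> (C + n) * h n"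
  shows "integrable_orbit_equivalence (phi m) M S T (\<lambda>x. x)"
  unfolding integrable_orbit_equivalence_def
proof (intro conjI exI)
  show "orbit_equivalence M S T (\<lambda>x. x)" by (rule orbit_equivalence_id)
  show "orbit_equivalence_cocycles M S T (\<lambda>x. x) cS cT" by (rule cocycles)
  note sum = summable_phi[OF c C, of m]
  show "(\<integral>\<^sup>+x. ennreal (phi m (real_of_int \<bar>cS x\<bar>)) \<partial>M) < \<infinity>"
  proof (rule nn_integral_phi_finite[OF cS_measurable _ sum])
    fix n
    \<comment> \<open>Large values of \<open>cS\<close> occur only on the top level of the odometer
      tower, and those of \<open>cT\<close> only on the tops of the T-towers; both have mass
      \<open>1 / h n\<close>.\<close>
    have "prob {x \<in> space M. int (h n) \<le> \<bar>cS x\<bar>} \<le> prob (level n (h n - 1))"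
    proof (rule finite_measure_mono_AE[OF _ level_sets])
      show "AE x in M. x \<in> {x \<in> space M. int (h n) \<le> \<bar>cS x\<bar>} \<longrightarrow> x \<in> level n (h n - 1)"
        using G_AE
      proof eventually_elim
        case (elim x)
        then show ?case using cS_props(2)[OF elim, of n] r_less[of n x] G_G0[OF elim]
          by (cases "r n x + 1 < h n") (auto simp: level_def)
      qed
    qed
    then show "prob {x \<in> space M. int (h n) \<le> \<bar>cS x\<bar>} \<le> 1 / h n" using prob_level[of "h n - 1" n] h_pos[of n] by simp
  qed
  show "(\<integral>\<^sup>+x. ennreal (phi m (real_of_int \<bar>cT x\<bar>)) \<partial>M) < \<infinity>"
  proof (rule nn_integral_phi_finite[OF cT_measurable _ sum])
    fix n
    have "prob {x \<in> space M. int (h n) \<le> \<bar>cT x\<bar>} \<le> prob {x \<in> G\<^sub>0. s n x = h n - 1}"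
    proof (rule finite_measure_mono_AE)
      show "AE x in M. x \<in> {x \<in> space M. int (h n) \<le> \<bar>cT x\<bar>} \<longrightarrow> x \<in> {x \<in> G\<^sub>0. s n x = h n - 1}"
        using G_AE
      proof eventually_elim
        case (elim x)
        then show ?case using abs_cT_less[OF elim, of n] s_less[of n x] G_G0[OF elim]
          by (cases "s n x + 1 < h n") auto
      qed
    qed measurable
    then show "prob {x \<in> space M. int (h n) \<le> \<bar>cT x\<bar>} \<le> 1 / h n" using prob_s[of "h n - 1" n] h_pos[of n] by simp
  qed
qed

end

section \<open>Upper bound for the entropy\<close>

lemma card_permutes_constrained:
  fixes C :: "'b \<Rightarrow> 'b set" and m :: real
  assumes A: "finite A" and I: "I \<subseteq> A" and C: "\<And>i. i \<in> I \<Longrightarrow> finite (C i) \<and> card (C i) \<le> m" and m: "0 \<le> m"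
  shows "card {p. p permutes A \<and> (\<forall>i\<in>I. p i \<in> C i)} \<le> m ^ card I * fact (card A - card I)"
proof -
  let ?P = "{p. p permutes A \<and> (\<forall>i\<in>I. p i \<in> C i)}"
  let ?R = "\<lambda>p. restrict p I"
  have finI: "finite I" using A I finite_subset by auto
  have finP: "finite ?P" using finite_permutations[OF A] by (rule finite_subset[rotated]) auto
  \<comment> \<open>Permutations with the same restriction to \<open>I\<close> differ from one of
    them, \<open>p0\<close>, by a permutation of \<open>A - I\<close>; the number of restrictions is
    bounded by a product over \<open>I\<close>.\<close>
  have fib: "card {p \<in> ?P. ?R p = v} \<le> fact (card A - card I)" for v
  proof (cases "{p \<in> ?P. ?R p = v} = {}")
    case False
    then obtain p0 where p0: "p0 permutes A" "?R p0 = v" by auto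
    let ?f = "\<lambda>p. inv p0 \<circ> p"
    have "inj_on ?f {p \<in> ?P. ?R p = v}"
    proof (rule inj_onI)
      fix p p' assume "inv p0 \<circ> p = inv p0 \<circ> p'"
      then have "p0 \<circ> (inv p0 \<circ> p) = p0 \<circ> (inv p0 \<circ> p')" by simp
      then show "p = p'" using permutes_inv_o(1)[OF p0(1)] by (simp add: o_assoc)
    qed
    moreover have "?f ` {p \<in> ?P. ?R p = v} \<subseteq> {p. p permutes (A - I)}"
    proof safe
      fix p assume p: "p permutes A" "v = ?R p"
      have "inv p0 \<circ> p permutes A" by (rule permutes_compose[OF p(1) permutes_inv[OF p0(1)]])
      moreover have "(inv p0 \<circ> p) i = i" if "i \<in> I" for i
      proof -
        have "p i = p0 i" using p(2) p0(2) that by (metis restrict_apply')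
        then show ?thesis using permutes_inverses(2)[OF p0(1)] by simp
      qed
      ultimately show "inv p0 \<circ> p permutes (A - I)" by (rule permutes_superset) auto
    qed
    ultimately have "card {p \<in> ?P. ?R p = v} \<le> card {p. p permutes (A - I)}"
      using finite_permutations[of "A - I"] A by (intro card_inj_on_le[of ?f]) auto
    also have "\<dots> = fact (card A - card I)"
      using A finI I by (simp add: card_permutations card_Diff_subset)
    finally show ?thesis .
  next
    case True
    then show ?thesis by (simp only: card.empty)
  qed
  have "?R ` ?P \<subseteq> Pi\<^sub>E I C" by auto
  then have "card (?R ` ?P) \<le> card (Pi\<^sub>E I C)" using finI C by (intro card_mono finite_PiE) auto
  also have "\<dots> = (\<Prod>i\<in>I. card (C i))" by (rule card_PiE[OF finI])
  finally have "real (card (?R ` ?P)) \<le> real (\<Prod>i\<in>I. card (C i))" by (rule of_nat_mono)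
  also have "\<dots> = (\<Prod>i\<in>I. real (card (C i)))" by simp
  also have "\<dots> \<le> (\<Prod>i\<in>I. m)" by (rule prod_mono) (use C in auto)
  finally have R: "real (card (?R ` ?P)) \<le> m ^ card I" by simp
  have "?P = (\<Union>v\<in>?R ` ?P. {p \<in> ?P. ?R p = v})" by auto
  then have "card ?P \<le> (\<Sum>v\<in>?R ` ?P. card {p \<in> ?P. ?R p = v})"
    using card_UN_le[of "?R ` ?P" "\<lambda>v. {p \<in> ?P. ?R p = v}"] finP by simp
  also have "\<dots> \<le> (\<Sum>v\<in>?R ` ?P. fact (card A - card I))" by (rule sum_mono[OF fib])
  finally have "card ?P \<le> card (?R ` ?P) * fact (card A - card I)" by simp
  then have "real (card ?P) \<le> real (card (?R ` ?P) * fact (card A - card I))" by (rule of_nat_mono)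
  then have "real (card ?P) \<le> real (card (?R ` ?P)) * fact (card A - card I)"
    unfolding of_nat_mult of_nat_fact .
  also have "real (card (?R ` ?P)) * fact (card A - card I) \<le> m ^ card I * fact (card A - card I)" using R by (intro mult_right_mono) auto
  finally show ?thesis .
qed

lemma power_div_fact_le_exp:
  fixes x :: real assumes "0 \<le> x" shows "x ^ n / fact n \<le> exp x"
proof -
  have "(\<Sum>i\<in>{n}. x ^ i /\<^sub>R fact i) \<le> (\<Sum>i. x ^ i /\<^sub>R fact i)"
    by (rule sum_le_suminf[OF summable_exp_generic]) (use assms in auto)
  then show ?thesis by (simp add: exp_def divide_inverse mult.commute)
qed

text \<open>The elementary half of Stirling's formula, from n ^ n / n! \<le> exp n.\<close>

lemma ln_fact_ge: "n * ln n - n \<le> ln (fact n :: real)"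
proof (cases "n = 0")
  case False
  then have n: "0 < real n" by simp
  have "real n ^ n \<le> exp n * fact n" using power_div_fact_le_exp[of n n] by (simp add: field_simps)
  then have "ln (real n ^ n) \<le> ln (exp n * fact n)" using n by (subst ln_le_cancel_iff) auto
  then show ?thesis using n by (simp add: ln_mult ln_realpow)
qed simp

text \<open>The quotient n! / (n - k)! has k factors, each at least n - k.\<close>

lemma fact_diff_le:
  assumes "k \<le> n"
  shows "fact (n - k) * (real (n - k)) ^ k \<le> fact n"
  using assms
proof (induction k)
  case (Suc k)
  have "fact (n - Suc k) * (real (n - Suc k)) ^ Suc k
      = fact (n - Suc k) * real (n - Suc k) * (real (n - Suc k)) ^ k" by simp
  also have "\<dots> \<le> fact (n - Suc k) * real (n - k) * (real (n - k)) ^ k"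
    by (intro mult_mono power_mono) auto
  also have "fact (n - Suc k) * real (n - k) = fact (n - k)"
    using Suc.prems by (metis Suc_diff_Suc Suc_le_lessD fact_Suc mult.commute of_nat_fact of_nat_mult)
  finally show ?case using Suc by simp
qed simp

section \<open>Itineraries along towers and the upper bound\<close>

context tower_system
begin

sublocale T: measure_preserving_map M T
  by unfold_locales (use T_in_Aut in \<open>simp_all add: Aut_def\<close>)

lemma simple_function_r: "simple_function M (r n)"
  unfolding simple_function_def
proof (intro conjI ballI)
  show "finite (r n ` space M)"
    by (rule finite_subset[of _ "{..<h n}"]) (use r_less in auto)
  fix v show "r n -` {v} \<inter> space M \<in> sets M" by (rule measurable_sets[OF r_measurable]) simp
qed

lemma r_mod_le:
  assumes "x \<in> G\<^sub>0" "n \<le> m"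
  shows "r m x mod h n = r n x"
  using assms(2)
proof (induction m rule: dec_induct)
  case (step m)
  then show ?case using r_mod[OF assms(1), of m] mod_mod_cancel[OF h_dvd[OF step(1)], of "r (Suc m) x"] by simp
qed (use r_less in simp)

text \<open>The index is constant while the orbit passes through one copy of a tower. Time
  \<open>l * h m\<close> lies in copy number l for every initial height, so these fixed times sample
  all copies; it may precede or follow time i.\<close>

lemma digit_funpow_T:
  assumes x: "x \<in> G"
  shows "digit m ((T ^^ i) x) = digit m ((T ^^ ((s m x + i) div h m * h m)) x)"
proof -
  define l where "l = (s m x + i) div h m"
  have e: "s m x + i = l * h m + (s m x + i) mod h m" unfolding l_def by (simp add: mult.commute)
  have lt: "(s m x + i) mod h m < h m" using h_pos by simp
  have "digit m ((T ^^ i) x) = digit m ((T ^^ (l * h m)) x)"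
  proof (cases "l * h m \<le> i")
    case True
    define y where "y = (T ^^ (l * h m)) x"
    have y: "y \<in> G" unfolding y_def by (rule funpow_T_in_G[OF x])
    have sy: "s m y = s m x" unfolding y_def s_funpow_T[OF x] using s_less by simp
    have Ty: "(T ^^ i) x = (T ^^ (i - l * h m)) y"
      unfolding y_def using True by (metis comp_apply funpow_add le_add_diff_inverse2)
    have "s m y + (i - l * h m) < h m" using e lt True sy by linarith
    from funpow_T_step[OF y this] show ?thesis unfolding Ty y_def[symmetric] by blast
  next
    case False
    define y where "y = (T ^^ i) x"
    have y: "y \<in> G" unfolding y_def by (rule funpow_T_in_G[OF x])
    have sy: "s m y = (s m x + i) mod h m" unfolding y_def by (rule s_funpow_T[OF x])
    have Ty: "(T ^^ (l * h m)) x = (T ^^ (l * h m - i)) y"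
      unfolding y_def using False by (metis comp_apply funpow_add le_add_diff_inverse2 nat_le_linear)
    have "s m y + (l * h m - i) < h m" using e False sy s_less[of m x] by linarith
    from funpow_T_step[OF y this] show ?thesis unfolding Ty y_def[symmetric] by metis
  qed
  then show ?thesis by (simp add: l_def)
qed

lemma r_funpow_T:
  assumes x: "x \<in> G" and "n \<le> Suc m"
  shows "r n ((T ^^ i) x) =
    point m ((s m x + i) mod h m) (digit m ((T ^^ ((s m x + i) div h m * h m)) x)) mod h n"
proof -
  have y: "(T ^^ i) x \<in> G\<^sub>0" by (rule G_G0[OF funpow_T_in_G[OF x]])
  have "r n ((T ^^ i) x) = r (Suc m) ((T ^^ i) x) mod h n" using r_mod_le[OF y assms(2)] by simp
  also have "r (Suc m) ((T ^^ i) x) = point m (s m ((T ^^ i) x)) (digit m ((T ^^ i) x))"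
    by (rule point_s_digit[OF y, symmetric])
  also have "s m ((T ^^ i) x) = (s m x + i) mod h m" by (rule s_funpow_T[OF x])
  also note digit_funpow_T[OF x, of m i]
  finally show ?thesis .
qed

text \<open>A stretch of \<open>N\<close> points meets at most \<open>N div h m + 2\<close> copies of towers of height \<open>h m\<close>.\<close>

lemma rv_entropy_itinerary_r_le:
  assumes "n \<le> Suc m"
  shows "rv_entropy M (itinerary T (r n) N) \<le> ln (h m) + (N div h m + 2) * ln (q m)"
proof -
  define L where "L = N div h m + 2"
  \<comment> \<open>\<open>F\<close> decodes the word from the initial height and the indices of the
    \<open>L\<close> copies met; counting such data in \<open>C\<close> bounds the number of
    words.\<close>
  define F where "F = (\<lambda>(j, ds). map (\<lambda>i. point m ((j + i) mod h m) (ds ! ((j + i) div h m)) mod h n) [0..<N])"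
  define C where "C = {..<h m} \<times> {ds. set ds \<subseteq> {..<q m} \<and> length ds = L}"
  have finC: "finite C" unfolding C_def by (intro finite_cartesian_product finite_lists_length_eq) auto
  have cardC: "card C = h m * q m ^ L"
    unfolding C_def by (simp add: card_cartesian_product card_lists_length_eq)
  have "AE x in M. itinerary T (r n) N x \<in> F ` C"
    using G_AE
  proof eventually_elim
    case (elim x)
    let ?ds = "map (\<lambda>l. digit m ((T ^^ (l * h m)) x)) [0..<L]"
    have "(s m x + i) div h m < L" if "i < N" for i
    proof -
      have "N = h m * (N div h m) + N mod h m" by simp
      moreover have "N mod h m < h m" using h_pos by simp
      moreover have "h m * L = h m * (N div h m) + 2 * h m" by (simp add: L_def algebra_simps)
      ultimately have "s m x + i < h m * L" using that s_less[of m x] by linarith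
      then show ?thesis by (simp add: less_mult_imp_div_less mult.commute)
    qed
    then have "itinerary T (r n) N x = F (s m x, ?ds)"
      unfolding itinerary_def F_def using r_funpow_T[OF elim assms] by simp
    moreover have "(s m x, ?ds) \<in> C"
      unfolding C_def using s_less digit_less[OF G_G0[OF funpow_T_in_G[OF elim]]] by auto
    ultimately show ?case by blast
  qed
  then have "rv_entropy M (itinerary T (r n) N) \<le> ln (card (F ` C))"
    by (intro rv_entropy_le_ln_card T.simple_function_itinerary simple_function_r finite_imageI finC)
  also have "\<dots> \<le> ln (card C)"
  proof (subst ln_le_cancel_iff)
    show "real (card (F ` C)) \<le> real (card C)" using card_image_le[OF finC] by simp
    have "card C > 0" unfolding cardC using h_pos q_pos by simp
    then have "F ` C \<noteq> {}" using finC by auto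
    then show "0 < real (card (F ` C))" "0 < real (card C)" using finC \<open>card C > 0\<close> by (auto simp: card_gt_0_iff)
  qed
  also have "\<dots> = ln (h m) + L * ln (q m)"
    unfolding cardC using h_pos[of m] q_pos[of m] by (simp add: ln_mult ln_realpow)
  finally show ?thesis by (simp add: L_def add.commute)
qed

lemma process_entropy_r_le:
  assumes "n \<le> Suc m"
  shows "process_entropy M T (r n) \<le> ln (q m) / h m"
proof (rule LIMSEQ_le[OF T.process_entropy_tendsto[OF simple_function_r]])
  have "(\<lambda>N. (ln (h m) + 2 * ln (q m)) * (1 / real N) + ln (q m) / h m) \<longlonglongrightarrow> (ln (h m) + 2 * ln (q m)) * 0 + ln (q m) / h m"
    by (intro tendsto_intros lim_1_over_n)
  then show "(\<lambda>N. (ln (h m) + 2 * ln (q m)) * (1 / real N) + ln (q m) / h m) \<longlonglongrightarrow> ln (q m) / h m" by simp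
  show "\<exists>N0. \<forall>N\<ge>N0. rv_entropy M (itinerary T (r n) N) / N \<le> (ln (h m) + 2 * ln (q m)) * (1 / real N) + ln (q m) / h m"
  proof (intro exI allI impI)
    fix N :: nat assume N: "1 \<le> N"
    have lq: "0 \<le> ln (real (q m))" using q_ge2[of m] by simp
    have "real (N div h m) \<le> N / h m" by (rule of_nat_div_le_of_nat)
    then have "(real (N div h m) + 2) * ln (q m) \<le> (N / h m + 2) * ln (q m)" using lq by (intro mult_right_mono) auto
    moreover have "rv_entropy M (itinerary T (r n) N) \<le> ln (h m) + (real (N div h m) + 2) * ln (q m)"
      using rv_entropy_itinerary_r_le[OF assms, of N] by (simp add: add.commute)
    ultimately have "rv_entropy M (itinerary T (r n) N) \<le> ln (h m) + (N / h m + 2) * ln (q m)" by linarith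
    then have "rv_entropy M (itinerary T (r n) N) / N \<le> (ln (h m) + (N / h m + 2) * ln (q m)) / N"
      by (rule divide_right_mono) simp
    also have "\<dots> = (ln (h m) + 2 * ln (q m)) * (1 / real N) + ln (q m) / h m"
      using N h_pos[of m] by (simp add: field_simps)
    finally show "rv_entropy M (itinerary T (r n) N) / N \<le> (ln (h m) + 2 * ln (q m)) * (1 / real N) + ln (q m) / h m" .
  qed
qed

end

section \<open>Lower bound for the entropy\<close>

text \<open>The permutations attached to the towers of the next level exhaust all permutations
  almost uniformly, so that consecutive towers are almost independent.\<close>

locale uniform_tower_system = tower_system +
  assumes card_perm: "p permutes {..<q n} \<Longrightarrow> card {b \<in> {..<q (Suc n)}. perm n b = p} \<le> 2 * real (q (Suc n)) / fact (q n)"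
begin

lemma card_perm_set:
  assumes P: "finite P" "\<And>p. p \<in> P \<Longrightarrow> p permutes {..<q n}"
  shows "card {b \<in> {..<q (Suc n)}. perm n b \<in> P} \<le> 2 * q (Suc n) / fact (q n) * card P"
proof -
  have "{b \<in> {..<q (Suc n)}. perm n b \<in> P} = (\<Union>p\<in>P. {b \<in> {..<q (Suc n)}. perm n b = p})" by auto
  then have "card {b \<in> {..<q (Suc n)}. perm n b \<in> P} \<le> (\<Sum>p\<in>P. card {b \<in> {..<q (Suc n)}. perm n b = p})"
    using card_UN_le[OF P(1), of "\<lambda>p. {b \<in> {..<q (Suc n)}. perm n b = p}"] by simp
  then have "real (card {b \<in> {..<q (Suc n)}. perm n b \<in> P}) \<le> real (\<Sum>p\<in>P. card {b \<in> {..<q (Suc n)}. perm n b = p})"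
    by (rule of_nat_mono)
  also have "\<dots> = (\<Sum>p\<in>P. real (card {b \<in> {..<q (Suc n)}. perm n b = p}))" by (rule of_nat_sum)
  also have "\<dots> \<le> (\<Sum>p\<in>P. 2 * q (Suc n) / fact (q n))" by (rule sum_mono) (use card_perm[OF P(2)] in simp)
  finally show ?thesis by (simp add: mult.commute)
qed

text \<open>The itinerary of \<open>r (n + 1)\<close> along the tower \<open>a\<close> of height \<open>h l\<close>.\<close>

definition tower_word :: "nat \<Rightarrow> nat \<Rightarrow> nat \<Rightarrow> nat list" where
  "tower_word n l a = map (\<lambda>j. point l j a mod h (Suc n)) [0..<h l]"

definition word_class :: "nat \<Rightarrow> nat \<Rightarrow> nat \<Rightarrow> nat set" where
  "word_class n l a = {b \<in> {..<q l}. tower_word n l b = tower_word n l a}"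

text \<open>Modulo \<open>h (Suc n)\<close> the index \<open>b\<close> drops out, because
  \<open>h (Suc n)\<close> divides \<open>h (Suc l)\<close>. The word of a tower is thus the
  concatenation of the words of its subtowers in the order \<open>perm l b\<close>.\<close>

lemma point_Suc_mod:
  assumes "n \<le> l" "j < h l"
  shows "point (Suc l) (i * h l + j) b mod h (Suc n) = point l j (perm l b i) mod h (Suc n)"
proof -
  have "(i * h l + j) mod h l = j" "(i * h l + j) div h l = i" using assms(2) by simp_all
  moreover have "h (Suc n) dvd h (Suc l) * b" using h_dvd[of "Suc n" "Suc l"] assms(1) by simp
  then obtain c where "h (Suc l) * b = h (Suc n) * c" by (rule dvdE)
  ultimately show ?thesis by simp
qed

text \<open>Prescribing the words of k consecutive subtowers confines each of k values of the
  permutation to a class of size at most \<open>m\<close>. The permutations are counted by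
  \<open>card_permutes_constrained\<close>, and each is used by few towers.\<close>

lemma card_window:
  fixes m :: real
  assumes "n \<le> l" and i: "i + k \<le> q l"
    and cls: "\<And>a. card (word_class n l a) \<le> m"
  shows "card {b \<in> {..<q (Suc l)}. \<forall>t\<in>{i..<i + k}. tower_word n l (perm l b t) = tower_word n l (v t)}
    \<le> 2 * q (Suc l) / fact (q l) * (m ^ k * fact (q l - k))"
proof -
  let ?P = "{p. p permutes {..<q l} \<and> (\<forall>t\<in>{i..<i + k}. p t \<in> word_class n l (v t))}"
  have m: "0 \<le> m" using cls[of 0] of_nat_0_le_iff[of "card (word_class n l 0)"] by linarith
  have fin: "finite ?P" by (rule finite_subset[OF _ finite_permutations[of "{..<q l}"]]) auto
  have "real (card ?P) \<le> m ^ card {i..<i + k} * fact (card {..<q l} - card {i..<i + k})"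
    by (rule card_permutes_constrained) (use i cls m in \<open>auto simp: word_class_def\<close>)
  then have P: "real (card ?P) \<le> m ^ k * fact (q l - k)" by simp
  have "{b \<in> {..<q (Suc l)}. \<forall>t\<in>{i..<i + k}. tower_word n l (perm l b t) = tower_word n l (v t)}
      \<subseteq> {b \<in> {..<q (Suc l)}. perm l b \<in> ?P}"
    using perm perm_less i unfolding word_class_def by auto
  then have "real (card {b \<in> {..<q (Suc l)}. \<forall>t\<in>{i..<i + k}. tower_word n l (perm l b t) = tower_word n l (v t)})
      \<le> real (card {b \<in> {..<q (Suc l)}. perm l b \<in> ?P})"
    by (intro of_nat_mono card_mono) auto
  also have "\<dots> \<le> 2 * q (Suc l) / fact (q l) * card ?P" by (rule card_perm_set[OF fin]) auto
  also have "\<dots> \<le> 2 * q (Suc l) / fact (q l) * (m ^ k * fact (q l - k))"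
    by (rule mult_left_mono[OF P]) simp
  finally show ?thesis .
qed

text \<open>Normalised so that \<open>q n * exp (- (rate n * h n) - 4) = 1\<close>, which matches
  the one-element classes at stage n.\<close>

definition rate :: "nat \<Rightarrow> real" where "rate n = ln (q n) / h n - 4 / h n"

text \<open>The term \<open>-4\<close> absorbs the factor \<open>2\<close> and the error in Stirling's formula in the induction.\<close>

lemma card_word_class:
  assumes "n \<le> l"
  shows "card (word_class n l a) \<le> q l * exp (- (rate n * h l) - 4)"
  using assms
proof (induction l arbitrary: a rule: dec_induct)
  case base
  have hn: "0 < real (h n)" and qn: "0 < real (q n)" using h_pos q_pos by simp_all
  \<comment> \<open>The first letter already determines the index: the starting level is below
    \<open>h (Suc n)\<close>, so it equals its residue, and its quotient by \<open>h n\<close> is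
    the index.\<close>
  have "\<forall>b\<in>word_class n n a. \<forall>c\<in>word_class n n a. b = c"
  proof (intro ballI)
    fix b c assume "b \<in> word_class n n a" "c \<in> word_class n n a"
    then have bc: "tower_word n n b = tower_word n n c" "b < q n" "c < q n" by (auto simp: word_class_def)
    have "tower_word n n b ! 0 = tower_word n n c ! 0" using bc(1) by simp
    then have "point n 0 b mod h (Suc n) = point n 0 c mod h (Suc n)"
      using h_pos[of n] unfolding tower_word_def by simp
    then have "point n 0 b = point n 0 c"
      using point_less[OF h_pos bc(2)] point_less[OF h_pos bc(3)] by simp
    then have "point n 0 b div h n = point n 0 c div h n" by simp
    then show "b = c" using point_div[OF h_pos] by simp
  qed
  moreover have fin: "finite (word_class n n a)" by (auto simp: word_class_def)
  ultimately have "card (word_class n n a) \<le> 1" using card_le_Suc0_iff_eq[OF fin] by simp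
  moreover have "real (q n) * exp (- (rate n * h n) - 4) = 1"
    using hn qn by (simp add: rate_def field_simps exp_minus)
  ultimately show ?case by simp
next
  case (step l)
  let ?e = "\<lambda>l. real (q l) * exp (- (rate n * h l) - 4)"
  have hl: "0 < real (h l)" and ql: "2 \<le> real (q l)" using h_pos q_ge2[of l] by simp_all
  have "word_class n (Suc l) a \<subseteq> {b \<in> {..<q (Suc l)}. \<forall>t\<in>{0..<0 + q l}.
      tower_word n l (perm l b t) = tower_word n l (perm l a t)}"
  proof safe
    fix b t assume b: "b \<in> word_class n (Suc l) a" and t: "t \<in> {0..<0 + q l}"
    have "point l j (perm l b t) mod h (Suc n) = point l j (perm l a t) mod h (Suc n)" if "j < h l" for j
    proof -
      have "t * h l + j < h (Suc l)" using add_h_mult_less[OF that, of t] t by (simp add: mult.commute add.commute)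
      then have "point (Suc l) (t * h l + j) b mod h (Suc n) = point (Suc l) (t * h l + j) a mod h (Suc n)"
        using b unfolding word_class_def tower_word_def by (simp add: map_eq_conv del: point.simps)
      then show ?thesis using point_Suc_mod[OF step(1) that] by (simp del: point.simps)
    qed
    then show "tower_word n l (perm l b t) = tower_word n l (perm l a t)" unfolding tower_word_def by simp
  qed (auto simp: word_class_def)
  then have "real (card (word_class n (Suc l) a)) \<le> real (card {b \<in> {..<q (Suc l)}. \<forall>t\<in>{0..<0 + q l}.
      tower_word n l (perm l b t) = tower_word n l (perm l a t)})"
    by (intro of_nat_mono card_mono) auto
  also have "\<dots> \<le> 2 * q (Suc l) / fact (q l) * (?e l ^ q l * fact (q l - q l))"
    by (rule card_window[OF step(1) _ step.IH]) simp
  also have "?e l ^ q l = exp (q l * (ln (q l) - rate n * h l - 4))"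
  proof -
    have "?e l = exp (ln (q l) + (- (rate n * h l) - 4))" using ql by (simp only: exp_add) simp
    then have "?e l = exp (ln (q l) - rate n * h l - 4)" by (simp add: algebra_simps)
    then show ?thesis by (simp only: exp_of_nat_mult)
  qed
  also have "2 * q (Suc l) / fact (q l) * (exp (q l * (ln (q l) - rate n * h l - 4)) * fact (q l - q l))
      = exp (ln 2 + ln (q (Suc l)) - ln (fact (q l)) + q l * (ln (q l) - rate n * h l - 4))"
    using q_pos[of "Suc l"] by (simp only: exp_add[of "ln 2 + ln (q (Suc l)) - ln (fact (q l))"] exp_diff exp_add) simp
  also have "\<dots> \<le> exp (ln (q (Suc l)) - rate n * h (Suc l) - 4)"
  proof (subst exp_le_cancel_iff)
    \<comment> \<open>The leading terms q ln q cancel. What remains, ln 2 + q - 4 q with q =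
      \<open>q l\<close>, is at most -4 since q is at least 2.\<close>
    have "q l * ln (q l) - q l \<le> ln (fact (q l) :: real)" by (rule ln_fact_ge)
    moreover have "ln 2 \<le> (1 :: real)" using ln_2_less_1 by simp
    moreover have "q l * (ln (q l) - rate n * h l - 4) = q l * ln (q l) - rate n * h (Suc l) - 4 * q l"
      by (simp add: h_Suc algebra_simps)
    ultimately show "ln 2 + ln (q (Suc l)) - ln (fact (q l)) + q l * (ln (q l) - rate n * h l - 4)
      \<le> ln (q (Suc l)) - rate n * h (Suc l) - 4" using ql by linarith
  qed
  also have "ln (q (Suc l)) - rate n * h (Suc l) - 4 = ln (q (Suc l)) + (- (rate n * h (Suc l)) - 4)" by simp
  also have "exp \<dots> = ?e (Suc l)" using q_pos[of "Suc l"] by (simp only: exp_add) simp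
  finally show ?case .
qed

text \<open>A window of \<open>k + 1\<close> subtower heights inside one tower contains k complete
  subtowers. For each starting height j, the word prescribes theirs, which leaves few indices b;
  each pair (j, b) has mass \<open>1 / h (Suc (Suc l))\<close>.\<close>

lemma prob_itinerary_le:
  assumes nl: "n \<le> l" and k: "2 * k \<le> q l" and N: "N = (k + 1) * h l"
  shows "prob (itinerary T (r (Suc n)) N -` {w} \<inter> {x \<in> G. s (Suc l) x + N \<le> h (Suc l)})
    \<le> 2 * exp (- (k * (rate n * h l)))"
proof -
  let ?h = "h (Suc l)" and ?q = "q (Suc l)"
  define B where "B j = {b \<in> {..<?q}. map (\<lambda>i. point (Suc l) (j + i) b mod h (Suc n)) [0..<N] = w}" for j
  define m where "m = q l * exp (- (rate n * h l) - 4)"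
  define Pm where "Pm = 2 / fact (q l) * (m ^ k * fact (q l - k))"
  have ql: "2 \<le> real (q l)" using q_ge2[of l] by simp
  have mpos: "0 < m" using ql by (simp add: m_def)
  have Pm0: "0 \<le> Pm" unfolding Pm_def using mpos by simp
  have cardB: "card (B j) \<le> ?q * Pm" if j: "j + N \<le> ?h" for j
  proof (cases "B j = {}")
    case False
    then obtain b0 where b0: "b0 \<in> B j" by blast
    \<comment> \<open>The first subtower starting strictly after position j; the k complete ones
      begin here and end by \<open>j + N\<close>.\<close>
    define i0 where "i0 = j div h l + 1"
    have jeq: "j = h l * (j div h l) + j mod h l" and jm: "j mod h l < h l" using h_pos by simp_all
    have i0h: "i0 * h l = h l * (j div h l) + h l" by (simp add: i0_def algebra_simps)
    have i0k: "(i0 + k) * h l \<le> j + N" using jeq i0h unfolding N by (simp add: algebra_simps)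
    then have "(i0 + k) * h l \<le> h (Suc l)" using j by (rule order_trans)
    then have "(i0 + k) * h l \<le> q l * h l" unfolding h_Suc mult.commute[of "h l"] .
    then have ik: "i0 + k \<le> q l" using h_pos[of l] unfolding mult_le_cancel2 by blast
    have "B j \<subseteq> {b \<in> {..<?q}. \<forall>t\<in>{i0..<i0 + k}. tower_word n l (perm l b t) = tower_word n l (perm l b0 t)}"
    proof safe
      fix b t assume b: "b \<in> B j" and t: "t \<in> {i0..<i0 + k}"
      have "point l c (perm l b t) mod h (Suc n) = point l c (perm l b0 t) mod h (Suc n)" if c: "c < h l" for c
      proof -
        have "i0 * h l \<le> t * h l" "(t + 1) * h l \<le> (i0 + k) * h l" using t by (intro mult_right_mono; simp)+
        moreover have "(t + 1) * h l = t * h l + h l" by simp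
        ultimately have 1: "j \<le> t * h l + c" "t * h l + c - j < N"
          using jeq jm i0h i0k c h_pos[of l] by linarith+
        define i where "i = t * h l + c - j"
        have i: "i < N" "j + i = t * h l + c" using 1 by (simp_all add: i_def)
        have "map (\<lambda>i. point (Suc l) (j + i) b mod h (Suc n)) [0..<N] ! i
            = map (\<lambda>i. point (Suc l) (j + i) b0 mod h (Suc n)) [0..<N] ! i"
          using b b0 unfolding B_def by simp
        then have "point (Suc l) (t * h l + c) b mod h (Suc n) = point (Suc l) (t * h l + c) b0 mod h (Suc n)"
          using i by (simp del: point.simps)
        then show ?thesis using point_Suc_mod[OF nl c] by (simp del: point.simps)
      qed
      then show "tower_word n l (perm l b t) = tower_word n l (perm l b0 t)" unfolding tower_word_def by simp
    qed (auto simp: B_def)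
    then have "real (card (B j)) \<le> real (card {b \<in> {..<?q}. \<forall>t\<in>{i0..<i0 + k}. tower_word n l (perm l b t) = tower_word n l (perm l b0 t)})"
      by (intro of_nat_mono card_mono) auto
    also have "\<dots> \<le> 2 * ?q / fact (q l) * (m ^ k * fact (q l - k))"
      by (rule card_window[OF nl ik]) (use card_word_class[OF nl] in \<open>simp add: m_def\<close>)
    finally show ?thesis by (simp add: Pm_def mult_ac)
  qed (use Pm0 in simp)
  let ?J = "{j. j + N \<le> ?h}"
  have finJ: "finite ?J" by (rule finite_subset[of _ "{..?h}"]) auto
  have N0: "0 < N" using N h_pos by simp
  have "prob (itinerary T (r (Suc n)) N -` {w} \<inter> {x \<in> G. s (Suc l) x + N \<le> ?h})
      \<le> prob (\<Union>j\<in>?J. \<Union>b\<in>B j. {x \<in> G\<^sub>0. s (Suc l) x = j \<and> digit (Suc l) x = b})"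
  proof (rule finite_measure_mono)
    show "itinerary T (r (Suc n)) N -` {w} \<inter> {x \<in> G. s (Suc l) x + N \<le> ?h}
      \<subseteq> (\<Union>j\<in>?J. \<Union>b\<in>B j. {x \<in> G\<^sub>0. s (Suc l) x = j \<and> digit (Suc l) x = b})"
    proof
      fix x assume "x \<in> itinerary T (r (Suc n)) N -` {w} \<inter> {x \<in> G. s (Suc l) x + N \<le> ?h}"
      then have x: "x \<in> G" "s (Suc l) x + N \<le> ?h" and w: "itinerary T (r (Suc n)) N x = w" by auto
      have "r (Suc n) ((T ^^ i) x) = point (Suc l) (s (Suc l) x + i) (digit (Suc l) x) mod h (Suc n)" if "i < N" for i
      proof -
        have "s (Suc l) x + i < ?h" using x(2) that by simp
        from funpow_T_step[OF x(1) this] have "r (Suc (Suc l)) ((T ^^ i) x) = point (Suc l) (s (Suc l) x + i) (digit (Suc l) x)"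
          by (rule conjunct1)
        then show ?thesis using r_mod_le[OF G_G0[OF funpow_T_in_G[OF x(1), of i]], of "Suc n" "Suc (Suc l)"] nl
          by (simp del: point.simps)
      qed
      then have "digit (Suc l) x \<in> B (s (Suc l) x)"
        using w digit_less[OF G_G0[OF x(1)]] unfolding B_def itinerary_def by (auto simp del: point.simps)
      then show "x \<in> (\<Union>j\<in>?J. \<Union>b\<in>B j. {x \<in> G\<^sub>0. s (Suc l) x = j \<and> digit (Suc l) x = b})"
        using x G_G0 by auto
    qed
    show "(\<Union>j\<in>?J. \<Union>b\<in>B j. {x \<in> G\<^sub>0. s (Suc l) x = j \<and> digit (Suc l) x = b}) \<in> events"
      using finJ by (intro sets.finite_UN) (auto simp: B_def)
  qed
  also have "\<dots> \<le> (\<Sum>j\<in>?J. prob (\<Union>b\<in>B j. {x \<in> G\<^sub>0. s (Suc l) x = j \<and> digit (Suc l) x = b}))"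
    using finJ by (intro finite_measure_subadditive_finite) (auto simp: B_def intro!: sets.finite_UN)
  also have "\<dots> \<le> (\<Sum>j\<in>?J. Pm / ?h)"
  proof (rule sum_mono)
    fix j assume "j \<in> ?J"
    then have j: "j + N \<le> ?h" by simp
    have jh: "j < ?h" using j N0 by simp
    have "prob (\<Union>b\<in>B j. {x \<in> G\<^sub>0. s (Suc l) x = j \<and> digit (Suc l) x = b})
        \<le> (\<Sum>b\<in>B j. prob {x \<in> G\<^sub>0. s (Suc l) x = j \<and> digit (Suc l) x = b})"
      by (intro finite_measure_subadditive_finite) (auto simp: B_def)
    also have "\<dots> = (\<Sum>b\<in>B j. 1 / h (Suc (Suc l)))"
      by (intro sum.cong refl prob_s_digit[OF jh]) (auto simp: B_def)
    also have "\<dots> = card (B j) / (?h * ?q)" by (simp add: h_Suc[of "Suc l"])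
    also have "\<dots> \<le> (?q * Pm) / (?h * ?q)" by (rule divide_right_mono[OF cardB[OF j]]) simp
    also have "\<dots> = Pm / ?h" using q_pos[of "Suc l"] by simp
    finally show "prob (\<Union>b\<in>B j. {x \<in> G\<^sub>0. s (Suc l) x = j \<and> digit (Suc l) x = b}) \<le> Pm / ?h" .
  qed
  also have "\<dots> \<le> Pm"
  proof -
    have "?J \<subseteq> {..<?h}" using N0 by auto
    then have "card ?J \<le> ?h" using card_mono[of "{..<?h}" ?J] by simp
    then have "card ?J * Pm \<le> ?h * Pm" using Pm0 by (intro mult_right_mono) auto
    then show ?thesis using h_pos[of "Suc l"] by (simp add: field_simps)
  qed
  also have "Pm \<le> 2 * exp (- (k * (rate n * h l)))"
  proof -
    \<comment> \<open>With \<open>2 * k \<le> q l\<close>, the quotient q! / (q - k)! is at least (q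
      / 2) ^ k. The resulting 2 ^ k is absorbed by the k factors exp (-4) in
      \<open>m\<close>.\<close>
    have kq: "k \<le> q l" and half: "real (q l) / 2 \<le> real (q l - k)" using k by (auto simp: of_nat_diff)
    have "fact (q l - k) * (real (q l) / 2) ^ k \<le> fact (q l - k) * real (q l - k) ^ k"
      using half by (intro mult_left_mono power_mono) auto
    also have "\<dots> \<le> fact (q l)" by (rule fact_diff_le[OF kq])
    finally have "fact (q l - k) / fact (q l) \<le> 1 / (real (q l) / 2) ^ k"
      using ql by (simp add: field_simps)
    then have "2 * m ^ k * (fact (q l - k) / fact (q l)) \<le> 2 * m ^ k * (1 / (real (q l) / 2) ^ k)"
      using mpos by (intro mult_left_mono) auto
    also have "\<dots> = 2 * (2 * exp (- (rate n * h l) - 4)) ^ k"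
      using ql by (simp add: m_def power_divide power_mult_distrib)
    also have "\<dots> \<le> 2 * (exp (- (rate n * h l))) ^ k"
    proof (intro mult_left_mono power_mono)
      have "2 \<le> exp (4 :: real)" using exp_ge_add_one_self[of "4 :: real"] by linarith
      then show "2 * exp (- (rate n * h l) - 4) \<le> exp (- (rate n * h l))"
        by (simp add: exp_diff field_simps)
    qed auto
    also have "\<dots> = 2 * exp (- (k * (rate n * h l)))" by (simp add: exp_of_nat_mult[symmetric])
    finally show ?thesis by (simp add: Pm_def mult_ac)
  qed
  finally show ?thesis .
qed

lemma prob_window_ge:
  assumes N: "N = (k + 1) * h l"
  shows "1 - real (k + 1) / real (q l) \<le> prob {x \<in> G. s (Suc l) x + N \<le> h (Suc l)}"
proof -
  have "prob {x \<in> G. s (Suc l) x + N \<le> h (Suc l)} = prob {x \<in> G\<^sub>0. s (Suc l) x + N \<le> h (Suc l)}"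
  proof (rule finite_measure_eq_AE)
    show "AE x in M. (x \<in> {x \<in> G. s (Suc l) x + N \<le> h (Suc l)}) = (x \<in> {x \<in> G\<^sub>0. s (Suc l) x + N \<le> h (Suc l)})"
      using G_AE by eventually_elim (auto dest: G_G0)
  qed measurable
  also have "{x \<in> G\<^sub>0. s (Suc l) x + N \<le> h (Suc l)} = (\<Union>j<h (Suc l) + 1 - N. {x \<in> G\<^sub>0. s (Suc l) x = j})"
    by auto
  also have "prob \<dots> = (\<Sum>j<h (Suc l) + 1 - N. prob {x \<in> G\<^sub>0. s (Suc l) x = j})"
  proof (rule finite_measure_finite_Union)
    show "disjoint_family_on (\<lambda>j. {x \<in> G\<^sub>0. s (Suc l) x = j}) {..<h (Suc l) + 1 - N}"
      by (auto simp: disjoint_family_on_def)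
  qed auto
  also have "\<dots> = (\<Sum>j<h (Suc l) + 1 - N. 1 / h (Suc l))"
    by (rule sum.cong[OF refl prob_s]) (use N h_pos[of l] in auto)
  also have "\<dots> = (h (Suc l) + 1 - N) / h (Suc l)" by simp
  \<comment> \<open>There are \<open>h (Suc l) + 1 - N\<close> admissible starting heights. If N is
    larger than that allows, the truncated difference is 0 and the real one is negative.\<close>
  also have "\<dots> \<ge> (real (h (Suc l)) - N) / h (Suc l)" by (intro divide_right_mono) auto
  also have "(real (h (Suc l)) - N) / h (Suc l) = 1 - real (k + 1) / real (q l)"
    unfolding N using h_pos[of l] q_pos[of l] by (simp add: h_Suc field_simps)
  finally show ?thesis by (simp add: add.commute)
qed

text \<open>For fixed k and growing l, windows that leave their tower have probability at most (k +
  1) / \<open>q l\<close>, which tends to 0. The other windows yield entropy k times the rate per k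
  + 1 subtower heights; finally k tends to infinity.\<close>

lemma process_entropy_r_ge:
  assumes q: "filterlim q at_top sequentially"
  shows "rate n \<le> process_entropy M T (r (Suc n))"
proof (cases "rate n \<le> 0")
  case True
  have "0 \<le> process_entropy M T (r (Suc n))"
    by (rule LIMSEQ_le_const[OF T.process_entropy_tendsto[OF simple_function_r]]) (auto simp: rv_entropy_nonneg)
  then show ?thesis using True by simp
next
  case False
  then have rate: "0 < rate n" by simp
  let ?E = "process_entropy M T (r (Suc n))"
  have hlim: "(\<lambda>l. 1 / real (h l)) \<longlonglongrightarrow> 0" by (rule inverse_h_tendsto_0)
  have qlim: "(\<lambda>l. 1 / real (q l)) \<longlonglongrightarrow> 0"
    using tendsto_compose_filtermap
    by (intro real_tendsto_divide_at_top[OF tendsto_const] filterlim_compose[OF filterlim_real_sequentially q])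
  have k: "k / (k + 1) * rate n \<le> ?E" for k :: nat
  proof -
    define N where "N l = (k + 1) * h l" for l
    have Nlim: "filterlim N at_top sequentially"
    proof (rule filterlim_at_top_mono[OF filterlim_ident])
      have "l \<le> N l" for l
      proof -
        have "l \<le> h l" using h_ge_pow2[of l] less_exp[of l] by linarith
        then show ?thesis by (simp add: N_def)
      qed
      then show "\<forall>\<^sub>F l in sequentially. l \<le> N l" by simp
    qed
    have lim: "(\<lambda>l. rv_entropy M (itinerary T (r (Suc n)) (N l)) / N l) \<longlonglongrightarrow> ?E"
      using filterlim_compose[OF T.process_entropy_tendsto[OF simple_function_r] Nlim] .
    let ?f = "\<lambda>l. ((1 - real (k + 1) * (1 / real (q l))) * (real k * rate n) - 2 * ln 2 * (1 / real (h l))) / real (k + 1)"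
    have "(\<lambda>l. ((1 - real (k + 1) * a l) * (real k * rate n) - 2 * ln 2 * b l) / real (k + 1))
        \<longlonglongrightarrow> ((1 - real (k + 1) * 0) * (real k * rate n) - 2 * ln 2 * 0) / real (k + 1)"
      if "a \<longlonglongrightarrow> 0" "b \<longlonglongrightarrow> 0" for a b :: "nat \<Rightarrow> real"
      by (intro tendsto_divide tendsto_diff tendsto_mult tendsto_const that) simp
    from this[OF qlim hlim]
    have f1: "?f \<longlonglongrightarrow> ((1 - real (k + 1) * 0) * (real k * rate n) - 2 * ln 2 * 0) / real (k + 1)" .
    have f2: "((1 - real (k + 1) * 0) * (real k * rate n) - 2 * ln 2 * 0) / real (k + 1) = real k / real (k + 1) * rate n" by simp
    have flim: "?f \<longlonglongrightarrow> real k / real (k + 1) * rate n" using f1 unfolding f2 .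
    have "\<forall>\<^sub>F l in sequentially. 2 * k \<le> q l" using q unfolding filterlim_at_top by blast
    then have "\<forall>\<^sub>F l in sequentially. ?f l \<le> rv_entropy M (itinerary T (r (Suc n)) (N l)) / N l"
      using eventually_ge_at_top[of n]
    proof eventually_elim
      case (elim l)
      let ?G = "{x \<in> G. s (Suc l) x + N l \<le> h (Suc l)}"
      have G: "?G \<in> events" by measurable
      have hl: "0 < real (h l)" using h_pos by simp
      have pG: "1 - real (k + 1) / real (q l) \<le> prob ?G" by (rule prob_window_ge[OF N_def])
      have "prob ?G * (- ln (2 * exp (- (k * (rate n * h l))))) - ln 2 \<le> rv_entropy M (itinerary T (r (Suc n)) (N l))"
        by (rule rv_entropy_ge[OF T.simple_function_itinerary[OF simple_function_r] G _ prob_itinerary_le[OF elim(2,1) N_def]]) simp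
      moreover have "- ln (2 * exp (- (k * (rate n * h l)))) = k * (rate n * h l) - ln 2" by (simp add: ln_mult)
      ultimately have 1: "prob ?G * (k * (rate n * h l) - ln 2) - ln 2 \<le> rv_entropy M (itinerary T (r (Suc n)) (N l))"
        by simp
      have 2: "prob ?G * ln 2 \<le> ln 2" using mult_right_mono[OF prob_le_1[of ?G], of "ln 2"] by simp
      have 3: "(1 - real (k + 1) / real (q l)) * (k * (rate n * h l)) \<le> prob ?G * (k * (rate n * h l))"
        using pG rate hl by (intro mult_right_mono) auto
      have "(1 - real (k + 1) / real (q l)) * (k * (rate n * h l)) - 2 * ln 2 \<le> rv_entropy M (itinerary T (r (Suc n)) (N l))"
        using 1[unfolded right_diff_distrib[of "prob ?G"]] 2 3 by linarith
      then have "((1 - real (k + 1) / real (q l)) * (k * (rate n * h l)) - 2 * ln 2) / N l \<le> rv_entropy M (itinerary T (r (Suc n)) (N l)) / N l"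
        by (rule divide_right_mono) simp
      moreover have "((1 - real (k + 1) / real (q l)) * (k * (rate n * h l)) - 2 * ln 2) / N l = ?f l"
        unfolding N_def using hl by (simp add: field_simps)
      ultimately show ?case by simp
    qed
    then show ?thesis by (rule tendsto_le[OF sequentially_bot lim flim])
  qed
  have "(\<lambda>k. real k / real (Suc k) * rate n) \<longlonglongrightarrow> 1 * rate n"
    by (intro tendsto_mult LIMSEQ_n_over_Suc_n tendsto_const)
  then have "1 * rate n \<le> ?E"
    by (rule LIMSEQ_le_const2) (use k in \<open>auto simp: add.commute\<close>)
  then show ?thesis by simp
qed

end

section \<open>Choice of the heights\<close>

definition radix :: "(nat \<Rightarrow> nat) \<Rightarrow> nat \<Rightarrow> nat" where "radix Q k = (\<Prod>i<k. Q i)"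

definition truncate :: "(nat \<Rightarrow> nat) \<Rightarrow> nat \<Rightarrow> (nat \<Rightarrow> nat) \<Rightarrow> nat" where
  "truncate Q k x = (\<Sum>i<k. x i * radix Q i)"

lemma radix_0 [simp]: "radix Q 0 = 1" and radix_Suc: "radix Q (Suc k) = radix Q k * Q k"
  by (simp_all add: radix_def)

lemma truncate_0 [simp]: "truncate Q 0 x = 0"
  and truncate_Suc: "truncate Q (Suc k) x = truncate Q k x + x k * radix Q k"
  by (simp_all add: truncate_def)

lemma radix_dvd: "k \<le> l \<Longrightarrow> radix Q k dvd radix Q l"
  by (induction l rule: dec_induct) (simp_all add: radix_Suc dvd_mult2)

lemma radix_pos: "(\<And>i. 0 < Q i) \<Longrightarrow> 0 < radix Q k"
  by (simp add: radix_def prod_pos)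

lemma truncate_less:
  assumes "\<And>i. x i < Q i"
  shows "truncate Q k x < radix Q k"
proof (induction k)
  case (Suc k)
  have "truncate Q k x + x k * radix Q k < radix Q k * (x k + 1)" using Suc by simp
  also have "\<dots> \<le> radix Q k * Q k" by (rule mult_le_mono2) (use assms[of k] in simp)
  finally show ?case by (simp add: truncate_Suc radix_Suc)
qed simp

lemma truncate_mod:
  assumes "\<And>i. x i < Q i" "k \<le> l"
  shows "truncate Q l x mod radix Q k = truncate Q k x"
  using assms(2)
proof (induction l rule: dec_induct)
  case base
  then show ?case using truncate_less[of x Q k] assms(1) by simp
next
  case (step l)
  have "radix Q k dvd x l * radix Q l" using radix_dvd[OF step(1), of Q] by simp
  then obtain c where "x l * radix Q l = radix Q k * c" by (rule dvdE)
  then show ?case using step by (simp add: truncate_Suc)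
qed

text \<open>Residues modulo d do not depend on how many digits are read, once d divides the radix.
  Heights that are only divisors of radices thus have well-defined positions.\<close>

lemma truncate_mod_eq:
  assumes x: "\<And>i. x i < Q i" and "d dvd radix Q k" "d dvd radix Q l"
  shows "truncate Q k x mod d = truncate Q l x mod d"
proof -
  have *: "truncate Q k x mod d = truncate Q l x mod d" if "k \<le> l" "d dvd radix Q k" for k l
    using truncate_mod[of x Q k l] x that mod_mod_cancel[OF that(2), of "truncate Q l x"] by simp
  show ?thesis
  proof (cases "k \<le> l")
    case True
    then show ?thesis using assms(2) by (rule *)
  next
    case False
    then show ?thesis using assms(3) by (intro *[symmetric]) simp_all
  qed
qed

lemma truncate_odometer_map:
  assumes x: "\<And>i. x i < Q i"
  shows "truncate Q k (odometer_map Q x) = (truncate Q k x + 1) mod radix Q k"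
proof -
  let ?y = "\<lambda>n::nat. if n = 0 then 1 else 0 :: nat"
  \<comment> \<open>Conservation law of addition: result plus outgoing carry equals the old value
    plus 1. At k = 0 the summand 1 has not been read yet, as it sits in digit 0.\<close>
  have *: "truncate Q k (odometer_map Q x) + radix Q k * carry Q x ?y k = truncate Q k x + (if k = 0 then 0 else 1)"
  proof (induction k)
    case (Suc k)
    let ?c = "x k + ?y k + carry Q x ?y k"
    have o: "odometer_map Q x k = ?c mod Q k" and c: "carry Q x ?y (Suc k) = ?c div Q k"
      by (simp_all add: odometer_map_def add_with_carry_def)
    have alg1: "A + m * R + R * K * d = A + R * (m + K * d)" and alg2: "A + R * (u + v + w) = (A + R * w) + R * (u + v)"
      for A m R K d u v w :: nat by (simp_all add: algebra_simps)
    have "truncate Q (Suc k) (odometer_map Q x) + radix Q (Suc k) * carry Q x ?y (Suc k)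
        = truncate Q k (odometer_map Q x) + radix Q k * (?c mod Q k + Q k * (?c div Q k))"
      unfolding truncate_Suc radix_Suc o c by (rule alg1)
    also have "?c mod Q k + Q k * (?c div Q k) = ?c" by (rule mod_mult_div_eq)
    also have "truncate Q k (odometer_map Q x) + radix Q k * ?c
        = (truncate Q k (odometer_map Q x) + radix Q k * carry Q x ?y k) + radix Q k * (x k + ?y k)"
      by (rule alg2)
    also have "\<dots> = truncate Q k x + (if k = 0 then 0 else 1) + radix Q k * (x k + ?y k)" by (simp only: Suc)
    also have "\<dots> = truncate Q (Suc k) x + 1" by (cases "k = 0") (simp_all add: truncate_Suc algebra_simps)
    finally show ?case by (simp only: nat.distinct if_False)
  qed simp
  have odo: "odometer_map Q x i < Q i" for i
    using x[of i] by (simp add: odometer_map_def add_with_carry_def)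
  have "truncate Q k (odometer_map Q x) = (truncate Q k (odometer_map Q x) + radix Q k * carry Q x ?y k) mod radix Q k"
    using truncate_less[of "odometer_map Q x" Q k] odo by simp
  also have "\<dots> = (truncate Q k x + 1) mod radix Q k" unfolding * by (cases "k = 0") auto
  finally show ?thesis .
qed

section \<open>Divisors of the odometer and the sizes of the quotients\<close>

lemma ex_dvd_digit:
  assumes inf: "supernatural_exponent Q p = \<infinity>"
  shows "\<exists>i\<ge>k. p dvd Q i"
proof (rule ccontr)
  assume "\<not> ?thesis"
  then have "multiplicity p (Q i) = 0" if "i \<ge> k" for i using that by (simp add: not_dvd_imp_multiplicity_0)
  then have "supernatural_exponent Q p = (\<Sum>n<k. enat (multiplicity p (Q n)))"
    unfolding supernatural_exponent_def by (intro suminf_finite) (auto simp: zero_enat_def)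
  also have "\<dots> = enat (\<Sum>n<k. multiplicity p (Q n))" by (induction k) (auto simp: zero_enat_def)
  finally show False using inf by simp
qed

lemma dvd_radix_mult_power:
  assumes inf: "supernatural_exponent Q p = \<infinity>" and "d dvd radix Q k"
  shows "\<exists>l. d * p ^ e dvd radix Q l"
proof (induction e)
  case 0
  then show ?case using assms(2) by auto
next
  case (Suc e)
  then obtain l where l: "d * p ^ e dvd radix Q l" by blast
  obtain i where i: "i \<ge> l" "p dvd Q i" using ex_dvd_digit[OF inf] by blast
  have "d * p ^ e * p dvd radix Q i * Q i"
    using l i radix_dvd[OF i(1), of Q] by (intro mult_dvd_mono) (auto intro: dvd_trans)
  then have "d * p ^ Suc e dvd radix Q (Suc i)" by (simp add: radix_Suc mult_ac)
  then show ?case by blast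
qed

lemma ex_power_between:
  fixes t :: real and u p :: nat
  assumes "0 < u" "2 \<le> p" "u \<le> t"
  shows "\<exists>e. u * p ^ e \<le> t \<and> t < u * p ^ Suc e"
proof -
  obtain n where n: "t < real n" using reals_Archimedean2 by blast
  have "n < p ^ n" using assms(2) by (intro power_gt_expt) simp
  then have "real n < real (p ^ n)" by simp
  also have "\<dots> \<le> real (u * p ^ n)" using mult_le_mono1[of 1 u "p ^ n"] assms(1) by (intro of_nat_mono) simp
  finally have "t < real (u * p ^ n)" using n by linarith
  moreover have "\<not> t < real (u * p ^ 0)" using assms(3) by simp
  ultimately obtain e where "\<forall>i\<le>e. \<not> t < real (u * p ^ i)" "t < real (u * p ^ Suc e)"
    using ex_least_nat_less[of "\<lambda>e. t < real (u * p ^ e)" n] by blast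
  then show ?thesis by (intro exI[of _ e]) (auto simp: not_less)
qed

text \<open>First absorb the largest radix not exceeding d, among the first n + 1 of them, by a
  least common multiple; this costs a factor of at most d, hence at most t. Powers of p then bring
  the factor into the range from t / p to t.\<close>

lemma next_height:
  assumes Q: "\<And>i. 2 \<le> Q i" and p: "2 \<le> p" and inf: "supernatural_exponent Q p = \<infinity>"
    and d: "0 < d" "d dvd radix Q k" and t: "real d \<le> t"
  shows "\<exists>u>0. u \<le> t \<and> t < u * p \<and> (\<exists>l. d * u dvd radix Q l) \<and>
    (\<forall>j\<le>n. radix Q j \<le> d \<longrightarrow> radix Q j dvd d * u)"
proof -
  define J where "J = {j. j \<le> n \<and> radix Q j \<le> d}"
  have J: "finite J" "0 \<in> J" using d by (auto simp: J_def)
  define \<kappa> where "\<kappa> = Max J"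
  have \<kappa>: "\<kappa> \<in> J" unfolding \<kappa>_def using J by (intro Max_in) auto
  have Qpos: "0 < Q i" for i using Q[of i] by simp
  \<comment> \<open>Since the radices form a divisibility chain, absorbing the one with the largest
    index \<open>\<kappa>\<close> absorbs all earlier ones.\<close>
  define u where "u = lcm d (radix Q \<kappa>) div d"
  have du: "d * u = lcm d (radix Q \<kappa>)" unfolding u_def by simp
  have "0 < lcm d (radix Q \<kappa>)" using d radix_pos[of Q \<kappa>] Qpos by (simp add: lcm_pos_nat)
  then have u0: "0 < u" using du by (metis mult_0_right neq0_conv)
  have "lcm d (radix Q \<kappa>) \<le> d * radix Q \<kappa>"
    using d radix_pos[of Q \<kappa>] Qpos by (intro dvd_imp_le lcm_least) auto
  then have "d * u \<le> d * radix Q \<kappa>" unfolding du .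
  then have "u \<le> radix Q \<kappa>" using d(1) by simp
  also have "\<dots> \<le> d" using \<kappa> by (simp add: J_def)
  finally have "real u \<le> t" using t by linarith
  then obtain e where e: "u * p ^ e \<le> t" "t < u * p ^ Suc e" using ex_power_between[OF u0 p] by blast
  have "lcm d (radix Q \<kappa>) dvd radix Q (max k \<kappa>)"
    using d(2) radix_dvd[of k "max k \<kappa>" Q] radix_dvd[of \<kappa> "max k \<kappa>" Q] by (intro lcm_least) (auto intro: dvd_trans)
  then obtain l where "d * u * p ^ e dvd radix Q l" unfolding du using dvd_radix_mult_power[OF inf] by blast
  then have "\<exists>l. d * (u * p ^ e) dvd radix Q l" by (auto simp: mult.assoc)
  moreover have "radix Q j dvd d * (u * p ^ e)" if "j \<le> n" "radix Q j \<le> d" for j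
  proof -
    have "j \<le> \<kappa>" unfolding \<kappa>_def using J that by (intro Max_ge) (auto simp: J_def)
    then have "radix Q j dvd lcm d (radix Q \<kappa>)" using radix_dvd[of j \<kappa> Q] by (meson dvd_lcm2 dvd_trans)
    then show ?thesis unfolding du[symmetric] by (simp add: mult.assoc[symmetric] dvd_mult2)
  qed
  moreover have "0 < u * p ^ e" using u0 p by simp
  ultimately show ?thesis using e by (intro exI[of _ "u * p ^ e"]) (auto simp: mult_ac)
qed

text \<open>The quotient of consecutive heights can be prescribed up to the factor \<open>p\<close>, while the other
  prime factors are absorbed as soon as they are small compared with the height.\<close>

lemma exists_heights:
  fixes a :: "nat \<Rightarrow> real"
  assumes Q: "\<And>i. 2 \<le> Q i" and p: "2 \<le> p" and inf: "supernatural_exponent Q p = \<infinity>"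
    and a0: "0 < a 0" and a: "mono a"
  obtains h q :: "nat \<Rightarrow> nat" where "0 < h 0" "\<And>n. 2 \<le> q n" "\<And>n. h (Suc n) = h n * q n"
    "\<And>n. \<exists>k. h n dvd radix Q k" "\<And>k. \<exists>n. radix Q k dvd h n"
    "\<And>n. real (q n) * real p ^ 2 \<le> exp (a n * h n)" "\<And>n. exp (a n * h n) < real (q n) * real p ^ 3"
    "\<And>n. real p ^ 3 \<le> exp (a 0 * h n / 2)"
proof -
  \<comment> \<open>From height \<open>K\<close> on, the quadratic term (a 0 y / 2)^2 / 2 of the
    exponential series dominates p^3 y.\<close>
  define K where "K = 8 * real p ^ 3 / (a 0)\<^sup>2"
  have p1: "1 \<le> real p" using p by simp
  have big: "real p ^ 3 * y \<le> exp (a 0 * y / 2)" if "K \<le> y" "0 \<le> y" for y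
  proof -
    have "8 * real p ^ 3 \<le> y * (a 0)\<^sup>2" using that(1) a0 by (simp add: K_def pos_divide_le_eq)
    then have "8 * real p ^ 3 * y \<le> y * (a 0)\<^sup>2 * y" using that(2) by (rule mult_right_mono)
    then have "real p ^ 3 * y \<le> (a 0 * y / 2) ^ 2 / 2" by (simp add: power2_eq_square algebra_simps)
    also have "\<dots> \<le> exp (a 0 * y / 2)" using power_div_fact_le_exp[of "a 0 * y / 2" 2] that(2) a0 by (simp add: fact_numeral)
    finally show ?thesis .
  qed
  define P where "P n d \<longleftrightarrow> 0 < d \<and> (\<exists>k. d dvd radix Q k) \<and> K \<le> real d" for n d :: nat
  define R where "R n d d' \<longleftrightarrow> (\<exists>u\<ge>2. d' = d * u \<and> real u * real p ^ 2 \<le> exp (a n * d) \<and> exp (a n * d) < real u * real p ^ 3 \<and>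
    (\<forall>j\<le>n. radix Q j \<le> d \<longrightarrow> radix Q j dvd d'))" for n d d' :: nat
  have "\<exists>h. \<forall>n. P n (h n) \<and> R n (h n) (h (Suc n))"
  proof (rule dependent_nat_choice)
    obtain n where n: "K < real n" using reals_Archimedean2 by blast
    have "n < p ^ n" using p by (intro power_gt_expt) simp
    then have "real n < real (p ^ n)" by (rule of_nat_less_iff[THEN iffD2])
    then have "K \<le> real (p ^ n)" using n by linarith
    moreover have "\<exists>l. 1 * p ^ n dvd radix Q l" by (rule dvd_radix_mult_power[OF inf, of _ 0]) simp
    ultimately have "P 0 (p ^ n)" using p by (simp add: P_def)
    then show "\<exists>d. P 0 d" ..
  next
    fix d n assume "P n d"
    then obtain k where d: "0 < d" "d dvd radix Q k" "K \<le> real d" by (auto simp: P_def)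
    \<comment> \<open>The spare factor p^2 is what later makes
      \<open>fact (q n) \<le> q (Suc n)\<close> hold in spite of the uncertainty p in each
      quotient.\<close>
    define t where "t = exp (a n * d) / p ^ 2"
    have "a 0 \<le> a n" using a by (simp add: monoD)
    then have "a 0 / 2 * d \<le> a n * d" using a0 by (intro mult_right_mono) auto
    then have le: "a 0 * d / 2 \<le> a n * d" by simp
    have "real p ^ 3 * d \<le> exp (a 0 * d / 2)" by (rule big[OF d(3)]) simp
    also have "\<dots> \<le> exp (a n * d)" using le by (simp only: exp_le_cancel_iff)
    finally have E: "real p ^ 3 * d \<le> exp (a n * d)" .
    have tp: "d * p \<le> t" unfolding t_def using E p1 by (simp add: field_simps power3_eq_cube power2_eq_square)
    have "d \<le> d * p" using p by simp
    then have "real d \<le> real (d * p)" by (rule of_nat_mono)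
    then have "real d \<le> t" using tp by linarith
    from next_height[OF Q p inf d(1,2) this, of n] obtain u where
      u: "0 < u" "u \<le> t" "t < u * p" "\<exists>l. d * u dvd radix Q l" "\<forall>j\<le>n. radix Q j \<le> d \<longrightarrow> radix Q j dvd d * u"
      by blast
    have "real (d * p) < real (u * p)" using tp u(3) by linarith
    then have "d * p < u * p" by (rule of_nat_less_iff[THEN iffD1])
    then have "d < u" by simp
    then have u2: "2 \<le> u" using d(1) by simp
    have "P (Suc n) (d * u)" unfolding P_def
      using u d u2 by (auto intro: order_trans[OF d(3)])
    moreover have "R n d (d * u)" unfolding R_def
      using u u2 p1 by (intro exI[of _ u]) (auto simp: t_def field_simps power3_eq_cube power2_eq_square)
    ultimately show "\<exists>d'. P (Suc n) d' \<and> R n d d'" by blast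
  qed
  then obtain h where h: "\<And>n. P n (h n)" "\<And>n. R n (h n) (h (Suc n))" by blast
  from h(2) have "\<forall>n. \<exists>u\<ge>2. h (Suc n) = h n * u \<and> real u * real p ^ 2 \<le> exp (a n * h n) \<and> exp (a n * h n) < real u * real p ^ 3 \<and>
    (\<forall>j\<le>n. radix Q j \<le> h n \<longrightarrow> radix Q j dvd h (Suc n))" unfolding R_def by blast
  then obtain q where q: "\<And>n. 2 \<le> q n" "\<And>n. h (Suc n) = h n * q n" "\<And>n. real (q n) * real p ^ 2 \<le> exp (a n * h n)"
    "\<And>n. exp (a n * h n) < real (q n) * real p ^ 3" "\<And>n j. j \<le> n \<Longrightarrow> radix Q j \<le> h n \<Longrightarrow> radix Q j dvd h (Suc n)"
    by metis
  have hp: "0 < h n" for n using h(1)[of n] by (simp add: P_def)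
  have n_le: "n \<le> h n" for n
  proof (induction n)
    case (Suc n)
    have "h n * 2 \<le> h n * q n" using q(1)[of n] by (rule mult_le_mono2)
    then show ?case using Suc hp[of n] q(2)[of n] by linarith
  qed simp
  show ?thesis
  proof (rule that[OF hp q(1) q(2) _ _ q(3) q(4)])
    show "\<exists>k. h n dvd radix Q k" for n using h(1)[of n] by (simp add: P_def)
    show "\<exists>n. radix Q k dvd h n" for k
    proof -
      \<comment> \<open>Both conditions for absorption hold at this stage: k is at most
        \<open>?n\<close>, and \<open>radix Q k\<close> is at most
        \<open>?n \<le> h ?n\<close>.\<close>
      let ?n = "max k (radix Q k)"
      have "radix Q k \<le> h ?n" using n_le[of ?n] by simp
      then show ?thesis using q(5)[of k ?n] by auto
    qed
    show "real p ^ 3 \<le> exp (a 0 * h n / 2)" for n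
    proof -
      have "real p ^ 3 * 1 \<le> real p ^ 3 * h n" using hp[of n] by (intro mult_left_mono) auto
      also have "\<dots> \<le> exp (a 0 * h n / 2)" using h(1)[of n] by (intro big) (auto simp: P_def)
      finally show ?thesis by simp
    qed
  qed
qed

text \<open>The permutations are listed periodically in b. Each occurs at most N div m! + 1 times,
  and 1 \<le> N / m! gives the factor 2.\<close>

lemma exists_uniform_permutations:
  assumes "fact m \<le> N"
  shows "\<exists>\<pi>. (\<forall>b. \<pi> b permutes {..<m::nat}) \<and>
    (\<forall>p. p permutes {..<m} \<longrightarrow> card {b \<in> {..<N}. \<pi> b = p} \<le> 2 * real N / fact m)"
proof -
  define F :: nat where "F = fact m"
  have F: "0 < F" by (simp add: F_def)
  have "finite {p. p permutes {..<m}}" by (rule finite_permutations) simp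
  moreover have "card {p. p permutes {..<m}} = F" by (simp add: card_permutations F_def)
  ultimately obtain g where g: "bij_betw g {0..<F} {p. p permutes {..<m}}"
    using ex_bij_betw_nat_finite by metis
  define \<pi> where "\<pi> b = g (b mod F)" for b
  have 1: "\<pi> b permutes {..<m}" for b
    using bij_betwE[OF g] F by (simp add: \<pi>_def)
  have 2: "card {b \<in> {..<N}. \<pi> b = p} \<le> 2 * real N / fact m" if "p permutes {..<m}" for p
  proof -
    have "p \<in> g ` {0..<F}" using g that by (simp add: bij_betw_def)
    then obtain c where c: "c < F" "p = g c" by auto
    have "{b \<in> {..<N}. \<pi> b = p} \<subseteq> (\<lambda>d. d * F + c) ` {..N div F}"
    proof
      fix b assume b: "b \<in> {b \<in> {..<N}. \<pi> b = p}"
      then have "g (b mod F) = g c" "b mod F < F" using c F by (auto simp: \<pi>_def)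
      then have "b mod F = c" using g c by (auto simp: bij_betw_def inj_on_def)
      then have "b = (b div F) * F + c" by (metis div_mult_mod_eq)
      moreover have "b div F \<le> N div F" using b by (intro div_le_mono) auto
      ultimately show "b \<in> (\<lambda>d. d * F + c) ` {..N div F}" by blast
    qed
    then have "card {b \<in> {..<N}. \<pi> b = p} \<le> card {..N div F}"
      by (meson card_image_le card_mono finite_atMost finite_imageI order_trans)
    then have "real (card {b \<in> {..<N}. \<pi> b = p}) \<le> real (N div F) + 1" by simp
    also have "real (N div F) \<le> N / F" by (rule of_nat_div_le_of_nat)
    also have "1 \<le> real N / F"
    proof -
      have "F \<le> N" using assms by (simp add: F_def)
      then show ?thesis using F by simp
    qed
    finally show ?thesis by (simp add: F_def)
  qed
  show ?thesis using 1 2 by blast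
qed

text \<open>Raising the upper bound for \<open>q n\<close> to the power \<open>q n\<close> gives the
  exponent a n * h (n + 1). The factor p^(2 q n) gained there outweighs the p^3 lost in the lower
  bound for \<open>q (Suc n)\<close>, so even \<open>q n ^ q n\<close> is below it.\<close>

lemma fact_quotient_le_next:
  fixes a :: "nat \<Rightarrow> real" and h q :: "nat \<Rightarrow> nat" and p :: nat
  assumes a: "mono a" and p: "2 \<le> p" and q: "2 \<le> q n" "h (Suc n) = h n * q n"
    and up: "real (q n) * real p ^ 2 \<le> exp (a n * h n)" and lo: "exp (a (Suc n) * h (Suc n)) < real (q (Suc n)) * real p ^ 3"
  shows "fact (q n) \<le> (q (Suc n) :: nat)"
proof -
  have p1: "1 \<le> real p" using p by simp
  have "real (q n) ^ q n * real p ^ 3 \<le> real (q n) ^ q n * (real p ^ 2) ^ q n"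
  proof (rule mult_left_mono)
    have "real p ^ 3 \<le> real p ^ (2 * q n)" by (rule power_increasing) (use q(1) p1 in auto)
    then show "real p ^ 3 \<le> (real p ^ 2) ^ q n" by (simp add: power_mult)
  qed simp
  also have "\<dots> = (real (q n) * real p ^ 2) ^ q n" by (simp add: power_mult_distrib)
  also have "\<dots> \<le> exp (a n * h n) ^ q n"
    using up by (simp add: power_mono)
  also have "\<dots> = exp (a n * h (Suc n))" using q(2) by (simp add: exp_of_nat_mult[symmetric] mult_ac)
  also have "\<dots> \<le> exp (a (Suc n) * h (Suc n))" using a by (simp add: mult_right_mono monoD)
  also have "\<dots> < real (q (Suc n)) * real p ^ 3" by (rule lo)
  finally have "real (q n) ^ q n < q (Suc n)" using p1 by simp
  then have "real (q n ^ q n) \<le> real (q (Suc n))" by simp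
  then have "q n ^ q n \<le> q (Suc n)" by (rule of_nat_le_iff[THEN iffD1])
  moreover have "fact (q n) \<le> q n ^ q n" using fact_le_power[of "q n", where 'a = nat] by simp
  ultimately show ?thesis by (rule order_trans[rotated])
qed

section \<open>The towers generate\<close>

context tower_system
begin

text \<open>The set is the symmetric difference, within \<open>G\<^sub>0\<close>, of
  \<open>A\<close> and a union of levels. The closure properties below carry approximability from
  single digits to the generated sigma-algebra.\<close>

definition approximable :: "'a set \<Rightarrow> bool" where
  "approximable A \<longleftrightarrow> (\<forall>e>0. \<exists>n D. prob {x \<in> G\<^sub>0. x \<in> A \<longleftrightarrow> r n x \<notin> D} < e)"

lemma r_Collect_sets: "A \<in> sets M \<Longrightarrow> {x \<in> G\<^sub>0. x \<in> A \<longleftrightarrow> r n x \<notin> D} \<in> sets M"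
proof -
  assume A: "A \<in> sets M"
  have "{x \<in> G\<^sub>0. x \<in> A \<longleftrightarrow> r n x \<notin> D} = (G\<^sub>0 \<inter> A - (r n -` D \<inter> space M)) \<union> ((G\<^sub>0 - A) \<inter> (r n -` D \<inter> space M))"
    using G0_space by auto
  then show ?thesis using A G0_sets measurable_sets[OF r_measurable, of D n] by auto
qed

lemma approximable_level:
  assumes "A \<inter> G\<^sub>0 = {x \<in> G\<^sub>0. r n x \<in> D}"
  shows "approximable A"
  unfolding approximable_def
proof (intro allI impI exI)
  fix e :: real assume "0 < e"
  have empty: "{x \<in> G\<^sub>0. x \<in> A \<longleftrightarrow> r n x \<notin> D} = {}" using assms by blast
  show "prob {x \<in> G\<^sub>0. x \<in> A \<longleftrightarrow> r n x \<notin> D} < e" unfolding empty using \<open>0 < e\<close> by simp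
qed

lemma approximable_Compl:
  assumes "approximable A" "B \<inter> G\<^sub>0 = G\<^sub>0 - A"
  shows "approximable B"
  unfolding approximable_def
proof (intro allI impI)
  fix e :: real assume "0 < e"
  then obtain n D where nD: "prob {x \<in> G\<^sub>0. x \<in> A \<longleftrightarrow> r n x \<notin> D} < e"
    using assms(1) unfolding approximable_def by blast
  have "{x \<in> G\<^sub>0. x \<in> B \<longleftrightarrow> r n x \<notin> - D} = {x \<in> G\<^sub>0. x \<in> A \<longleftrightarrow> r n x \<notin> D}" using assms(2) by blast
  then have "prob {x \<in> G\<^sub>0. x \<in> B \<longleftrightarrow> r n x \<notin> - D} < e" using nD by simp
  then show "\<exists>n D. prob {x \<in> G\<^sub>0. x \<in> B \<longleftrightarrow> r n x \<notin> D} < e" by blast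
qed

lemma approximable_UN:
  fixes A :: "nat \<Rightarrow> 'a set"
  assumes A: "\<And>i. A i \<in> sets M" and approx: "\<And>i. approximable (A i)"
  shows "approximable (\<Union>i. A i)"
  unfolding approximable_def
proof (intro allI impI)
  fix e :: real assume e: "0 < e"
  define U where "U m = (\<Union>i<m. A i)" for m
  have U: "U m \<in> sets M" for m unfolding U_def using A by auto
  have UA: "(\<Union>m. U m) = (\<Union>i. A i)" unfolding U_def by auto
  have "(\<lambda>m. prob (U m)) \<longlonglongrightarrow> prob (\<Union>m. U m)"
  proof (rule finite_Lim_measure_incseq)
    have "U k \<subseteq> U l" if "k \<le> l" for k l unfolding U_def using that by (intro UN_mono) auto
    then show "incseq U" by (simp add: incseq_def)
  qed (use U in auto)
  from LIMSEQ_D[OF this, of "e / 2"] obtain m where m: "\<bar>prob (U m) - prob (\<Union>i. A i)\<bar> < e / 2"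
    unfolding UA using e by auto
  have "prob ((\<Union>i. A i) - U m) = prob (\<Union>i. A i) - prob (U m)"
    by (rule finite_measure_Diff) (use U A in \<open>auto simp: U_def\<close>)
  then have tail: "prob ((\<Union>i. A i) - U m) < e / 2" using m by linarith
  define d where "d = e / (2 * (m + 1))"
  have d: "0 < d" using e by (simp add: d_def)
  have "\<exists>n D. prob {x \<in> G\<^sub>0. x \<in> A i \<longleftrightarrow> r n x \<notin> D} < d" for i
    using approx[of i] d unfolding approximable_def by blast
  then obtain n D where nD: "\<And>i. prob {x \<in> G\<^sub>0. x \<in> A i \<longleftrightarrow> r (n i) x \<notin> D i} < d" by metis
  define N where "N = Max (n ` {..<m} \<union> {0})"
  have N: "n i \<le> N" if "i < m" for i unfolding N_def using that by (intro Max_ge) auto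
  \<comment> \<open>The finitely many approximants are expressed on the common stage
    \<open>N\<close>, as \<open>r (n i)\<close> is a residue of \<open>r N\<close>.\<close>
  define E where "E = {\<rho>. \<exists>i<m. \<rho> mod h (n i) \<in> D i}"
  let ?B = "\<lambda>i. {x \<in> G\<^sub>0. x \<in> A i \<longleftrightarrow> r (n i) x \<notin> D i}"
  have B: "?B i \<in> sets M" for i by (rule r_Collect_sets[OF A])
  have "prob {x \<in> G\<^sub>0. x \<in> (\<Union>i. A i) \<longleftrightarrow> r N x \<notin> E} \<le> prob (((\<Union>i. A i) - U m) \<union> (\<Union>i<m. ?B i))"
  proof (rule finite_measure_mono)
    show "{x \<in> G\<^sub>0. x \<in> (\<Union>i. A i) \<longleftrightarrow> r N x \<notin> E} \<subseteq> ((\<Union>i. A i) - U m) \<union> (\<Union>i<m. ?B i)"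
    proof
      fix x assume x: "x \<in> {x \<in> G\<^sub>0. x \<in> (\<Union>i. A i) \<longleftrightarrow> r N x \<notin> E}"
      then have "r N x mod h (n i) = r (n i) x" if "i < m" for i using r_mod_le[OF _ N[OF that]] by simp
      then have "r N x \<in> E \<longleftrightarrow> (\<exists>i<m. r (n i) x \<in> D i)" unfolding E_def by auto
      then show "x \<in> ((\<Union>i. A i) - U m) \<union> (\<Union>i<m. ?B i)" using x unfolding U_def by auto
    qed
    show "((\<Union>i. A i) - U m) \<union> (\<Union>i<m. ?B i) \<in> sets M"
      using U A B by (intro sets.Un sets.Diff sets.countable_UN sets.finite_UN) auto
  qed
  also have "\<dots> \<le> prob ((\<Union>i. A i) - U m) + prob (\<Union>i<m. ?B i)"
    using U A B by (intro measure_Un_le sets.Diff sets.countable_UN sets.finite_UN) auto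
  also have "prob (\<Union>i<m. ?B i) \<le> (\<Sum>i<m. prob (?B i))"
    by (rule finite_measure_subadditive_finite) (use B in auto)
  also have "\<dots> \<le> (\<Sum>i<m. d)" by (intro sum_mono less_imp_le nD)
  also have "\<dots> \<le> e / 2"
  proof -
    have "m * d \<le> (m + 1) * d" using d by (simp add: mult_right_mono)
    also have "\<dots> = e / 2" by (simp add: d_def field_simps)
    finally show ?thesis by simp
  qed
  finally have "prob {x \<in> G\<^sub>0. x \<in> (\<Union>i. A i) \<longleftrightarrow> r N x \<notin> E} < e" using tail by simp
  then show "\<exists>n D. prob {x \<in> G\<^sub>0. x \<in> (\<Union>i. A i) \<longleftrightarrow> r n x \<notin> D} < e" by blast
qed

lemma KS_entropy_T_le:
  fixes a :: real
  assumes approx: "\<And>A. A \<in> sets M \<Longrightarrow> approximable A"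
    and off: "\<And>x n. x \<in> space M \<Longrightarrow> x \<notin> G\<^sub>0 \<Longrightarrow> r n x = 0"
    and le: "\<And>n. ln (q n) \<le> a * h n"
  shows "KS_entropy M T \<le> ereal a"
proof (rule T.KS_entropy_le_generating[OF simple_function_r])
  fix m n :: nat assume mn: "m \<le> n"
  \<comment> \<open>Off \<open>G\<^sub>0\<close> both sides are 0 by \<open>off\<close>, so the
    refinement holds on the whole space.\<close>
  have "r m x = r n x mod h m" if "x \<in> space M" for x
    using r_mod_le[OF _ mn] off[OF that] by (cases "x \<in> G\<^sub>0") simp_all
  then show "\<exists>f. \<forall>x\<in>space M. r m x = f (r n x)" by (intro exI[of _ "\<lambda>\<rho>. \<rho> mod h m"]) simp
next
  fix A and e :: real assume A: "A \<in> sets M" and "0 < e"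
  then obtain n D where nD: "prob {x \<in> G\<^sub>0. x \<in> A \<longleftrightarrow> r n x \<notin> D} < e"
    using approx unfolding approximable_def by blast
  have eq: "prob {x \<in> space M. x \<in> A \<longleftrightarrow> r n x \<notin> D} = prob {x \<in> G\<^sub>0. x \<in> A \<longleftrightarrow> r n x \<notin> D}"
  proof (rule finite_measure_eq_AE)
    have "{x \<in> space M. x \<in> A \<longleftrightarrow> r n x \<notin> D} = (A - (r n -` D \<inter> space M)) \<union> ((r n -` D \<inter> space M) - A)"
      using A sets.sets_into_space by auto
    then show "{x \<in> space M. x \<in> A \<longleftrightarrow> r n x \<notin> D} \<in> events"
      using A measurable_sets[OF r_measurable, of D n] by auto
    show "AE x in M. (x \<in> {x \<in> space M. x \<in> A \<longleftrightarrow> r n x \<notin> D}) = (x \<in> {x \<in> G\<^sub>0. x \<in> A \<longleftrightarrow> r n x \<notin> D})"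
      using G0_AE by eventually_elim (use G0_space in auto)
  qed (rule r_Collect_sets[OF A])
  show "\<exists>n D. prob {x \<in> space M. x \<in> A \<longleftrightarrow> r n x \<notin> D} < e"
    by (intro exI[of _ n] exI[of _ D]) (unfold eq, rule nD)
next
  fix n
  have "process_entropy M T (r n) \<le> ln (q n) / h n" by (rule process_entropy_r_le) simp
  also have "\<dots> \<le> a" using le[of n] h_pos[of n] by (simp add: pos_divide_le_eq)
  finally show "process_entropy M T (r n) \<le> a" .
qed

end

section \<open>Measurability on the odometer space\<close>

lemma space_odometer_space: "space (odometer_space Q) = {x. \<forall>i. x i < Q i}"
  by (auto simp: odometer_space_def space_PiM PiE_def Pi_def extensional_def space_uniform_count_measure)

lemma sets_odometer_space:
  "sets (odometer_space Q) =
    sigma_sets {x. \<forall>i. x i < Q i} {{x. (\<forall>i. x i < Q i) \<and> x i \<in> A} | i A. A \<subseteq> {0..<Q i}}"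
proof -
  have "(\<Pi>\<^sub>E i\<in>UNIV. space (uniform_count_measure {0..<Q i})) = {x. \<forall>i. x i < Q i}"
    by (auto simp: PiE_def Pi_def extensional_def space_uniform_count_measure)
  then show ?thesis unfolding odometer_space_def sets_PiM_single by (simp add: sets_uniform_count_measure)
qed

lemma truncate_measurable: "truncate Q k \<in> measurable (odometer_space Q) (count_space UNIV)"
proof (induction k)
  case 0
  then show ?case by (simp add: truncate_def[abs_def])
next
  case (Suc k)
  have comp: "(\<lambda>x. x k) \<in> measurable (odometer_space Q) (uniform_count_measure {0..<Q k})"
    unfolding odometer_space_def by (rule measurable_component_singleton) simp
  have "(\<lambda>x. i + x k * radix Q k) \<in> measurable (odometer_space Q) (count_space UNIV)" for i
    by (rule measurable_compose[OF comp]) (simp add: measurable_def)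
  then have "(\<lambda>x. truncate Q k x + x k * radix Q k) \<in> measurable (odometer_space Q) (count_space UNIV)"
    by (rule measurable_compose_countable[OF _ Suc])
  then show ?case by (simp add: truncate_Suc)
qed

section \<open>Conclusion\<close>

text \<open>Turns the almost everywhere conjugacy into a pointwise one by discarding the whole
  S-orbit of every exceptional point. Measurability of \<open>\<Phi>\<close> and of its inverse lets
  measurable sets pass in both directions.\<close>

lemma odometer_coding:
  assumes S: "S \<in> Aut M" and odo: "odometer_with_digits M S Q"
  obtains G :: "'a set" and \<Phi> :: "'a \<Rightarrow> nat \<Rightarrow> nat" where
    "G \<in> sets M" "AE x in M. x \<in> G" "\<And>x k. x \<in> G \<Longrightarrow> zpow M S k x \<in> G"
    "\<And>x i. x \<in> G \<Longrightarrow> \<Phi> x i < Q i" "\<And>x. x \<in> G \<Longrightarrow> \<Phi> (S x) = odometer_map Q (\<Phi> x)"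
    "\<And>C. C \<in> sets (odometer_space Q) \<Longrightarrow> {x \<in> G. \<Phi> x \<in> C} \<in> sets M"
    "\<And>A. A \<in> sets M \<Longrightarrow> \<exists>C\<in>sets (odometer_space Q). \<forall>x\<in>G. x \<in> A \<longleftrightarrow> \<Phi> x \<in> C"
proof -
  let ?N = "odometer_space Q"
  obtain A B \<Phi> where A: "A \<in> sets M" and B: "B \<in> sets ?N" and A_AE: "AE x in M. x \<in> A"
    and bij: "bij_betw \<Phi> A B" and \<Phi>: "\<Phi> \<in> measurable (restrict_space M A) (restrict_space ?N B)"
    and inv: "inv_into A \<Phi> \<in> measurable (restrict_space ?N B) (restrict_space M A)"
    and eq: "AE x in M. S x \<in> A \<and> \<Phi> (S x) = odometer_map Q (\<Phi> x)"
    using odo unfolding odometer_with_digits_def conjugate_systems_def by blast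
  have AM: "A \<subseteq> space M" and BN: "B \<subseteq> space ?N" using A B sets.sets_into_space by auto
  have bS: "bij_betw S (space M) (space M)" by (rule Aut_bij[OF S])
  have "AE x in M. x \<in> A \<and> \<Phi> (S x) = odometer_map Q (\<Phi> x)" using A_AE eq by eventually_elim auto
  \<comment> \<open>The failure set is only known to lie in a null set; \<open>Z\<close> is a
    measurable null set that contains it.\<close>
  then obtain Z where Z: "Z \<in> null_sets M" "{x \<in> space M. \<not> (x \<in> A \<and> \<Phi> (S x) = odometer_map Q (\<Phi> x))} \<subseteq> Z"
    unfolding eventually_ae_filter by blast
  define E where "E = space M - Z"
  have E: "E \<in> sets M" using Z(1) by (auto simp: E_def)
  have E_AE: "AE x in M. x \<in> E" using AE_not_in[OF Z(1)] AE_space by eventually_elim (auto simp: E_def)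
  have EA: "x \<in> A" "\<Phi> (S x) = odometer_map Q (\<Phi> x)" if "x \<in> E" for x using that Z(2) by (auto simp: E_def)
  define G where "G = {x \<in> space M. \<forall>k. zpow M S k x \<in> E}"
  have G_eq: "G = (\<Inter>k. zpow M S k -` E \<inter> space M)" by (auto simp: G_def)
  have G: "G \<in> sets M" unfolding G_eq using measurable_sets[OF zpow_measurable[OF S] E] by (intro sets.countable_INT) auto
  have G_AE: "AE x in M. x \<in> G"
  proof -
    have "AE x in M. \<forall>k. zpow M S k x \<in> E" unfolding AE_all_countable using AE_zpow[OF S E_AE] by blast
    then show ?thesis using AE_space by eventually_elim (simp add: G_def)
  qed
  have GE: "x \<in> E" if "x \<in> G" for x
  proof -
    have "zpow M S 0 x \<in> E" using that unfolding G_def by blast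
    then show ?thesis by simp
  qed
  have G_inv: "zpow M S k x \<in> G" if "x \<in> G" for x k
    using that zpow_in_space[OF bS, of x k] zpow_add[OF bS, of x _ k, symmetric] by (auto simp: G_def)
  have \<Phi>B: "\<Phi> x \<in> B" if "x \<in> G" for x using bij_betwE[OF bij] EA(1)[OF GE[OF that]] by blast
  have meas: "{x \<in> G. \<Phi> x \<in> C} \<in> sets M" if C: "C \<in> sets ?N" for C
  proof -
    have "C \<inter> B \<in> sets (restrict_space ?N B)" using C B by (simp add: sets_restrict_space_iff sets.Int)
    then have "\<Phi> -` (C \<inter> B) \<inter> space (restrict_space M A) \<in> sets (restrict_space M A)"
      by (rule measurable_sets[OF \<Phi>])
    then have "\<Phi> -` (C \<inter> B) \<inter> A \<in> sets M" using A AM by (simp add: sets_restrict_space_iff space_restrict_space Int_absorb2)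
    then have "G \<inter> (\<Phi> -` (C \<inter> B) \<inter> A) \<in> sets M" using G by (rule sets.Int[rotated])
    also have "G \<inter> (\<Phi> -` (C \<inter> B) \<inter> A) = {x \<in> G. \<Phi> x \<in> C}" using \<Phi>B EA(1) GE by auto
    finally show ?thesis .
  qed
  have gen: "\<exists>C\<in>sets ?N. \<forall>x\<in>G. x \<in> D \<longleftrightarrow> \<Phi> x \<in> C" if D: "D \<in> sets M" for D
  proof -
    have "D \<inter> A \<in> sets (restrict_space M A)" using D A by (simp add: sets_restrict_space_iff sets.Int)
    then have "inv_into A \<Phi> -` (D \<inter> A) \<inter> space (restrict_space ?N B) \<in> sets (restrict_space ?N B)"
      by (rule measurable_sets[OF inv])
    then have C: "inv_into A \<Phi> -` (D \<inter> A) \<inter> B \<in> sets ?N"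
      using B BN by (simp add: sets_restrict_space_iff space_restrict_space Int_absorb2)
    have "x \<in> D \<longleftrightarrow> \<Phi> x \<in> inv_into A \<Phi> -` (D \<inter> A) \<inter> B" if "x \<in> G" for x
      using bij_betw_inv_into_left[OF bij, of x] EA(1)[OF GE[OF that]] \<Phi>B[OF that] by auto
    then show ?thesis using C by blast
  qed
  show ?thesis
  proof (rule that[OF G G_AE G_inv _ _ meas gen])
    show "\<Phi> x i < Q i" if "x \<in> G" for x i using \<Phi>B[OF that] BN by (auto simp: space_odometer_space)
    show "\<Phi> (S x) = odometer_map Q (\<Phi> x)" if "x \<in> G" for x by (rule EA(2)[OF GE[OF that]])
  qed
qed

text \<open>\<open>a n\<close> is the entropy aimed at on stage n: constant for finite
  \<open>\<alpha>\<close>, and n + 1 otherwise. Linear growth is slow enough for the integrability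
  estimate.\<close>

lemma exists_targets:
  fixes \<alpha> :: ereal assumes "0 < \<alpha>"
  obtains a :: "nat \<Rightarrow> real" and C :: real where "0 < a 0" "mono a" "0 \<le> C" "\<And>n. a n \<le> C + n"
    "\<And>n. \<alpha> \<noteq> \<infinity> \<Longrightarrow> ereal (a n) = \<alpha>" "(\<lambda>n. ereal (a n)) \<longlonglongrightarrow> \<alpha>"
proof (cases \<alpha>)
  case (real x)
  then show ?thesis using assms by (intro that[of "\<lambda>_. x" x]) (auto simp: mono_def)
next
  case PInf
  have "(\<lambda>n. ereal (real (Suc n))) \<longlonglongrightarrow> \<infinity>"
    using LIMSEQ_Suc[OF id_nat_ereal_tendsto_PInf] by simp
  then show ?thesis using PInf by (intro that[of "\<lambda>n. real (Suc n)" 1]) (auto simp: mono_def)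
next
  case MInf
  then show ?thesis using assms by simp
qed

theorem theorem2:
  fixes M :: "'a measure" and \<alpha> :: ereal and S :: "'a \<Rightarrow> 'a"
    and q :: "nat \<Rightarrow> nat" and p_star :: nat
  assumes "standard_atomless_prob_space M"
    and "0 < \<alpha>"
    and "S \<in> Aut M"
    and "odometer_with_digits M S q"
    and "prime p_star"
    and "supernatural_exponent q p_star = \<infinity>"
  shows "\<exists>T\<in>Aut M. KS_entropy M T = \<alpha> \<and>
           (\<exists>\<Psi>. orbit_equivalence M S T \<Psi> \<and>
                (\<forall>m. integrable_orbit_equivalence (phi m) M S T \<Psi>))"
proof -
  let ?N = "odometer_space q"
  have q2: "\<And>n. 2 \<le> q n" using assms(4) by (simp add: odometer_with_digits_def)
  have p2: "2 \<le> p_star" using assms(5) by (rule prime_ge_2_nat)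
  obtain G \<Phi> where G: "G \<in> sets M" "AE x in M. x \<in> G" "\<And>x k. x \<in> G \<Longrightarrow> zpow M S k x \<in> G"
    and \<Phi>_less: "\<And>x i. x \<in> G \<Longrightarrow> \<Phi> x i < q i" and \<Phi>_S: "\<And>x. x \<in> G \<Longrightarrow> \<Phi> (S x) = odometer_map q (\<Phi> x)"
    and \<Phi>_sets: "\<And>C. C \<in> sets ?N \<Longrightarrow> {x \<in> G. \<Phi> x \<in> C} \<in> sets M"
    and \<Phi>_gen: "\<And>A. A \<in> sets M \<Longrightarrow> \<exists>C\<in>sets ?N. \<forall>x\<in>G. x \<in> A \<longleftrightarrow> \<Phi> x \<in> C"
    using odometer_coding[OF assms(3,4)] by blast
  have GM: "G \<subseteq> space M" using G(1) sets.sets_into_space by auto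
  obtain a :: "nat \<Rightarrow> real" and C :: real where a: "0 < a 0" "mono a" and C: "0 \<le> C" "\<And>n. a n \<le> C + n"
    and a_eq: "\<And>n. \<alpha> \<noteq> \<infinity> \<Longrightarrow> ereal (a n) = \<alpha>"
    and a_lim: "(\<lambda>n. ereal (a n)) \<longlonglongrightarrow> \<alpha>"
    using exists_targets[OF assms(2)] by blast
  obtain h k :: "nat \<Rightarrow> nat" where h: "0 < h 0" "\<And>n. 2 \<le> k n" "\<And>n. h (Suc n) = h n * k n"
    and h_dvd: "\<And>n. \<exists>l. h n dvd radix q l" and dvd_h: "\<And>l. \<exists>n. radix q l dvd h n"
    and up: "\<And>n. real (k n) * real p_star ^ 2 \<le> exp (a n * h n)"
    and lo: "\<And>n. exp (a n * h n) < real (k n) * real p_star ^ 3"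
    and p_h: "\<And>n. real p_star ^ 3 \<le> exp (a 0 * h n / 2)"
    using exists_heights[OF q2 p2 assms(6) a] by blast
  have "fact (k n) \<le> k (Suc n)" for n
    by (rule fact_quotient_le_next[OF a(2) p2 h(2,3) up lo])
  then have "\<forall>n. \<exists>\<pi>. (\<forall>b. \<pi> b permutes {..<k n}) \<and>
      (\<forall>p. p permutes {..<k n} \<longrightarrow> card {b \<in> {..<k (Suc n)}. \<pi> b = p} \<le> 2 * real (k (Suc n)) / fact (k n))"
    using exists_uniform_permutations by blast
  then obtain perm where perms: "\<And>n b. perm n b permutes {..<k n}"
    "\<And>n p. p permutes {..<k n} \<Longrightarrow> card {b \<in> {..<k (Suc n)}. perm n b = p} \<le> 2 * real (k (Suc n)) / fact (k n)"
    by metis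
  obtain l where l: "\<And>n. h n dvd radix q (l n)" using h_dvd by metis
  \<comment> \<open>The position modulo \<open>h n\<close>, read from enough digits. The value 0 off
    \<open>G\<close> keeps \<open>r n x < h n\<close> everywhere and makes \<open>r m\<close> a
    function of a finer \<open>r n\<close> on the whole space.\<close>
  define r where "r n x = (if x \<in> G then truncate q (l n) (\<Phi> x) mod h n else 0)" for n x
  interpret prob_space M using assms(1) by (simp add: standard_atomless_prob_space_def)
  interpret digit_system h k perm by unfold_locales (use h perms in auto)
  have r_eq: "r n x mod d = truncate q j (\<Phi> x) mod d" if "x \<in> G" "d dvd h n" "d dvd radix q j" for n x d j
  proof -
    have "r n x mod d = truncate q (l n) (\<Phi> x) mod d" unfolding r_def using that(1,2) by (simp add: mod_mod_cancel)
    also have "\<dots> = truncate q j (\<Phi> x) mod d"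
      by (rule truncate_mod_eq[OF \<Phi>_less[OF that(1)] dvd_trans[OF that(2) l] that(3)])
    finally show ?thesis .
  qed
  interpret uniform_tower_system h k perm M S G r
  proof unfold_locales
    show "S \<in> Aut M" "G \<in> sets M" "AE x in M. x \<in> G" by fact+
    show "zpow M S j x \<in> G" if "x \<in> G" for x j by (rule G(3)[OF that])
    show "r n x < h n" for n x unfolding r_def using h_pos[of n] by simp
    show "r n \<in> measurable M (count_space UNIV)" for n
    proof (rule measurableI)
      fix D :: "nat set"
      let ?C = "truncate q (l n) -` ((\<lambda>v. v mod h n) -` D) \<inter> space ?N"
      have "?C \<in> sets ?N" by (rule measurable_sets[OF truncate_measurable]) simp
      then have 1: "{x \<in> G. \<Phi> x \<in> ?C} \<in> sets M" by (rule \<Phi>_sets)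
      have "r n -` D \<inter> space M = {x \<in> G. \<Phi> x \<in> ?C} \<union> (if 0 \<in> D then space M - G else {})"
        using GM \<Phi>_less by (auto simp: r_def space_odometer_space split: if_splits)
      then show "r n -` D \<inter> space M \<in> sets M" using 1 G(1) by auto
    qed simp
    show "r (Suc n) x mod h n = r n x" if "x \<in> G" for x n
      using r_eq[OF that, of "h n" "Suc n" "l n"] l h(3) that by (simp add: r_def)
    show "r n (S x) = (r n x + 1) mod h n" if x: "x \<in> G" for x n
    proof -
      have Sx: "S x \<in> G" using G(3)[OF x, of 1] zpow_one[OF Aut_bij[OF assms(3)]] x GM by auto
      have "truncate q (l n) (\<Phi> (S x)) = (truncate q (l n) (\<Phi> x) + 1) mod radix q (l n)"
        unfolding \<Phi>_S[OF x] by (rule truncate_odometer_map[OF \<Phi>_less[OF x]])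
      then have "truncate q (l n) (\<Phi> (S x)) mod h n = (truncate q (l n) (\<Phi> x) + 1) mod h n"
        using mod_mod_cancel[OF l] by simp
      then show ?thesis using x Sx by (simp add: r_def mod_simps)
    qed
    show "card {b \<in> {..<k (Suc n)}. perm n b = p} \<le> 2 * real (k (Suc n)) / fact (k n)" if "p permutes {..<k n}" for n p
      using perms(2)[OF that] by simp
  qed
  have p1: "1 \<le> real p_star" using p2 by simp
  have ln_up: "ln (k n) \<le> a n * h n" for n
  proof -
    have "real (k n) * 1 \<le> real (k n) * real p_star ^ 2" using p1 by (intro mult_left_mono) auto
    then have "real (k n) \<le> exp (a n * h n)" using up[of n] by linarith
    then have "ln (real (k n)) \<le> ln (exp (a n * h n))" using q_pos[of n] by (subst ln_le_cancel_iff) auto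
    then show ?thesis by simp
  qed
  have ln_lo: "a n * h n - 3 * ln p_star \<le> ln (k n)" for n
  proof -
    have "ln (exp (a n * h n)) \<le> ln (real (k n) * real p_star ^ 3)" using lo[of n] q_pos[of n] p1 by (subst ln_le_cancel_iff) auto
    also have "\<dots> = ln (k n) + 3 * ln p_star" using q_pos[of n] p1 by (simp add: ln_mult ln_realpow)
    finally show ?thesis by simp
  qed
  \<comment> \<open>The heights were started so large that the loss 3 ln p is at most half of a 0 *
    h n.\<close>
  have growth: "a 0 / 2 * h n \<le> ln (k n)" for n
  proof -
    have "ln (real p_star ^ 3) \<le> ln (exp (a 0 * h n / 2))" using p_h[of n] p1 by (subst ln_le_cancel_iff) auto
    then have "3 * ln p_star \<le> a 0 * h n / 2" using p1 by (simp add: ln_realpow)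
    moreover have "a 0 * h n \<le> a n * h n" using a(2) by (simp add: monoD mult_right_mono)
    ultimately show ?thesis using ln_lo[of n] by (simp add: field_simps)
  qed
  have k_lim: "filterlim k at_top sequentially"
    unfolding filterlim_at_top
  proof
    fix Z :: nat
    have "\<forall>\<^sub>F n in sequentially. 2 * real Z / a 0 \<le> real (h n)" using filterlim_h unfolding filterlim_at_top by blast
    then show "\<forall>\<^sub>F n in sequentially. Z \<le> k n"
    proof eventually_elim
      case (elim n)
      then have "real Z \<le> a 0 / 2 * h n" using a(1) by (simp add: field_simps)
      also have "\<dots> \<le> ln (k n)" by (rule growth)
      also have "\<dots> \<le> k n" using ln_bound[of "real (k n)"] q_pos[of n] by simp
      finally show ?case by simp
    qed
  qed
  have lower: "\<alpha> \<le> KS_entropy M T"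
  proof -
    have rate_ge: "a n - (3 * ln p_star + 4) * (1 / h n) \<le> rate n" for n
    proof -
      have "(a n * h n - 3 * ln p_star - 4) / h n \<le> (ln (k n) - 4) / h n"
        using ln_lo[of n] by (intro divide_right_mono) auto
      moreover have "(a n * h n - 3 * ln p_star - 4) / h n = a n - (3 * ln p_star + 4) * (1 / h n)"
        using h_pos[of n] by (simp add: field_simps)
      moreover have "(ln (k n) - 4) / h n = rate n" by (simp add: rate_def diff_divide_distrib)
      ultimately show ?thesis by simp
    qed
    have le: "ereal (a n - (3 * ln p_star + 4) * (1 / h n)) \<le> KS_entropy M T" for n
      using rate_ge[of n] process_entropy_r_ge[OF k_lim, of n] T.process_entropy_le_KS_entropy[OF simple_function_r[of "Suc n"]]
      by (meson ereal_less_eq(3) order_trans)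
    have "(\<lambda>n. ereal ((3 * ln p_star + 4) * (1 / h n))) \<longlonglongrightarrow> ereal ((3 * ln p_star + 4) * 0)"
      by (intro tendsto_ereal tendsto_mult tendsto_const inverse_h_tendsto_0)
    then have "(\<lambda>n. ereal (a n) - ereal ((3 * ln p_star + 4) * (1 / h n))) \<longlonglongrightarrow> \<alpha> - ereal ((3 * ln p_star + 4) * 0)"
      using assms(2) by (intro tendsto_diff_ereal_general a_lim) auto
    then have "(\<lambda>n. ereal (a n - (3 * ln p_star + 4) * (1 / h n))) \<longlonglongrightarrow> \<alpha>" by simp
    then show ?thesis by (rule LIMSEQ_le_const2) (use le in blast)
  qed
  have upper: "KS_entropy M T \<le> \<alpha>"
  proof (cases "\<alpha> = \<infinity>")
    case False
    \<comment> \<open>For finite \<open>\<alpha>\<close> all targets \<open>a n\<close> coincide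
      with \<open>\<alpha>\<close>, so one bound serves every stage.\<close>
    have "KS_entropy M T \<le> ereal (a 0)"
    proof (rule KS_entropy_T_le)
      show "r n x = 0" if "x \<notin> G" for x n using that by (simp add: r_def)
      show "ln (k n) \<le> a 0 * h n" for n using ln_up[of n] a_eq[OF False, of n] a_eq[OF False, of 0] by (metis ereal.inject)
      have approx: "approximable {x \<in> G. \<Phi> x \<in> C}" if "C \<in> sets ?N" for C
        using that unfolding sets_odometer_space
      proof (induction rule: sigma_sets.induct)
        case (Basic C)
        then obtain i D where C: "C = {x. (\<forall>i. x i < q i) \<and> x i \<in> D}" by auto
        \<comment> \<open>Digit i is a function of the residue modulo
          \<open>radix q (Suc i)\<close>, which \<open>r n\<close> determines as soon as this radix
          divides \<open>h n\<close>. This is where every finite quotient of the odometer must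
          divide some height.\<close>
        obtain n where n: "radix q (Suc i) dvd h n" using dvd_h by blast
        have "\<Phi> x i = (r n x mod radix q (Suc i)) div radix q i" if x: "x \<in> G" for x
        proof -
          have "r n x mod radix q (Suc i) = truncate q (Suc i) (\<Phi> x)"
            using r_eq[OF x n, of "Suc i"] truncate_less[of "\<Phi> x" q "Suc i"] \<Phi>_less[OF x] by simp
          also have "\<dots> div radix q i = \<Phi> x i"
            using truncate_less[of "\<Phi> x" q i] \<Phi>_less[OF x] by (simp add: truncate_Suc)
          finally show ?thesis by simp
        qed
        then show ?case
          using \<Phi>_less by (intro approximable_level[of _ n "{\<rho>. (\<rho> mod radix q (Suc i)) div radix q i \<in> D}"]) (auto simp: C)
      next
        case Empty
        show ?case by (rule approximable_level[of _ 0 "{}"]) auto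
      next
        case (Compl C)
        show ?case by (rule approximable_Compl[OF Compl.IH]) (use \<Phi>_less in auto)
      next
        case (Union C)
        have "{x \<in> G. \<Phi> x \<in> C i} \<in> sets M" for i
          using Union.hyps by (intro \<Phi>_sets) (simp add: sets_odometer_space)
        then have "approximable (\<Union>i. {x \<in> G. \<Phi> x \<in> C i})" by (rule approximable_UN[OF _ Union.IH])
        moreover have "(\<Union>i. {x \<in> G. \<Phi> x \<in> C i}) = {x \<in> G. \<Phi> x \<in> (\<Union>i. C i)}" by auto
        ultimately show ?case by simp
      qed
      show "approximable A" if A: "A \<in> sets M" for A
      proof -
        obtain C where "C \<in> sets ?N" "\<forall>x\<in>G. x \<in> A \<longleftrightarrow> \<Phi> x \<in> C" using \<Phi>_gen[OF A] by blast
        then have "approximable {x \<in> G. \<Phi> x \<in> C}" "{x \<in> G. x \<in> A} = {x \<in> G. \<Phi> x \<in> C}" using approx by auto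
        moreover have "{x \<in> G. x \<in> A \<longleftrightarrow> r n x \<notin> D} = {x \<in> G. x \<in> {x \<in> G. x \<in> A} \<longleftrightarrow> r n x \<notin> D}" for n D by auto
        ultimately show ?thesis unfolding approximable_def by simp
      qed
    qed
    then show ?thesis using a_eq[OF False] by simp
  qed simp
  have ln_le: "ln (k n) \<le> (C + n) * h n" for n
    using ln_up[of n] mult_right_mono[OF C(2)[of n], of "real (h n)"] by linarith
  have "0 < a 0 / 2" using a(1) by simp
  then have "\<forall>m. integrable_orbit_equivalence (phi m) M S T (\<lambda>x. x)"
    using integrable_orbit_equivalence_id[OF _ growth C(1) ln_le] by blast
  then show ?thesis
    using T_in_Aut antisym[OF upper lower] orbit_equivalence_id by (intro bexI[of _ T]) auto
qed

end
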